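(* Let $\Sigma$ be a connected GRT-surface given by $$X=\frac{\ell'(\mu)}{2|g'|^2}\Big(T g'\overline{f'}-2g\langle g',gf'\rangle,\;-2\langle g',gf'\rangle\Big)+\ell(\mu)\,\frac{(2g,\,2-T)}{T},\qquad T=1+|g|^2,$$ where $f,g$ are holomorphic functions with $g'\neq 0$, $\ell:\mathbb{R}\to\mathbb{R}$ is a real function with $\ell'\neq 0$, and $\mu=\langle 1,f\rangle$. Then $\Sigma$ is rotational if and only if there are constants $a,b\in\mathbb{R}$ such that $\Sigma$ can be locally parameterized by $$X_{ab}(u_1,u_2)=\big(M(u_1)\cos u_2,\;M(u_1)\sin u_2,\;N(u_1)\big),$$ where $$M(u_1)=\frac{1}{1+e^{2u_1}}\left[\frac{a\,\ell'(\mu)\,(e^{-u_1}-e^{3u_1})+4\,\ell(\mu)\,e^{u_1}}{2}\right]$$ and $$N(u_1)=\frac{1}{1+e^{2u_1}}\Big[\ell(\mu)(1-e^{2u_1})-a\,\ell'(\mu)(1+e^{2u_1})\Big],$$ with $\mu=au_1+b$ in these two formulas.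
   Context: $\mathbb{R}^3$ is identified with $\mathbb{C}\times\mathbb{R}$. For complex numbers $w=w_1+iw_2$ and $v=v_1+iv_2$, $\langle w,v\rangle=w_1v_1+w_2v_2$, so $\langle 1,f\rangle=\mathrm{Re}\,f$. Primes on $f,g$ denote derivatives with respect to a local complex parameter $z=u_1+iu_2$ of a Riemann surface. The map $X$ is an immersion of this Riemann surface with non-zero Gauss–Kronecker curvature, with Gauss map $\nu=\frac{(2g,\,1-|g|^2)}{1+|g|^2}$ and support function $\langle X,\nu\rangle=\ell(\mu)$. GRT-surface (surface of generalized Ribaucour type): let a surface in $\mathbb{R}^3$ have Gauss map $\nu$, support function $\Psi(p)=\langle p,\nu(p)\rangle$, quadratic distance function $\Lambda(p)=\langle p,p\rangle$, mean curvature $H$ and Gauss curvature $K$. It is a GRT-surface if there are a function $\mu$ harmonic with respect to the third fundamental form $\langle d\nu,d\nu\rangle$ and a function $C:\mathbb{R}\to\mathbb{R}$ such that, for every point $p$ of the surface, the sphere with center $p+\left(\frac{H}{C(\mu)K}+\frac{\Psi(2-C(\mu))}{2C(\mu)}\right)\nu(p)$ and radius $\frac{H}{C(\mu)K}+\frac{\Psi(2-C(\mu))}{2C(\mu)}$ is tangent to a fixed sphere; in this case the surface satisfies $$\frac{H}{K}=C(\mu)\left(\frac{-\Lambda}{2\Psi}+\frac{\Psi}{2}\right)-\Psi .$$ For the immersion $X$ of the claim, $\mu=\langle 1,f\rangle$ and $C=\ell\ell''/(\ell')^2$. Rotational means that the surface is a surface of rotation about an axis: its sections orthogonal to the axis are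 circles centered on the axis.
   Formalization: Rotational is read locally about any axis; the surface is locally X_ab up to an orthogonal transformation of space fixing the origin, since the axis may be tilted, and points on the axis (the poles of a sphere, which X_ab never reaches) are exempt. *)

theory Defs
  imports "HOL-Analysis.Analysis"
begin

text \<open>
  Euclidean 3-space is the type \<^typ>\<open>complex \<times> real\<close>; its library inner product is
  \<open>(w, s) \<bullet> (v, t) = w \<bullet> v + s * t\<close> with \<open>w \<bullet> v = Re w * Re v + Im w * Im v\<close> on \<^typ>\<open>complex\<close>.
\<close>

type_synonym space3 = "complex \<times> real"


section \<open>Riemann surfaces\<close>

text \<open>
  The points of the surface are all the elements of a Hausdorff type; a chart is a pair of
  its domain \<open>U\<close> and its coordinate map \<open>\<phi>\<close> (relevant on \<open>U\<close> only). Connectedness is not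
  included.
\<close>

type_synonym 'a chart = "'a set \<times> ('a \<Rightarrow> complex)"

definition riemann_surface :: "'a::t2_space chart set \<Rightarrow> bool" where
  "riemann_surface A \<longleftrightarrow>
     (\<Union>(U, \<phi>)\<in>A. U) = UNIV \<and>
     (\<forall>(U, \<phi>)\<in>A. open U \<and> open (\<phi> ` U) \<and> homeomorphism U (\<phi> ` U) \<phi> (inv_into U \<phi>)) \<and>
     (\<forall>(U, \<phi>)\<in>A. \<forall>(V, \<psi>)\<in>A. (\<psi> \<circ> inv_into U \<phi>) holomorphic_on \<phi> ` (U \<inter> V))"

definition chart_image :: "'a chart \<Rightarrow> complex set" where
  "chart_image c = snd c ` fst c"

definition in_chart :: "'a chart \<Rightarrow> ('a \<Rightarrow> 'b) \<Rightarrow> complex \<Rightarrow> 'b" where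
  "in_chart c F = F \<circ> inv_into (fst c) (snd c)"

definition holomorphic_map :: "'a::t2_space chart set \<Rightarrow> ('a \<Rightarrow> complex) \<Rightarrow> bool" where
  "holomorphic_map A f \<longleftrightarrow> (\<forall>c\<in>A. in_chart c f holomorphic_on chart_image c)"


section \<open>Immersed surfaces in local coordinates\<close>

text \<open>
  \<open>pd 1\<close> and \<open>pd \<i>\<close> are the partial derivatives with respect to \<open>u\<^sub>1\<close> and \<open>u\<^sub>2\<close>, where
  \<open>z = u\<^sub>1 + \<i> u\<^sub>2\<close>.
\<close>

definition pd :: "complex \<Rightarrow> (complex \<Rightarrow> 'b::real_normed_vector) \<Rightarrow> complex \<Rightarrow> 'b" where
  "pd v F z = frechet_derivative F (at z) v"

definition C1_on :: "complex set \<Rightarrow> (complex \<Rightarrow> 'b::real_normed_vector) \<Rightarrow> bool" where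
  "C1_on D F \<longleftrightarrow> (\<forall>z\<in>D. F differentiable (at z)) \<and>
     continuous_on D (pd 1 F) \<and> continuous_on D (pd \<i> F)"

definition C2_on :: "complex set \<Rightarrow> (complex \<Rightarrow> 'b::real_normed_vector) \<Rightarrow> bool" where
  "C2_on D F \<longleftrightarrow> C1_on D F \<and> C1_on D (pd 1 F) \<and> C1_on D (pd \<i> F)"

definition immersion_on :: "complex set \<Rightarrow> (complex \<Rightarrow> space3) \<Rightarrow> bool" where
  "immersion_on D Y \<longleftrightarrow> C1_on D Y \<and> (\<forall>z\<in>D. inj (frechet_derivative Y (at z)))"

definition immersion :: "'a::t2_space chart set \<Rightarrow> ('a \<Rightarrow> space3) \<Rightarrow> bool" where
  "immersion A X \<longleftrightarrow> (\<forall>c\<in>A. immersion_on (chart_image c) (in_chart c X))"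

definition gauss_map :: "'a::t2_space chart set \<Rightarrow> ('a \<Rightarrow> space3) \<Rightarrow> ('a \<Rightarrow> space3) \<Rightarrow> bool" where
  "gauss_map A X \<nu> \<longleftrightarrow> (\<forall>p. norm (\<nu> p) = 1) \<and>
     (\<forall>c\<in>A. C1_on (chart_image c) (in_chart c \<nu>) \<and>
        (\<forall>z\<in>chart_image c. \<forall>v. pd v (in_chart c X) z \<bullet> in_chart c \<nu> z = 0))"

text \<open>
  The three fundamental forms are \<open>\<langle>dY, dY\<rangle>\<close>, \<open>- \<langle>dY, dn\<rangle>\<close> and \<open>\<langle>dn, dn\<rangle>\<close>; writing the second
  one in this way only needs first derivatives of the immersion \<open>Y\<close>.
\<close>

definition form :: "(complex \<Rightarrow> space3) \<Rightarrow> (complex \<Rightarrow> space3) \<Rightarrow> complex \<Rightarrow> complex \<Rightarrow> complex \<Rightarrow> real" where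
  "form Y Z v w z = pd v Y z \<bullet> pd w Z z"

definition gauss_curvature :: "(complex \<Rightarrow> space3) \<Rightarrow> (complex \<Rightarrow> space3) \<Rightarrow> complex \<Rightarrow> real" where
  "gauss_curvature Y n z =
     (let E = form Y Y 1 1 z; F = form Y Y 1 \<i> z; G = form Y Y \<i> \<i> z;
          L = - form Y n 1 1 z; M = - form Y n 1 \<i> z; N = - form Y n \<i> \<i> z
      in (L * N - M\<^sup>2) / (E * G - F\<^sup>2))"

definition mean_curvature :: "(complex \<Rightarrow> space3) \<Rightarrow> (complex \<Rightarrow> space3) \<Rightarrow> complex \<Rightarrow> real" where
  "mean_curvature Y n z =
     (let E = form Y Y 1 1 z; F = form Y Y 1 \<i> z; G = form Y Y \<i> \<i> z;
          L = - form Y n 1 1 z; M = - form Y n 1 \<i> z; N = - form Y n \<i> \<i> z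
      in (L * G - 2 * M * F + N * E) / (2 * (E * G - F\<^sup>2)))"

text \<open>Laplace--Beltrami operator of the metric \<open>E du\<^sub>1\<^sup>2 + 2 F du\<^sub>1 du\<^sub>2 + G du\<^sub>2\<^sup>2\<close>.\<close>

definition laplace_beltrami ::
    "(complex \<Rightarrow> real) \<Rightarrow> (complex \<Rightarrow> real) \<Rightarrow> (complex \<Rightarrow> real) \<Rightarrow> (complex \<Rightarrow> real) \<Rightarrow> complex \<Rightarrow> real" where
  "laplace_beltrami E F G h z =
     (let W = (\<lambda>w. sqrt (E w * G w - (F w)\<^sup>2))
      in (pd 1 (\<lambda>w. (G w * pd 1 h w - F w * pd \<i> h w) / W w) z
        + pd \<i> (\<lambda>w. (E w * pd \<i> h w - F w * pd 1 h w) / W w) z) / W z)"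

definition harmonic_wrt_third_form ::
    "'a::t2_space chart set \<Rightarrow> ('a \<Rightarrow> space3) \<Rightarrow> ('a \<Rightarrow> real) \<Rightarrow> bool" where
  "harmonic_wrt_third_form A \<nu> \<mu> \<longleftrightarrow>
     (\<forall>c\<in>A. let n = in_chart c \<nu>; h = in_chart c \<mu> in
        C2_on (chart_image c) h \<and>
        (\<forall>z\<in>chart_image c. laplace_beltrami (form n n 1 1) (form n n 1 \<i>) (form n n \<i> \<i>) h z = 0))"


section \<open>Surfaces of generalized Ribaucour type\<close>

text \<open>
  Two spheres are tangent if they touch in exactly one point. Radii may degenerate to 0, and
  the fixed sphere below must be allowed to be a point: the equation
  \<open>H/K = C(\<mu>) (- \<Lambda> / (2 \<Psi>) + \<Psi> / 2) - \<Psi>\<close> says that the spheres have signed radius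
  \<open>- \<Lambda> / (2 \<Psi>)\<close>, that is, that they all pass through the origin.
\<close>

definition tangent_spheres :: "space3 \<Rightarrow> real \<Rightarrow> space3 \<Rightarrow> real \<Rightarrow> bool" where
  "tangent_spheres c r d s \<longleftrightarrow> (\<exists>!x. x \<in> sphere c r \<inter> sphere d s)"

definition grt_radius :: "real \<Rightarrow> real \<Rightarrow> real \<Rightarrow> real \<Rightarrow> real" where
  "grt_radius H K \<Psi> k = H / (k * K) + \<Psi> * (2 - k) / (2 * k)"

text \<open>
  The quantity \<open>grt_radius\<close> can be negative; the radius proper is its absolute value.
\<close>

definition GRT_surface ::
    "'a::t2_space chart set \<Rightarrow> ('a \<Rightarrow> space3) \<Rightarrow> ('a \<Rightarrow> space3) \<Rightarrow> ('a \<Rightarrow> real) \<Rightarrow> (real \<Rightarrow> real) \<Rightarrow> bool" where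
  "GRT_surface A X \<nu> \<mu> C \<longleftrightarrow>
     immersion A X \<and> gauss_map A X \<nu> \<and>
     (\<forall>c\<in>A. \<forall>z\<in>chart_image c. gauss_curvature (in_chart c X) (in_chart c \<nu>) z \<noteq> 0) \<and>
     harmonic_wrt_third_form A \<nu> \<mu> \<and>
     (\<forall>p. C (\<mu> p) \<noteq> 0) \<and>
     (\<exists>x0 r0. r0 \<ge> 0 \<and>
        (\<forall>c\<in>A. \<forall>p\<in>fst c.
           let z = snd c p;
               H = mean_curvature (in_chart c X) (in_chart c \<nu>) z;
               K = gauss_curvature (in_chart c X) (in_chart c \<nu>) z;
               R = grt_radius H K (X p \<bullet> \<nu> p) (C (\<mu> p))
           in tangent_spheres (X p + R *\<^sub>R \<nu> p) \<bar>R\<bar> x0 r0))"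

text \<open>
  The immersion with data \<open>f, g, \<ell>\<close> at a point where these holomorphic functions have the
  values \<open>f, g\<close> and, with respect to some local parameter, the derivatives \<open>f', g'\<close>.
\<close>

definition grt_point :: "(real \<Rightarrow> real) \<Rightarrow> complex \<Rightarrow> complex \<Rightarrow> complex \<Rightarrow> complex \<Rightarrow> space3" where
  "grt_point l f g f' g' =
     (let T = 1 + (cmod g)\<^sup>2; \<mu> = 1 \<bullet> f in
        (deriv l \<mu> / (2 * (cmod g')\<^sup>2)) *\<^sub>R
           (of_real T * g' * cnj f' - 2 * g * of_real (g' \<bullet> (g * f')), - 2 * (g' \<bullet> (g * f')))
        + (l \<mu> / T) *\<^sub>R (2 * g, 2 - T))"

definition grt_normal :: "complex \<Rightarrow> space3" where
  "grt_normal g = (1 / (1 + (cmod g)\<^sup>2)) *\<^sub>R (2 * g, 1 - (cmod g)\<^sup>2)"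


section \<open>Rotational surfaces\<close>

text \<open>
  The circle orthogonal to the axis \<open>{x0 + t *\<^sub>R d | t}\<close>, centred at the axis point with
  parameter \<open>t\<close>; for \<open>r = 0\<close> it is a point of the axis (a pole).
\<close>

definition axis_plane :: "space3 \<Rightarrow> space3 \<Rightarrow> real \<Rightarrow> space3 set" where
  "axis_plane x0 d t = {x. (x - x0) \<bullet> d = t}"

definition axis_circle :: "space3 \<Rightarrow> space3 \<Rightarrow> real \<Rightarrow> real \<Rightarrow> space3 set" where
  "axis_circle x0 d t r = {x \<in> axis_plane x0 d t. dist (x0 + t *\<^sub>R d) x = r}"

text \<open>
  Being rotational is a local property here, since an immersed surface need not contain full
  circles: near each of its points the surface is an embedded open piece of a set \<open>Q\<close> whose
  nonempty sections orthogonal to the (common) axis are circles centred on the axis.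
\<close>

definition rotational :: "('a::t2_space \<Rightarrow> space3) \<Rightarrow> bool" where
  "rotational X \<longleftrightarrow>
     (\<exists>x0 d. norm d = 1 \<and>
        (\<forall>p. \<exists>W Q. open W \<and> p \<in> W \<and> (\<exists>Y. homeomorphism W (X ` W) X Y) \<and>
           openin (top_of_set Q) (X ` W) \<and>
           (\<forall>t. Q \<inter> axis_plane x0 d t = {} \<or>
                (\<exists>r\<ge>0. Q \<inter> axis_plane x0 d t = axis_circle x0 d t r))))"

definition profile_M :: "(real \<Rightarrow> real) \<Rightarrow> real \<Rightarrow> real \<Rightarrow> real \<Rightarrow> real" where
  "profile_M l a b u =
     (let \<mu> = a * u + b in
        1 / (1 + exp (2 * u)) *
          ((a * deriv l \<mu> * (exp (- u) - exp (3 * u)) + 4 * l \<mu> * exp u) / 2))"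

definition profile_N :: "(real \<Rightarrow> real) \<Rightarrow> real \<Rightarrow> real \<Rightarrow> real \<Rightarrow> real" where
  "profile_N l a b u =
     (let \<mu> = a * u + b in
        1 / (1 + exp (2 * u)) *
          (l \<mu> * (1 - exp (2 * u)) - a * deriv l \<mu> * (1 + exp (2 * u))))"

definition X_ab :: "(real \<Rightarrow> real) \<Rightarrow> real \<Rightarrow> real \<Rightarrow> complex \<Rightarrow> space3" where
  "X_ab l a b z =
     (Complex (profile_M l a b (Re z) * cos (Im z)) (profile_M l a b (Re z) * sin (Im z)),
      profile_N l a b (Re z))"

text \<open>
  \<open>Y\<close> restricted to a suitable open set \<open>D\<close> is a regular parametrization of a neighbourhood
  of \<open>p\<close> in the immersed surface \<open>X\<close>.
\<close>

definition parametrizes_near :: "('a::t2_space \<Rightarrow> space3) \<Rightarrow> (complex \<Rightarrow> space3) \<Rightarrow> 'a \<Rightarrow> bool" where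
  "parametrizes_near X Y p \<longleftrightarrow>
     (\<exists>D W \<theta> \<theta>'. open D \<and> open W \<and> p \<in> W \<and> immersion_on D Y \<and>
        homeomorphism D W \<theta> \<theta>' \<and> (\<forall>z\<in>D. X (\<theta> z) = Y z))"

text \<open>
  Up to an orthogonal transformation \<open>R\<close> of the ambient space (choice of the direction of the
  axis), \<open>X\<close> is locally parametrized by \<open>X_ab\<close>, with the same \<open>R\<close>, \<open>a\<close>, \<open>b\<close> everywhere.
  Points on the axis, where polar coordinates break down, are exempt: for \<open>a = 0\<close> the surface
  is a piece of a sphere and may contain the poles, which \<open>X_ab\<close> does not reach.
\<close>

definition locally_X_ab ::
    "('a::t2_space \<Rightarrow> space3) \<Rightarrow> (real \<Rightarrow> real) \<Rightarrow> (space3 \<Rightarrow> space3) \<Rightarrow> real \<Rightarrow> real \<Rightarrow> bool" where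
  "locally_X_ab X l R a b \<longleftrightarrow>
     (\<forall>p. X p \<notin> range (\<lambda>t. R (0, t)) \<longrightarrow> parametrizes_near X (R \<circ> X_ab l a b) p)"

end

theory Submission
  imports Defs "HOL-Complex_Analysis.Complex_Analysis"
begin

text \<open>
  Write \<open>\<nu>\<close> for the Gauss map and \<open>p = f' / g'\<close>. The immersion is \<open>X = grad \<psi> + \<psi> \<nu>\<close>, where
  \<open>\<psi> = l(\<mu>)\<close> is the support function, seen as a function on the unit sphere, and the gradient
  is \<open>l'(\<mu>) / 2\<close> times \<open>grad_vec g p\<close>. For a vector \<open>d\<close>, rotation about \<open>d\<close> moves the sphere with
  velocity \<open>d \<times> \<nu>\<close>, which in the stereographic coordinate is the holomorphic vector field
  \<open>rot_field d\<close>. Hence \<open>X \<bullet> (d \<times> \<nu>) = l'(\<mu>) Re F\<close> with \<open>F = p * rot_field d g\<close> (lemma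
  \<open>X_axial\<close>; \<open>F\<close> is called \<open>axial d\<close>), and \<open>F\<close> is holomorphic on the whole Riemann surface.

  The theorem turns on the condition \<open>Re F = 0\<close> for a unit vector \<open>d\<close>: the position vector, \<open>d\<close>
  and the normal are coplanar. By the identity theorem, if it holds on some nonempty open set then
  \<open>F\<close> is a constant \<open>\<i> a\<close> with \<open>a\<close> real, because the surface is connected. In the coordinate
  \<open>\<zeta> = log M(g)\<close>, where \<open>M\<close> is the Moebius transformation of a rotation that makes \<open>d\<close> vertical,
  \<open>F = \<i> df/d\<zeta>\<close>. So \<open>F = \<i> a\<close> means \<open>f = a \<zeta> + const\<close>, and inserting this into the immersion gives
  exactly the rotated \<open>X_ab\<close>. At the poles \<open>F\<close> vanishes; if there are any, then \<open>a = 0\<close>, \<open>f\<close> is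
  constant and the surface is a piece of a sphere about the origin. This shows that \<open>F = \<i> a\<close>
  implies both sides of the equivalence (lemma \<open>constant_axial_imp\<close>).

  Conversely, each side yields \<open>Re F = 0\<close> for some \<open>d\<close>. For \<open>X_ab\<close> this is the coplanarity of a
  meridian with the normal along it. For a rotational surface with axis \<open>x0 + t d\<close>, the circles
  through a point give \<open>(X - x0) \<bullet> (d \<times> \<nu>) = 0\<close>, which is the wanted condition only if the axis
  passes through the origin. Otherwise, in Mercator coordinates \<open>\<zeta> = u + \<i> v\<close> of the sphere,
  \<open>\<psi> = h(u) + y(v) / cosh u\<close> with a nonzero sinusoidal \<open>y\<close>. As \<open>\<mu>\<close> is harmonic, the quotient
  \<open>\<Delta>\<psi> / |\<nabla>\<psi>|\<^sup>2 = l''(\<mu>) / l'(\<mu>)\<^sup>2\<close> depends on the value of \<open>\<psi>\<close> only; but on each parallel \<open>u = const\<close>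
  it is a rational function of \<open>\<psi>\<close> with coefficients made from \<open>h\<close>. Comparing two parallels forces
  \<open>h = r + m tanh u\<close>, the support function of a round sphere. A sphere is also rotational about
  the line through the origin and its centre, so \<open>Re F = 0\<close> for the direction of that line, at
  first on an open set and then everywhere (lemmas \<open>off_axis_surface_is_sphere\<close>,
  \<open>axis_through_origin\<close>).
\<close>

section \<open>The immersion as gradient plus support function\<close>
definition cross :: "space3 \<Rightarrow> space3 \<Rightarrow> space3" where
  "cross x y = (\<i> * (of_real (snd x) * fst y - of_real (snd y) * fst x), Im (cnj (fst x) * fst y))"

text \<open>
  The velocity field, in the stereographic coordinate \<open>g\<close> of the Gauss map, of the rotation of the
  sphere about \<open>d\<close> with angular velocity \<open>d\<close>; for the vertical axis it is \<open>\<i> g\<close>.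
\<close>
definition rot_field :: "space3 \<Rightarrow> complex \<Rightarrow> complex" where
  "rot_field d g = (\<i> / 2) * (cnj (fst d) * g\<^sup>2 + 2 * of_real (snd d) * g - fst d)"

text \<open>
  Twice the spherical gradient of \<open>Re f\<close>, as a function of \<open>p = f' / g'\<close>. Only this quotient
  enters, which is why the immersion does not depend on the local parameter.
\<close>
definition grad_vec :: "complex \<Rightarrow> complex \<Rightarrow> space3" where
  "grad_vec g p = (cnj p - g\<^sup>2 * p, - 2 * Re (g * p))"

text \<open>
  For \<open>|\<alpha>|\<^sup>2 + |\<beta>|\<^sup>2 = 1\<close>, the action on space of the special unitary matrix with first row \<open>\<alpha>, \<beta>\<close>; \<open>moebius \<alpha> \<beta>\<close> below is its
  action on the stereographic coordinate.
\<close>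
definition rotation :: "complex \<Rightarrow> complex \<Rightarrow> space3 \<Rightarrow> space3" where
  "rotation \<alpha> \<beta> x = (\<alpha>\<^sup>2 * fst x - \<beta>\<^sup>2 * cnj (fst x) + 2 * \<alpha> * \<beta> * of_real (snd x),
     ((cmod \<alpha>)\<^sup>2 - (cmod \<beta>)\<^sup>2) * snd x - 2 * Re (\<alpha> * cnj \<beta> * fst x))"

definition moebius :: "complex \<Rightarrow> complex \<Rightarrow> complex \<Rightarrow> complex" where
  "moebius \<alpha> \<beta> w = (\<alpha> * w + \<beta>) / (cnj \<alpha> - cnj \<beta> * w)"

lemma inner_space3: "(x::space3) \<bullet> y = Re (fst x) * Re (fst y) + Im (fst x) * Im (fst y) + snd x * snd y"
  by (simp add: inner_prod_def inner_complex_def)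

lemma one_plus_cmod2_pos: "1 + (cmod z)\<^sup>2 > 0"
  by (simp add: add_pos_nonneg)

lemma grt_point_eq:
  assumes "g' \<noteq> 0"
  shows "grt_point l f g f' g' =
    (deriv l (Re f) / 2) *\<^sub>R grad_vec g (f' / g') + l (Re f) *\<^sub>R grt_normal g"
proof -
  define p where "p = f' / g'"
  have f': "f' = p * g'" using assms by (simp add: p_def)
  have nz: "(cmod g')\<^sup>2 \<noteq> 0" using assms by simp
  have i: "g' \<bullet> (g * f') = (cmod g')\<^sup>2 * Re (g * p)"
    unfolding f' inner_complex_def cmod_power2 by (simp add: algebra_simps power2_eq_square)
  have c: "of_real (1 + (cmod g)\<^sup>2) * g' * cnj f' = of_real ((cmod g')\<^sup>2) * (of_real (1 + (cmod g)\<^sup>2) * cnj p)"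
    unfolding f' complex_cnj_mult complex_norm_square by (simp add: algebra_simps)
  have w: "of_real (1 + (cmod g)\<^sup>2) * cnj p - 2 * g * of_real (Re (g * p)) = cnj p - g\<^sup>2 * p"
    unfolding complex_eq_iff cmod_power2 by (simp add: algebra_simps power2_eq_square)
  have "(deriv l (1 \<bullet> f) / (2 * (cmod g')\<^sup>2)) *\<^sub>R
           (of_real (1 + (cmod g)\<^sup>2) * g' * cnj f' - 2 * g * of_real (g' \<bullet> (g * f')), - 2 * (g' \<bullet> (g * f')))
     = (deriv l (Re f) / (2 * (cmod g')\<^sup>2)) *\<^sub>R ((cmod g')\<^sup>2 *\<^sub>R grad_vec g p)"
    unfolding c i grad_vec_def w[symmetric]
    by (simp add: inner_complex_def scaleR_conv_of_real algebra_simps)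
  also have "\<dots> = (deriv l (Re f) / 2) *\<^sub>R grad_vec g p"
    using nz by simp
  finally show ?thesis
    unfolding grt_point_def Let_def p_def
    by (simp add: grt_normal_def inner_complex_def)
qed

lemma grt_normal_unit: "grt_normal g \<bullet> grt_normal g = 1"
proof -
  have "(2 * g, 1 - (cmod g)\<^sup>2) \<bullet> (2 * g, 1 - (cmod g)\<^sup>2) = (1 + (cmod g)\<^sup>2)\<^sup>2"
    unfolding inner_space3 cmod_power2 by (simp add: algebra_simps power2_eq_square)
  thus ?thesis
    using one_plus_cmod2_pos[of g]
    unfolding grt_normal_def inner_scaleR_left inner_scaleR_right by (simp add: power2_eq_square)
qed

text \<open>
  The derivative of \<open>Re f\<close> along the rotation field: the gradient paired with the velocity \<open>d \<times> \<nu>\<close>.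
\<close>
lemma grad_vec_cross: "grad_vec g p \<bullet> cross d (grt_normal g) = 2 * Re (p * rot_field d g)"
proof -
  have "grad_vec g p \<bullet> cross d (2 * g, 1 - (cmod g)\<^sup>2) = (1 + (cmod g)\<^sup>2) * (2 * Re (p * rot_field d g))"
    unfolding inner_space3 grad_vec_def cross_def rot_field_def cmod_power2
    by (simp add: field_simps power2_eq_square)
  moreover have "cross d (c *\<^sub>R x) = c *\<^sub>R cross d x" for c x
    by (simp add: cross_def scaleR_conv_of_real algebra_simps)
  ultimately show ?thesis
    using one_plus_cmod2_pos[of g]
    unfolding grt_normal_def inner_scaleR_right by (simp del: scaleR_Pair)
qed

text \<open>
  The gradient determines \<open>p\<close>. This is what makes \<open>f' / g'\<close> a function on the surface that is defined
  without reference to charts.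
\<close>
lemma grad_vec_inverse: "cnj (fst (grad_vec g p) - g * of_real (snd (grad_vec g p))) = of_real (1 + (cmod g)\<^sup>2) * p"
  unfolding grad_vec_def complex_eq_iff cmod_power2
  by (simp add: algebra_simps power2_eq_square)

lemma cross_self_inner: "y \<bullet> cross x y = 0" "x \<bullet> cross x y = 0"
  by (simp_all add: inner_space3 cross_def algebra_simps)

lemma cross_swap: "z \<bullet> cross x y = - (y \<bullet> cross x z)"
  by (simp add: inner_space3 cross_def algebra_simps)

text \<open>
  Three vectors orthogonal to a common nonzero vector have vanishing triple product, by the identity
  that expands a vector in the dual basis.
\<close>
lemma coplanar:
  assumes "n \<noteq> 0" "x \<bullet> n = 0" "y \<bullet> n = 0" "z \<bullet> n = 0"
  shows "z \<bullet> cross x y = 0"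
proof -
  have i: "(z \<bullet> cross x y) *\<^sub>R n =
    (z \<bullet> n) *\<^sub>R cross x y + (x \<bullet> n) *\<^sub>R cross y z + (y \<bullet> n) *\<^sub>R cross z x"
    by (simp add: prod_eq_iff complex_eq_iff inner_space3 cross_def algebra_simps)
  show ?thesis using assms i by simp
qed

section \<open>Rotations and Moebius transformations\<close>
context
  fixes \<alpha> \<beta> :: complex
  assumes unit: "(cmod \<alpha>)\<^sup>2 + (cmod \<beta>)\<^sup>2 = 1"
begin

lemma unit_cnj: "\<alpha> * cnj \<alpha> + \<beta> * cnj \<beta> = 1"
  using unit by (metis complex_norm_square of_real_1 of_real_add)

lemma rotation_inverse: "rotation (cnj \<alpha>) (- \<beta>) (rotation \<alpha> \<beta> x) = x"
proof -
  obtain a b c d u v t where e: "\<alpha> = Complex a b" "\<beta> = Complex c d" "x = (Complex u v, t)"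
    by (metis complex.collapse surj_pair)
  have s: "a\<^sup>2 + b\<^sup>2 + c\<^sup>2 + d\<^sup>2 = 1" using unit by (simp add: e cmod_power2)
  hence s2: "(a\<^sup>2 + b\<^sup>2 + c\<^sup>2 + d\<^sup>2)^2 = 1" by simp
  have "rotation (cnj \<alpha>) (- \<beta>) (rotation \<alpha> \<beta> x) = ((a\<^sup>2 + b\<^sup>2 + c\<^sup>2 + d\<^sup>2)^2) *\<^sub>R x"
    unfolding rotation_def prod_eq_iff complex_eq_iff e cmod_power2
    by (simp add: power2_eq_square algebra_simps)
  thus ?thesis using s2 by simp
qed

lemma rotation_orthogonal: "orthogonal_transformation (rotation \<alpha> \<beta>)"
proof -
  obtain a b c d  where e: "\<alpha> = Complex a b" "\<beta> = Complex c d"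
    by (metis complex.collapse)
  have s: "a\<^sup>2 + b\<^sup>2 + c\<^sup>2 + d\<^sup>2 = 1" using unit by (simp add: e cmod_power2)
  hence s2: "(a\<^sup>2 + b\<^sup>2 + c\<^sup>2 + d\<^sup>2)^2 = 1" by simp
  have "rotation \<alpha> \<beta> x \<bullet> rotation \<alpha> \<beta> y = (a\<^sup>2 + b\<^sup>2 + c\<^sup>2 + d\<^sup>2)^2 * (x \<bullet> y)" for x y
    unfolding rotation_def inner_space3 e cmod_power2
    by (simp add: power2_eq_square algebra_simps)
  moreover have "linear (rotation \<alpha> \<beta>)"
    by (rule linearI) (simp_all add: rotation_def prod_eq_iff complex_eq_iff algebra_simps)
  ultimately show ?thesis unfolding orthogonal_transformation_def s2 by simp
qed

lemma one_plus_cmod2_moebius: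
  assumes "cnj \<alpha> - cnj \<beta> * w \<noteq> 0"
  shows "1 + (cmod (moebius \<alpha> \<beta> w))\<^sup>2 = (1 + (cmod w)\<^sup>2) / (cmod (cnj \<alpha> - cnj \<beta> * w))\<^sup>2"
proof -
  let ?D = "cnj \<alpha> - cnj \<beta> * w"
  have nz: "(cmod ?D)\<^sup>2 \<noteq> 0" using assms by simp
  have "(cmod ?D)\<^sup>2 + (cmod (\<alpha> * w + \<beta>))\<^sup>2 = ((cmod \<alpha>)\<^sup>2 + (cmod \<beta>)\<^sup>2) * (1 + (cmod w)\<^sup>2)"
    unfolding cmod_power2 by (simp add: algebra_simps power2_eq_square)
  thus ?thesis using nz unit by (simp add: moebius_def norm_divide power_divide field_simps)
qed

lemma grt_normal_moebius:
  assumes "cnj \<alpha> - cnj \<beta> * w \<noteq> 0"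
  shows "grt_normal (moebius \<alpha> \<beta> w) = rotation \<alpha> \<beta> (grt_normal w)"
proof -
  let ?D = "cnj \<alpha> - cnj \<beta> * w" and ?E = "\<alpha> * w + \<beta>"
  have nz: "(cmod ?D)\<^sup>2 \<noteq> 0" using assms by simp
  have lin: "rotation \<alpha> \<beta> (c *\<^sub>R x) = c *\<^sub>R rotation \<alpha> \<beta> x" for c x
    by (simp add: rotation_def prod_eq_iff complex_eq_iff algebra_simps)
  have 1: "rotation \<alpha> \<beta> (2 * w, 1 - (cmod w)\<^sup>2) = (2 * ?E * cnj ?D, (cmod ?D)\<^sup>2 - (cmod ?E)\<^sup>2)"
    unfolding rotation_def prod_eq_iff complex_eq_iff cmod_power2
    by (simp add: algebra_simps power2_eq_square)
  have 2: "?E * cnj ?D = (cmod ?D)\<^sup>2 *\<^sub>R moebius \<alpha> \<beta> w"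
    unfolding moebius_def scaleR_conv_of_real complex_norm_square using assms by simp
  have 3: "(cmod ?D)\<^sup>2 - (cmod ?E)\<^sup>2 = (cmod ?D)\<^sup>2 * (1 - (cmod (moebius \<alpha> \<beta> w))\<^sup>2)"
    using nz by (simp add: moebius_def norm_divide power_divide field_simps)
  have 4: "rotation \<alpha> \<beta> (2 * w, 1 - (cmod w)\<^sup>2)
     = (cmod ?D)\<^sup>2 *\<^sub>R (2 * moebius \<alpha> \<beta> w, 1 - (cmod (moebius \<alpha> \<beta> w))\<^sup>2)"
    unfolding 1 3 using arg_cong[OF 2, of "\<lambda>x. 2 * x"] by (simp add: mult.assoc scaleR_conv_of_real algebra_simps del: complex_cnj_diff complex_cnj_mult)
  show ?thesis
    unfolding grt_normal_def lin 4 one_plus_cmod2_moebius[OF assms] by simp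
qed

text \<open>
  The derivative of the Moebius transformation is the inverse square of the denominator, so the factor on \<open>p\<close>
  is the chain rule for \<open>f' / g'\<close>. Together with the same law for \<open>grt_normal\<close> this makes the immersion
  equivariant under rotations.
\<close>
lemma grad_vec_moebius:
  assumes "cnj \<alpha> - cnj \<beta> * w \<noteq> 0"
  shows "grad_vec (moebius \<alpha> \<beta> w) (p * (cnj \<alpha> - cnj \<beta> * w)\<^sup>2) = rotation \<alpha> \<beta> (grad_vec w p)"
proof -
  let ?D = "cnj \<alpha> - cnj \<beta> * w" and ?E = "\<alpha> * w + \<beta>"
  have "(moebius \<alpha> \<beta> w)\<^sup>2 * (p * ?D\<^sup>2) = ?E\<^sup>2 * p" and "moebius \<alpha> \<beta> w * (p * ?D\<^sup>2) = ?E * ?D * p"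
    using assms unfolding moebius_def power_divide by (simp_all add: power2_eq_square)
  hence "grad_vec (moebius \<alpha> \<beta> w) (p * ?D\<^sup>2) = (cnj (p * ?D\<^sup>2) - ?E\<^sup>2 * p, - 2 * Re (?E * ?D * p))"
    unfolding grad_vec_def by (simp only:)
  also have "\<dots> = rotation \<alpha> \<beta> (grad_vec w p)"
    unfolding rotation_def grad_vec_def prod_eq_iff complex_eq_iff cmod_power2
    by (simp add: algebra_simps power2_eq_square)
  finally show ?thesis .
qed

lemma rot_field_moebius:
  assumes "cnj \<alpha> - cnj \<beta> * w \<noteq> 0"
  shows "rot_field (rotation \<alpha> \<beta> d) (moebius \<alpha> \<beta> w) * (cnj \<alpha> - cnj \<beta> * w)\<^sup>2 = rot_field d w"
proof -
  let ?D = "cnj \<alpha> - cnj \<beta> * w" and ?E = "\<alpha> * w + \<beta>"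
  have R2: "2 * of_real (snd (rotation \<alpha> \<beta> d)) = 2 * (\<alpha> * cnj \<alpha> - \<beta> * cnj \<beta>) * of_real (snd d)
     - 2 * (\<alpha> * cnj \<beta> * fst d + cnj \<alpha> * \<beta> * cnj (fst d))"
    unfolding rotation_def complex_norm_square[symmetric]
    by (simp add: complex_eq_iff algebra_simps)
  have ring: "(a'\<^sup>2 * e' - b'\<^sup>2 * e + 2 * a' * b' * t) * (a * w + b)\<^sup>2
     + (2 * (a * a' - b * b') * t - 2 * (a * b' * e + a' * b * e')) * (a * w + b) * (a' - b' * w)
     - (a\<^sup>2 * e - b\<^sup>2 * e' + 2 * a * b * t) * (a' - b' * w)\<^sup>2
     = (a * a' + b * b')\<^sup>2 * (e' * w\<^sup>2 + 2 * t * w - e)" for a a' b b' e e' t w :: complex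
    by (simp add: algebra_simps power2_eq_square)
  have "rot_field (rotation \<alpha> \<beta> d) (moebius \<alpha> \<beta> w) * ?D\<^sup>2 =
   (\<i> / 2) * (cnj (fst (rotation \<alpha> \<beta> d)) * ?E\<^sup>2 + 2 * of_real (snd (rotation \<alpha> \<beta> d)) * ?E * ?D - fst (rotation \<alpha> \<beta> d) * ?D\<^sup>2)"
  proof -
    have "(\<i> / 2) * (A * (E / D)\<^sup>2 + 2 * B * (E / D) - C) * D\<^sup>2 = (\<i> / 2) * (A * E\<^sup>2 + 2 * B * E * D - C * D\<^sup>2)"
      if "D \<noteq> 0" for A B C D E :: complex
      using that by (simp add: field_simps power2_eq_square)
    thus ?thesis unfolding moebius_def rot_field_def using assms by blast
  qed
  also have "\<dots> = (\<i> / 2) * ((\<alpha> * cnj \<alpha> + \<beta> * cnj \<beta>)\<^sup>2 * (cnj (fst d) * w\<^sup>2 + 2 * of_real (snd d) * w - fst d))"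
    unfolding R2 ring[symmetric] by (simp add: rotation_def)
  finally show ?thesis by (simp add: unit_cnj rot_field_def)
qed

lemma moebius_inverse:
  assumes "cnj \<alpha> - cnj \<beta> * w \<noteq> 0"
  shows "moebius (cnj \<alpha>) (- \<beta>) (moebius \<alpha> \<beta> w) = w" "\<alpha> + cnj \<beta> * moebius \<alpha> \<beta> w \<noteq> 0"
proof -
  have u: "\<beta> * cnj \<beta> = 1 - \<alpha> * cnj \<alpha>" using unit_cnj by (simp add: algebra_simps)
  have 1: "\<alpha> + cnj \<beta> * moebius \<alpha> \<beta> w = 1 / (cnj \<alpha> - cnj \<beta> * w)"
    using assms u by (simp add: moebius_def field_simps)
  have 2: "cnj \<alpha> * moebius \<alpha> \<beta> w - \<beta> = w / (cnj \<alpha> - cnj \<beta> * w)"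
  proof -
    have "cnj \<alpha> * (\<alpha> * w + \<beta>) - \<beta> * (cnj \<alpha> - cnj \<beta> * w) = (\<alpha> * cnj \<alpha> + \<beta> * cnj \<beta>) * w"
      by (simp add: algebra_simps)
    thus ?thesis using assms unit_cnj unfolding moebius_def by (simp add: divide_simps)
  qed
  show "\<alpha> + cnj \<beta> * moebius \<alpha> \<beta> w \<noteq> 0" using 1 assms by simp
  have "moebius (cnj \<alpha>) (- \<beta>) (moebius \<alpha> \<beta> w) = (cnj \<alpha> * moebius \<alpha> \<beta> w - \<beta>) / (\<alpha> + cnj \<beta> * moebius \<alpha> \<beta> w)"
    unfolding moebius_def[of "cnj \<alpha>"] by simp
  thus "moebius (cnj \<alpha>) (- \<beta>) (moebius \<alpha> \<beta> w) = w"
    unfolding 1 2 using assms by (simp add: divide_simps)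
qed

lemma has_field_derivative_moebius:
  assumes "cnj \<alpha> - cnj \<beta> * w \<noteq> 0"
  shows "(moebius \<alpha> \<beta> has_field_derivative 1 / (cnj \<alpha> - cnj \<beta> * w)\<^sup>2) (at w)"
proof -
  have "\<alpha> * (cnj \<alpha> - cnj \<beta> * w) - (\<alpha> * w + \<beta>) * (- cnj \<beta>) = 1"
    using unit_cnj by (simp add: algebra_simps)
  thus ?thesis
    unfolding moebius_def[abs_def] using assms
    by (auto intro!: derivative_eq_intros simp: power2_eq_square)
qed

end

text \<open>
  The factorization of the rotation field exhibits the poles: \<open>\<alpha> w + \<beta> = 0\<close> is the point mapped to 0 and
  \<open>cnj \<alpha> - cnj \<beta> * w = 0\<close> the point mapped to infinity.
\<close>
lemma exists_rotation_to_axis: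
  assumes "norm (d :: space3) = 1"
  obtains \<alpha> \<beta> where "(cmod \<alpha>)\<^sup>2 + (cmod \<beta>)\<^sup>2 = 1" "rotation (cnj \<alpha>) (- \<beta>) (0, 1) = d"
    "\<And>w. rot_field d w = \<i> * (\<alpha> * w + \<beta>) * (cnj \<alpha> - cnj \<beta> * w)"
proof -
  obtain \<delta> t where d: "d = (\<delta>, t)" by (cases d)
  have n: "(cmod \<delta>)\<^sup>2 + t\<^sup>2 = 1" using assms by (simp add: d norm_prod_def)
  have "\<exists>\<alpha> \<beta>. (cmod \<alpha>)\<^sup>2 + (cmod \<beta>)\<^sup>2 = 1 \<and> \<delta> = - 2 * cnj \<alpha> * \<beta> \<and> t = (cmod \<alpha>)\<^sup>2 - (cmod \<beta>)\<^sup>2"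
  proof (cases "t = - 1")
    case True
    thus ?thesis using n by (intro exI[of _ 0] exI[of _ 1]) auto
  next
    case False
    have "t\<^sup>2 \<le> 1" using n by (metis le_add_same_cancel2 zero_le_power2)
    hence "t \<ge> - 1" by (simp add: abs_le_iff abs_square_le_1)
    hence t: "1 + t > 0" using False by simp
    define r where "r = sqrt ((1 + t) / 2)"
    have r: "r > 0" "r\<^sup>2 = (1 + t) / 2" using t by (auto simp: r_def)
    have cb: "(cmod (- \<delta> / (2 * of_real r)))\<^sup>2 = (1 - t) / 2"
    proof -
      have "(cmod (- \<delta> / (2 * of_real r)))\<^sup>2 = (cmod \<delta>)\<^sup>2 / (4 * r\<^sup>2)"
        using r by (simp add: norm_divide norm_mult power_divide power_mult_distrib)
      also have "\<dots> = (1 - t\<^sup>2) / (2 * (1 + t))"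
      proof -
        have "4 * r\<^sup>2 = 2 * (1 + t)" "(cmod \<delta>)\<^sup>2 = 1 - t\<^sup>2" using n r(2) by simp_all
        thus ?thesis by simp
      qed
      also have "\<dots> = (1 - t) / 2" using t by (simp add: field_simps power2_eq_square)
      finally show ?thesis .
    qed
    show ?thesis
    proof (intro exI conjI)
      show "(cmod (of_real r))\<^sup>2 + (cmod (- \<delta> / (2 * of_real r)))\<^sup>2 = 1" unfolding cb using r by (simp add: field_simps)
      show "t = (cmod (of_real r))\<^sup>2 - (cmod (- \<delta> / (2 * of_real r)))\<^sup>2" unfolding cb using r by (simp add: field_simps)
      show "\<delta> = - 2 * cnj (of_real r) * (- \<delta> / (2 * of_real r))" using r by simp
    qed
  qed
  then obtain \<alpha> \<beta> where ab: "(cmod \<alpha>)\<^sup>2 + (cmod \<beta>)\<^sup>2 = 1" "\<delta> = - 2 * cnj \<alpha> * \<beta>" "t = (cmod \<alpha>)\<^sup>2 - (cmod \<beta>)\<^sup>2"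
    by blast
  show ?thesis
  proof (rule that[of \<alpha> \<beta>])
    show "(cmod \<alpha>)\<^sup>2 + (cmod \<beta>)\<^sup>2 = 1" by fact
    show "rotation (cnj \<alpha>) (- \<beta>) (0, 1) = d" by (simp add: rotation_def d ab)
    show "rot_field d w = \<i> * (\<alpha> * w + \<beta>) * (cnj \<alpha> - cnj \<beta> * w)" for w
    proof -
      have c: "of_real t = \<alpha> * cnj \<alpha> - \<beta> * cnj \<beta>" unfolding ab complex_norm_square[symmetric] by simp
      show ?thesis unfolding rot_field_def d fst_conv snd_conv c unfolding ab
        by (simp add: algebra_simps power2_eq_square)
    qed
  qed
qed

section \<open>Curves in an immersed surface\<close>

text \<open>
  A curve that is differentiable in space and lies in the surface, but whose lift \<open>\<theta>\<close> to the parameter domain is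
  only known to be continuous, is still tangent to the surface. Injectivity of \<open>L\<close> bounds the increment
  of \<open>\<theta>\<close> by that of \<open>\<gamma>\<close>, so the normal component of the increment of \<open>\<gamma>\<close> is of smaller order than the
  increment itself. This is how tangency is obtained below from homeomorphisms alone.
\<close>
lemma normal_to_lifted_curve:
  fixes Y :: "complex \<Rightarrow> space3" and \<gamma> :: "real \<Rightarrow> space3"
  assumes der: "(Y has_derivative L) (at z)" and inj: "inj L" and normal: "\<And>h. n \<bullet> L h = 0"
    and cont: "isCont \<theta> 0" and start: "\<theta> 0 = z"
    and lift: "eventually (\<lambda>s. Y (\<theta> s) = \<gamma> s) (nhds 0)"
    and vel: "(\<gamma> has_vector_derivative \<gamma>') (at 0)"
  shows "n \<bullet> \<gamma>' = 0"
proof -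
  have lin: "bounded_linear L" using der by (rule has_derivative_bounded_linear)
  obtain b where b: "b > 0" "\<And>h. b * norm h \<le> norm (L h)"
    using linear_inj_bounded_below_pos[OF bounded_linear.linear[OF lin] inj] by blast
  have \<gamma>0: "\<gamma> 0 = Y z" using eventually_nhds_x_imp_x[OF lift] start by simp
  have q: "((\<lambda>s. (\<gamma> s - \<gamma> 0) /\<^sub>R s) \<longlongrightarrow> \<gamma>') (at 0)"
  proof -
    have "(\<lambda>s. norm (\<gamma> s - \<gamma> 0 - s *\<^sub>R \<gamma>') / norm s) \<midarrow>0\<rightarrow> 0"
      using vel unfolding has_vector_derivative_def has_derivative_at by simp
    moreover have "eventually (\<lambda>s. norm (\<gamma> s - \<gamma> 0 - s *\<^sub>R \<gamma>') / norm s = norm ((\<gamma> s - \<gamma> 0) /\<^sub>R s - \<gamma>')) (at (0::real))"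
    proof (rule eventually_at_filter[THEN iffD2, OF always_eventually], intro allI impI)
      fix s :: real assume s: "s \<noteq> 0"
      hence "(\<gamma> s - \<gamma> 0) /\<^sub>R s - \<gamma>' = (\<gamma> s - \<gamma> 0 - s *\<^sub>R \<gamma>') /\<^sub>R s"
        by (simp add: scaleR_diff_right)
      thus "norm (\<gamma> s - \<gamma> 0 - s *\<^sub>R \<gamma>') / norm s = norm ((\<gamma> s - \<gamma> 0) /\<^sub>R s - \<gamma>')"
        by (simp add: divide_inverse mult.commute)
    qed
    ultimately have "((\<lambda>s. norm ((\<gamma> s - \<gamma> 0) /\<^sub>R s - \<gamma>')) \<longlongrightarrow> 0) (at 0)"
      by (rule Lim_transform_eventually)
    thus ?thesis by (simp add: tendsto_norm_zero_iff LIM_zero_iff)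
  qed
  have bound: "\<bar>n \<bullet> \<gamma>'\<bar> \<le> (e * norm n / b) * norm \<gamma>'" if e: "e > 0" for e
  proof -
    define \<epsilon> where "\<epsilon> = min (e / 2) (b / 2)"
    have \<epsilon>: "\<epsilon> > 0" "\<epsilon> \<le> e / 2" "\<epsilon> \<le> b / 2" using e b by (auto simp: \<epsilon>_def)
    obtain \<delta> where \<delta>: "\<delta> > 0" "\<And>y. norm (y - z) < \<delta> \<Longrightarrow> norm (Y y - Y z - L (y - z)) \<le> \<epsilon> * norm (y - z)"
      using der \<epsilon>(1) unfolding has_derivative_at_alt by blast
    have near: "eventually (\<lambda>s. norm (\<theta> s - z) < \<delta>) (at 0)"
      using cont \<delta>(1) unfolding isCont_def start by (simp add: tendsto_iff dist_norm)
    have lift': "eventually (\<lambda>s. Y (\<theta> s) = \<gamma> s) (at 0)"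
      using lift by (simp add: eventually_nhds_conv_at)
    have "eventually (\<lambda>s. \<bar>n \<bullet> ((\<gamma> s - \<gamma> 0) /\<^sub>R s)\<bar> \<le> (e * norm n / b) * norm ((\<gamma> s - \<gamma> 0) /\<^sub>R s)) (at 0)"
      using near lift'
    proof eventually_elim
      case (elim s)
      define \<Delta> where "\<Delta> = \<theta> s - z"
      define r where "r = \<gamma> s - \<gamma> 0 - L \<Delta>"
      have r: "norm r \<le> \<epsilon> * norm \<Delta>" using \<delta>(2)[OF elim(1)] elim(2) by (simp add: r_def \<Delta>_def \<gamma>0)
      have g: "\<gamma> s - \<gamma> 0 = L \<Delta> + r" by (simp add: r_def)
      have "b * norm \<Delta> \<le> norm (\<gamma> s - \<gamma> 0) + norm r"
        using b(2)[of \<Delta>] norm_triangle_ineq4[of "\<gamma> s - \<gamma> 0" r] by (simp add: g)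
      also have "\<dots> \<le> norm (\<gamma> s - \<gamma> 0) + (b / 2) * norm \<Delta>"
        using r mult_right_mono[OF \<epsilon>(3), of "norm \<Delta>"] by simp
      finally have d: "norm \<Delta> \<le> (2 / b) * norm (\<gamma> s - \<gamma> 0)" using b(1) by (simp add: field_simps)
      have "\<bar>n \<bullet> (\<gamma> s - \<gamma> 0)\<bar> = \<bar>n \<bullet> r\<bar>" unfolding g by (simp add: inner_add_right normal)
      also have "\<dots> \<le> norm n * norm r" by (rule Cauchy_Schwarz_ineq2)
      also have "\<dots> \<le> norm n * ((e / 2) * ((2 / b) * norm (\<gamma> s - \<gamma> 0)))"
        using r mult_mono[OF \<epsilon>(2) d] e by (intro mult_left_mono) auto
      finally have "\<bar>n \<bullet> (\<gamma> s - \<gamma> 0)\<bar> \<le> (e * norm n / b) * norm (\<gamma> s - \<gamma> 0)" by (simp add: field_simps)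
      hence "\<bar>n \<bullet> (\<gamma> s - \<gamma> 0)\<bar> / \<bar>s\<bar> \<le> (e * norm n / b) * norm (\<gamma> s - \<gamma> 0) / \<bar>s\<bar>"
        by (rule divide_right_mono) simp
      thus ?case by (simp add: abs_mult divide_inverse mult_ac)
    qed
    thus ?thesis
      by (intro tendsto_le[OF _ tendsto_mult[OF tendsto_const tendsto_norm[OF q]] tendsto_rabs[OF tendsto_inner[OF tendsto_const q]]])
         auto
  qed
  show ?thesis
  proof (rule ccontr)
    assume nz: "n \<bullet> \<gamma>' \<noteq> 0"
    hence "n \<noteq> 0" "\<gamma>' \<noteq> 0" by auto
    hence pos: "norm n * norm \<gamma>' > 0" by simp
    define e where "e = b * \<bar>n \<bullet> \<gamma>'\<bar> / (2 * (norm n * norm \<gamma>'))"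
    have "e > 0" using b nz pos by (auto simp: e_def)
    have "\<bar>n \<bullet> \<gamma>'\<bar> \<le> \<bar>n \<bullet> \<gamma>'\<bar> / 2"
    proof -
      have "(e * norm n / b) * norm \<gamma>' = e * (norm n * norm \<gamma>') / b" by simp
      also have "\<dots> = \<bar>n \<bullet> \<gamma>'\<bar> / 2" using pos b(1) unfolding e_def by (simp add: field_simps)
      finally have half: "(e * norm n / b) * norm \<gamma>' = \<bar>n \<bullet> \<gamma>'\<bar> / 2" .
      show ?thesis using bound[OF \<open>e > 0\<close>] unfolding half .
    qed
    thus False using nz by simp
  qed
qed

section \<open>Rotational surfaces whose axis misses the origin\<close>

text \<open>
  Here \<open>h\<close> stands for the part of the support function that depends on the latitude alone, and \<open>\<tau>\<close> for
  the value of the support function. The hypothesis says that the rational functions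
  \<open>(A u - 2 \<tau>) / (P u + B u \<tau> - \<tau>\<^sup>2)\<close> agree for all \<open>u\<close>. Comparing coefficients for two values of
  \<open>u\<close> leaves two possibilities. Either \<open>B\<close> is constant, which is a linear first order equation for \<open>h\<close> with
  the asserted solutions. Or the numerator is always a factor of the denominator; then \<open>h\<close>, shifted by a
  constant, satisfies the equations \<open>E1\<close> and \<open>E2\<close> below, and these are inconsistent.
\<close>
lemma sphere_profile_of_rational_ratio:
  fixes h h1 h2 k :: "real \<Rightarrow> real"
  assumes I: "a < b" "\<And>u. a < u \<Longrightarrow> u < b \<Longrightarrow> u \<noteq> 0"
    and h: "\<And>u. a < u \<Longrightarrow> u < b \<Longrightarrow> (h has_real_derivative h1 u) (at u)"
      "\<And>u. a < u \<Longrightarrow> u < b \<Longrightarrow> (h1 has_real_derivative h2 u) (at u)"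
    and c: "c > 0" and \<kappa>: "\<kappa> > 0"
    and ratio: "\<And>u \<tau>. a < u \<Longrightarrow> u < b \<Longrightarrow> \<bar>\<tau> - \<tau>0\<bar> \<le> \<kappa> \<Longrightarrow>
      ((cosh u)\<^sup>2 * h2 u + 2 * h u) - 2 * \<tau> =
        k \<tau> * (((cosh u)\<^sup>2 * (h1 u)\<^sup>2 + c + 2 * sinh u * cosh u * h u * h1 u - (h u)\<^sup>2)
          + 2 * (h u - sinh u * cosh u * h1 u) * \<tau> - \<tau>\<^sup>2)"
  shows "\<exists>r m. \<forall>u. a < u \<longrightarrow> u < b \<longrightarrow> h u = r + m * tanh u"
proof -
  define A where "A u = (cosh u)\<^sup>2 * h2 u + 2 * h u" for u
  define P where "P u = (cosh u)\<^sup>2 * (h1 u)\<^sup>2 + c + 2 * sinh u * cosh u * h u * h1 u - (h u)\<^sup>2" for u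
  define B where "B u = 2 * (h u - sinh u * cosh u * h1 u)" for u
  have eq: "A u - 2 * \<tau> = k \<tau> * (P u + B u * \<tau> - \<tau>\<^sup>2)"
    if "a < u" "u < b" "\<bar>\<tau> - \<tau>0\<bar> \<le> \<kappa>" for u \<tau>
    using ratio[OF that] by (simp add: A_def P_def B_def)
  \<comment> \<open>The cubic terms cancel in the cross-multiplied identity, and a quadratic polynomial with three zeros vanishes.\<close>
  have coeffs: "A u - 2 * B u = A v - 2 * B v \<and> A u * B v - 2 * P v = A v * B u - 2 * P u \<and> A u * P v = A v * P u"
    if u: "a < u" "u < b" and v: "a < v" "v < b" for u v
  proof -
    define x where "x = A v + 2 * B u - A u - 2 * B v"
    define y where "y = A u * B v - 2 * P v - A v * B u + 2 * P u"
    define w where "w = A u * P v - A v * P u"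
    have z: "x * \<tau>\<^sup>2 + y * \<tau> + w = 0" if "\<bar>\<tau> - \<tau>0\<bar> \<le> \<kappa>" for \<tau>
    proof -
      have "(A u - 2 * \<tau>) * (P v + B v * \<tau> - \<tau>\<^sup>2) = (A v - 2 * \<tau>) * (P u + B u * \<tau> - \<tau>\<^sup>2)"
        unfolding eq[OF u that] eq[OF v that] by simp
      thus ?thesis unfolding x_def y_def w_def by (simp add: algebra_simps power2_eq_square)
    qed
    have z0: "x * \<tau>0\<^sup>2 + y * \<tau>0 + w = 0" and z1: "x * (\<tau>0 + \<kappa>)\<^sup>2 + y * (\<tau>0 + \<kappa>) + w = 0"
      and z2: "x * (\<tau>0 - \<kappa>)\<^sup>2 + y * (\<tau>0 - \<kappa>) + w = 0"
      using \<kappa> by (auto intro!: z)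
    have "2 * x * \<kappa>\<^sup>2 = 0" using z0 z1 z2 by algebra
    hence x: "x = 0" using \<kappa> by simp
    have "y * \<kappa> = 0" using z0 z1 unfolding x by algebra
    hence y: "y = 0" using \<kappa> by simp
    have "w = 0" using z0 x y by simp
    thus ?thesis using x y by (simp add: x_def y_def w_def)
  qed
  show ?thesis
  proof (cases "\<exists>u v. a < u \<and> u < b \<and> a < v \<and> v < b \<and> B u \<noteq> B v")
    case False
    define r where "r = B ((a + b) / 2) / 2"
    have r: "h u - sinh u * cosh u * h1 u = r" if "a < u" "u < b" for u
    proof -
      have "a < (a + b) / 2" "(a + b) / 2 < b" using I(1) by simp_all
      hence "B u = B ((a + b) / 2)" using False that by blast
      thus ?thesis by (simp add: r_def B_def)
    qed
    have "\<exists>m. \<forall>u\<in>{a<..<b}. (h u - r) * cosh u / sinh u = m"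
    proof (rule has_field_derivative_zero_constant)
      fix u assume u: "u \<in> {a<..<b}"
      hence nz: "sinh u \<noteq> 0" using I(2)[of u] by simp
      have "((\<lambda>u. (h u - r) * cosh u / sinh u) has_real_derivative
        ((h1 u * cosh u + (h u - r) * sinh u) * sinh u - (h u - r) * cosh u * cosh u) / (sinh u * sinh u)) (at u)"
        using h(1)[of u] u nz by (auto intro!: derivative_eq_intros)
      moreover have "(h1 u * cosh u + (h u - r) * sinh u) * sinh u - (h u - r) * cosh u * cosh u = 0"
      proof -
        have s: "h u - r = sinh u * cosh u * h1 u" using r[of u] u by simp
        have cc: "cosh u * cosh u = sinh u * sinh u + 1" using cosh_square_eq[of u] by (simp add: power2_eq_square)
        have "(h1 u * cosh u + (h u - r) * sinh u) * sinh u - (h u - r) * (cosh u * cosh u) = sinh u * cosh u * h1 u - (h u - r)"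
          unfolding cc by (simp add: algebra_simps)
        thus ?thesis by (simp add: s mult.assoc)
      qed
      ultimately show "((\<lambda>u. (h u - r) * cosh u / sinh u) has_real_derivative 0) (at u within {a<..<b})"
        by (auto intro: has_field_derivative_at_within)
    qed simp
    then obtain m where m: "\<And>u. a < u \<Longrightarrow> u < b \<Longrightarrow> (h u - r) * cosh u / sinh u = m" by auto
    have "h u = r + m * tanh u" if u: "a < u" "u < b" for u
      using m[OF u] I(2)[OF u] by (simp add: tanh_def field_simps)
    thus ?thesis by blast
  next
    case True
    then obtain u1 u2 where u12: "a < u1" "u1 < b" "a < u2" "u2 < b" "B u1 \<noteq> B u2" by blast
    define e where "e = A u1 - 2 * B u1"
    define H where "H u = h u + e / 2" for u
    have Ae: "A u = e + 2 * B u" if "a < u" "u < b" for u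
      using coeffs[OF u12(1,2) that] by (simp add: e_def)
    define q where "q = P u1 - e * B u1 / 2"
    have Pq: "P u = e * B u / 2 + q" if u: "a < u" "u < b" for u
      using coeffs[OF u12(1,2) u] unfolding Ae[OF u] Ae[OF u12(1,2)] q_def by (simp add: algebra_simps)
    have "A u1 * P u2 = A u2 * P u1" using coeffs[OF u12(1-4)] by simp
    hence "(e\<^sup>2 / 2 - 2 * q) * (B u2 - B u1) = 0"
      unfolding Ae[OF u12(1,2)] Ae[OF u12(3,4)] Pq[OF u12(1,2)] Pq[OF u12(3,4)]
      by (simp add: field_simps power2_eq_square)
    hence q: "q = e\<^sup>2 / 4" using u12(5) by simp
    have E2: "(cosh u)\<^sup>2 * h2 u = 2 * H u - 4 * (sinh u * cosh u * h1 u)" if u: "a < u" "u < b" for u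
      using Ae[OF u] by (simp add: A_def B_def H_def algebra_simps)
    have E1: "(H u)\<^sup>2 - 2 * (sinh u * cosh u) * h1 u * H u - (cosh u)\<^sup>2 * (h1 u)\<^sup>2 = c" if u: "a < u" "u < b" for u
      using Pq[OF u] unfolding q P_def B_def H_def by (simp add: field_simps power2_eq_square)
    have HD: "(H has_real_derivative h1 u) (at u)" if u: "a < u" "u < b" for u
      unfolding H_def[abs_def] using h(1)[OF u] by (auto intro!: derivative_eq_intros)
    have dzero: "D = 0" if u: "a < u" "u < b" and D: "(G has_real_derivative D) (at u)"
      and G: "\<And>v. a < v \<Longrightarrow> v < b \<Longrightarrow> G v = (g0::real)" for u D G g0
    proof -
      have "(G has_real_derivative 0) (at u)"
        by (rule has_field_derivative_transform_within_open[of "\<lambda>_. g0" 0 u "{a<..<b}"]) (use u G in auto)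
      thus ?thesis using D DERIV_unique by blast
    qed
    \<comment> \<open>The derivative of \<open>E1\<close> factors; the second factor is nonzero because of \<open>E2\<close> and the sign of \<open>c\<close>.\<close>
    have F1: "H u * sinh u + h1 u * cosh u = 0" if u: "a < u" "u < b" for u
    proof -
      have cc: "(cosh u)\<^sup>2 = (sinh u)\<^sup>2 + 1" by (rule cosh_square_eq)
      have "((\<lambda>u. (H u)\<^sup>2 - 2 * (sinh u * cosh u) * h1 u * H u - (cosh u)\<^sup>2 * (h1 u)\<^sup>2) has_real_derivative
        2 * H u * h1 u - (2 * (cosh u * cosh u + sinh u * sinh u) * h1 u * H u + 2 * (sinh u * cosh u) * h2 u * H u
          + 2 * (sinh u * cosh u) * h1 u * h1 u) - (2 * cosh u * sinh u * (h1 u)\<^sup>2 + (cosh u)\<^sup>2 * (2 * h1 u * h2 u))) (at u)"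
        using HD[OF u] h(2)[OF u] by (auto intro!: derivative_eq_intros simp: algebra_simps power2_eq_square)
      from dzero[OF u this E1]
      have "(H u * sinh u + h1 u * cosh u) * (2 * sinh u * h1 u + cosh u * h2 u) = 0"
        using cc by algebra
      moreover have "2 * sinh u * h1 u + cosh u * h2 u \<noteq> 0"
      proof
        assume z: "2 * sinh u * h1 u + cosh u * h2 u = 0"
        hence "H u = sinh u * cosh u * h1 u" using E2[OF u] by algebra
        hence "- ((cosh u)\<^sup>2 * (h1 u)\<^sup>2 * ((sinh u)\<^sup>2 + 1)) = c" using E1[OF u] by algebra
        moreover have "(cosh u)\<^sup>2 * (h1 u)\<^sup>2 * ((sinh u)\<^sup>2 + 1) \<ge> 0" by simp
        ultimately show False using c by linarith
      qed
      ultimately show ?thesis by simp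
    qed
    have u: "a < u1" "u1 < b" by fact+
    have "((\<lambda>u. H u * sinh u + h1 u * cosh u) has_real_derivative
      h1 u1 * sinh u1 + H u1 * cosh u1 + h2 u1 * cosh u1 + h1 u1 * sinh u1) (at u1)"
      using HD[OF u] h(2)[OF u] by (auto intro!: derivative_eq_intros simp: algebra_simps)
    from dzero[OF u this F1]
    have d: "h1 u1 * sinh u1 + H u1 * cosh u1 + h2 u1 * cosh u1 + h1 u1 * sinh u1 = 0" .
    have "H u1 * (2 + 2 * (sinh u1)\<^sup>2 + (cosh u1)\<^sup>2) = 0"
      using d F1[OF u] E2[OF u] by algebra
    moreover have "2 + 2 * (sinh u1)\<^sup>2 + (cosh u1)\<^sup>2 > 0"
      by (intro add_pos_nonneg) auto
    ultimately have H0: "H u1 = 0" by simp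
    hence "h1 u1 = 0" using F1[OF u] by simp
    thus ?thesis using E1[OF u] H0 c by simp
  qed
qed


lemma line_derivatives:
  assumes "(F has_field_derivative D) (at (Complex u v))"
  shows "((\<lambda>u. Re (F (Complex u v))) has_real_derivative Re D) (at u)"
    "((\<lambda>u. Im (F (Complex u v))) has_real_derivative Im D) (at u)"
    "((\<lambda>v. Re (F (Complex u v))) has_real_derivative - Im D) (at v)"
    "((\<lambda>v. Im (F (Complex u v))) has_real_derivative Re D) (at v)"
proof -
  have h: "((\<lambda>u. Complex u v) has_vector_derivative 1) (at u)"
    and w: "((\<lambda>v. Complex u v) has_vector_derivative \<i>) (at v)"
    by (simp_all add: has_vector_derivative_complex_iff)
  have "((F \<circ> (\<lambda>u. Complex u v)) has_vector_derivative 1 * D) (at u)"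
    by (rule field_vector_diff_chain_at[OF h]) (use assms in simp)
  thus "((\<lambda>u. Re (F (Complex u v))) has_real_derivative Re D) (at u)"
    "((\<lambda>u. Im (F (Complex u v))) has_real_derivative Im D) (at u)"
    by (simp_all add: has_vector_derivative_complex_iff o_def)
  have "((F \<circ> (\<lambda>v. Complex u v)) has_vector_derivative \<i> * D) (at v)"
    by (rule field_vector_diff_chain_at[OF w]) (use assms in simp)
  thus "((\<lambda>v. Re (F (Complex u v))) has_real_derivative - Im D) (at v)"
    "((\<lambda>v. Im (F (Complex u v))) has_real_derivative Re D) (at v)"
    by (simp_all add: has_vector_derivative_complex_iff o_def)
qed

lemma inj_if_deriv_nonzero:
  fixes l :: "real \<Rightarrow> real"
  assumes "\<And>t. l field_differentiable (at t)" "\<And>t. deriv l t \<noteq> 0"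
  shows "inj l"
proof -
  have d: "(l has_real_derivative deriv l t) (at t)" for t
    using assms(1) by (simp add: field_differentiable_derivI)
  have "l x \<noteq> l y" if xy: "x < y" for x y
  proof
    assume "l x = l y"
    obtain z where "l y - l x = (y - x) * deriv l z"
      using MVT2[of x y l "deriv l"] xy d by auto
    thus False using \<open>l x = l y\<close> xy assms(2)[of z] by simp
  qed
  thus ?thesis by (metis injI linorder_neqE_linordered_idom)
qed

text \<open>
  The hypothesis \<open>eq\<close> prescribes the derivative of the support function \<open>\<psi> = l (Re F)\<close> along the parallels,
  \<open>\<psi>\<^sub>v = Re (cnj E * cis v) / cosh u\<close>, so that \<open>\<psi> = h(u) + y(v) / cosh u\<close>. Since \<open>Re F\<close> is harmonic,
  \<open>\<psi>\<^sub>u\<^sub>u + \<psi>\<^sub>v\<^sub>v = k(\<psi>) (\<psi>\<^sub>u\<^sup>2 + \<psi>\<^sub>v\<^sup>2)\<close>, and replacing \<open>y\<close> by \<open>(\<psi> - h) cosh u\<close> turns this into the hypothesis of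
  the previous lemma. Its conclusion makes \<open>\<psi>\<close> the support function of a sphere with centre \<open>d\<close>, which does not
  change under rotation about \<open>d\<close>.
\<close>
lemma off_axis_surface_is_sphere:
  fixes l :: "real \<Rightarrow> real" and F :: "complex \<Rightarrow> complex" and E :: complex
  assumes l1: "\<And>t. l field_differentiable (at t)" and l2: "\<And>t. deriv l field_differentiable (at t)"
    and l': "\<And>t. deriv l t \<noteq> 0"
    and S: "open S" "\<zeta>0 \<in> S" and F: "F holomorphic_on S" and E: "E \<noteq> 0"
    and eq: "\<And>z. z \<in> S \<Longrightarrow>
      deriv l (Re (F z)) * Im (deriv F z) = - (Re (cnj E * cis (Im z)) / cosh (Re z))"
  obtains U d where "open U" "U \<noteq> {}" "U \<subseteq> S" "d \<noteq> 0"
    "\<And>z. z \<in> U \<Longrightarrow> Re (deriv F z * (rot_field d (exp z) / exp z)) = 0"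
proof -
  define y where "y v = Im (cnj E * cis v)" for v
  define y1 where "y1 v = Re (cnj E * cis v)" for v
  define c where "c = (cmod E)\<^sup>2"
  have c: "c > 0" using E by (simp add: c_def)
  have yD: "(y has_real_derivative y1 v) (at v)" and y1D: "(y1 has_real_derivative - y v) (at v)" for v
    unfolding y_def[abs_def] y1_def[abs_def] by (auto intro!: derivative_eq_intros)
  have yc: "(y v)\<^sup>2 + (y1 v)\<^sup>2 = c" for v
  proof -
    have "(y v)\<^sup>2 + (y1 v)\<^sup>2 = (cmod (cnj E * cis v))\<^sup>2" by (simp only: y_def y1_def cmod_power2 add.commute)
    thus ?thesis by (simp add: norm_mult c_def)
  qed
  obtain \<epsilon> where \<epsilon>: "\<epsilon> > 0" "ball \<zeta>0 \<epsilon> \<subseteq> S" using S openE by blast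
  define t where "t = min (\<epsilon> / 4) 1"
  have t: "0 < t" "t \<le> \<epsilon> / 4" "t \<le> 1" using \<epsilon> by (auto simp: t_def)
  \<comment> \<open>Off the equator, as the sphere profile is found by dividing by \<open>sinh u\<close>; and where \<open>y\<close> has nonzero slope, so that the support function covers an interval along the parallel.\<close>
  obtain u1 where u1: "u1 \<noteq> 0" "\<bar>u1 - Re \<zeta>0\<bar> \<le> t"
  proof (cases "Re \<zeta>0 = 0")
    case True thus ?thesis using that[of t] t by simp
  next
    case False thus ?thesis using that[of "Re \<zeta>0"] t by simp
  qed
  obtain v1 where v1: "y1 v1 \<noteq> 0" "\<bar>v1 - Im \<zeta>0\<bar> \<le> t"
  proof (cases "y1 (Im \<zeta>0) = 0")
    case True
    have "y1 (Im \<zeta>0 + t) = y1 (Im \<zeta>0) * cos t - y (Im \<zeta>0) * sin t"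
      unfolding y1_def y_def by (simp add: cis_mult[symmetric] cos_add sin_add algebra_simps)
    moreover have "sin t \<noteq> 0" using sin_gt_zero[of t] t pi_gt3 by simp
    moreover have "y (Im \<zeta>0) \<noteq> 0" using yc[of "Im \<zeta>0"] c True by auto
    ultimately show ?thesis using that[of "Im \<zeta>0 + t"] t True by simp
  next
    case False thus ?thesis using that[of "Im \<zeta>0"] t by simp
  qed
  define \<eta> where "\<eta> = min (\<epsilon> / 4) \<bar>u1\<bar>"
  have \<eta>: "\<eta> > 0" "\<eta> \<le> \<epsilon> / 4" "\<eta> \<le> \<bar>u1\<bar>" using \<epsilon> u1 by (auto simp: \<eta>_def)
  have box: "Complex u v \<in> S" if "\<bar>u - u1\<bar> < \<eta>" "\<bar>v - v1\<bar> < \<eta>" for u v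
  proof -
    have "cmod (Complex u v - \<zeta>0) \<le> \<bar>u - Re \<zeta>0\<bar> + \<bar>v - Im \<zeta>0\<bar>"
      using cmod_le[of "Complex u v - \<zeta>0"] by simp
    also have "\<dots> < \<epsilon>" using that u1(2) v1(2) t(2) \<eta>(2) by linarith
    finally show ?thesis using \<epsilon>(2) by (auto simp: dist_norm norm_minus_commute)
  qed
  have u_nz: "u \<noteq> 0" if "\<bar>u - u1\<bar> < \<eta>" for u using that \<eta>(3) by auto
  define f1 where "f1 = deriv F"
  define f2 where "f2 = deriv f1"
  define l1' where "l1' = deriv l"
  define l2' where "l2' = deriv l1'"
  have lD: "(l has_real_derivative l1' t) (at t)" and l1D: "(l1' has_real_derivative l2' t) (at t)" for t
    using l1 l2 by (simp_all add: field_differentiable_derivI l1'_def l2'_def)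
  have FD: "(F has_field_derivative f1 z) (at z)" and f1D: "(f1 has_field_derivative f2 z) (at z)" if "z \<in> S" for z
    unfolding f1_def f2_def using F S(1) that holomorphic_deriv[OF F S(1)] by (auto intro: holomorphic_derivI)
  define \<mu> where "\<mu> u v = Re (F (Complex u v))" for u v
  define \<psi> where "\<psi> u v = l (\<mu> u v)" for u v
  define h where "h u = \<psi> u v1 - y v1 / cosh u" for u
  define h1 where "h1 u = l1' (\<mu> u v1) * Re (f1 (Complex u v1)) + y v1 * sinh u / (cosh u)\<^sup>2" for u
  define h2 where "h2 u = l2' (\<mu> u v1) * (Re (f1 (Complex u v1)))\<^sup>2 + l1' (\<mu> u v1) * Re (f2 (Complex u v1))
     + y v1 * (2 / (cosh u)^3 - 1 / cosh u)" for u
  have \<mu>u: "((\<lambda>u. \<mu> u v) has_real_derivative Re (f1 (Complex u v))) (at u)"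
    and \<mu>v: "((\<lambda>v. \<mu> u v) has_real_derivative - Im (f1 (Complex u v))) (at v)"
    and f1u: "((\<lambda>u. Re (f1 (Complex u v))) has_real_derivative Re (f2 (Complex u v))) (at u)"
    and f1v: "((\<lambda>v. Im (f1 (Complex u v))) has_real_derivative Re (f2 (Complex u v))) (at v)"
    if "\<bar>u - u1\<bar> < \<eta>" "\<bar>v - v1\<bar> < \<eta>" for u v
    unfolding \<mu>_def using line_derivatives[OF FD] line_derivatives[OF f1D] box that by auto
  have \<psi>u: "((\<lambda>u. \<psi> u v) has_real_derivative l1' (\<mu> u v) * Re (f1 (Complex u v))) (at u)"
    and \<psi>v: "((\<lambda>v. \<psi> u v) has_real_derivative l1' (\<mu> u v) * - Im (f1 (Complex u v))) (at v)"
    if "\<bar>u - u1\<bar> < \<eta>" "\<bar>v - v1\<bar> < \<eta>" for u v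
    unfolding \<psi>_def using DERIV_chain2[OF lD \<mu>u] DERIV_chain2[OF lD \<mu>v] that by auto
  have \<psi>uu: "((\<lambda>u. l1' (\<mu> u v) * Re (f1 (Complex u v))) has_real_derivative
      l2' (\<mu> u v) * (Re (f1 (Complex u v)))\<^sup>2 + l1' (\<mu> u v) * Re (f2 (Complex u v))) (at u)"
    if "\<bar>u - u1\<bar> < \<eta>" "\<bar>v - v1\<bar> < \<eta>" for u v
    using DERIV_mult[OF DERIV_chain2[OF l1D \<mu>u[OF that]] f1u[OF that]] by (simp add: power2_eq_square algebra_simps)
  have \<psi>vv: "((\<lambda>v. l1' (\<mu> u v) * - Im (f1 (Complex u v))) has_real_derivative
      l2' (\<mu> u v) * (Im (f1 (Complex u v)))\<^sup>2 - l1' (\<mu> u v) * Re (f2 (Complex u v))) (at v)"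
    if "\<bar>u - u1\<bar> < \<eta>" "\<bar>v - v1\<bar> < \<eta>" for u v
    using DERIV_mult[OF DERIV_chain2[OF l1D \<mu>v[OF that]] DERIV_minus[OF f1v[OF that]]] by (simp add: power2_eq_square algebra_simps)
  have \<psi>v_eq: "l1' (\<mu> u v) * - Im (f1 (Complex u v)) = y1 v / cosh u" if "\<bar>u - u1\<bar> < \<eta>" "\<bar>v - v1\<bar> < \<eta>" for u v
    using eq[OF box[OF that]] by (simp add: l1'_def \<mu>_def f1_def y1_def)
  have sechD: "((\<lambda>u. a / cosh u) has_real_derivative - (a * sinh u / (cosh u)\<^sup>2)) (at u)" for a u :: real
    by (auto intro!: derivative_eq_intros simp: power2_eq_square)
  have sech2D: "((\<lambda>u. a * sinh u / (cosh u)\<^sup>2) has_real_derivative - (a * (2 / (cosh u)^3 - 1 / cosh u)) * - 1) (at u)" for a u :: real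
  proof -
    have "((\<lambda>u. a * sinh u / (cosh u)\<^sup>2) has_real_derivative
      (a * cosh u * (cosh u)\<^sup>2 - a * sinh u * (2 * cosh u * sinh u)) / ((cosh u)\<^sup>2 * (cosh u)\<^sup>2)) (at u)"
      by (auto intro!: derivative_eq_intros)
    moreover have "(a * cosh u * (cosh u)\<^sup>2 - a * sinh u * (2 * cosh u * sinh u)) / ((cosh u)\<^sup>2 * (cosh u)\<^sup>2) = - (a * (2 / (cosh u)^3 - 1 / cosh u)) * - 1"
    proof -
      have "(a * C * C\<^sup>2 - a * s * (2 * C * s)) / (C\<^sup>2 * C\<^sup>2) = - (a * (2 / C^3 - 1 / C)) * - 1"
        if C: "C > 0" and s: "s\<^sup>2 = C\<^sup>2 - 1" for C s :: real
      proof -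
        have "a * C * C\<^sup>2 - a * s * (2 * C * s) = a * C * (C\<^sup>2 - 2 * s\<^sup>2)"
          by (simp add: power2_eq_square algebra_simps)
        also have "\<dots> = a * C * (2 - C\<^sup>2)" unfolding s by simp
        finally show ?thesis using C by (simp add: field_simps power2_eq_square power3_eq_cube)
      qed
      from this[OF cosh_real_pos sinh_square_eq] show ?thesis .
    qed
    ultimately show ?thesis by simp
  qed
  have hD: "(h has_real_derivative h1 u) (at u)" if "\<bar>u - u1\<bar> < \<eta>" for u
    unfolding h_def[abs_def] h1_def
    using DERIV_diff[OF \<psi>u[OF that, of v1] sechD[of "y v1" u]] \<eta>(1) by simp
  have h1D: "(h1 has_real_derivative h2 u) (at u)" if "\<bar>u - u1\<bar> < \<eta>" for u
    unfolding h1_def[abs_def] h2_def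
    using DERIV_add[OF \<psi>uu[OF that, of v1] sech2D[of "y v1" u]] \<eta>(1) by simp
  have \<psi>_eq: "\<psi> u v = h u + y v / cosh u" if uv: "\<bar>u - u1\<bar> < \<eta>" "\<bar>v - v1\<bar> < \<eta>" for u v
  proof -
    have "\<exists>k. \<forall>v\<in>{v1 - \<eta><..<v1 + \<eta>}. \<psi> u v - y v / cosh u = k"
    proof (rule has_field_derivative_zero_constant)
      fix v assume "v \<in> {v1 - \<eta><..<v1 + \<eta>}"
      hence v: "\<bar>v - v1\<bar> < \<eta>" by auto
      have "((\<lambda>v. \<psi> u v - y v / cosh u) has_real_derivative 0) (at v)"
        using DERIV_diff[OF \<psi>v[OF uv(1) v] DERIV_cdivide[OF yD, of "cosh u" v]] unfolding \<psi>v_eq[OF uv(1) v] by simp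
      thus "((\<lambda>v. \<psi> u v - y v / cosh u) has_real_derivative 0) (at v within {v1 - \<eta><..<v1 + \<eta>})"
        by (rule has_field_derivative_at_within)
    qed simp
    then obtain k where "\<And>v. v\<in>{v1 - \<eta><..<v1 + \<eta>} \<Longrightarrow> \<psi> u v - y v / cosh u = k" by blast
    from this[of v] this[of v1] show ?thesis using uv \<eta>(1) unfolding h_def by (auto simp: abs_less_iff algebra_simps)
  qed
  have open_near: "eventually (\<lambda>u. \<bar>u - a\<bar> < \<eta>) (nhds b)" if "\<bar>b - a\<bar> < \<eta>" for a b :: real
  proof -
    have "open {u. \<bar>u - a\<bar> < \<eta>}" by (intro open_Collect_less continuous_intros)
    thus ?thesis using that eventually_nhds by blast
  qed
  have \<psi>u_eq: "l1' (\<mu> u v) * Re (f1 (Complex u v)) = h1 u - y v * sinh u / (cosh u)\<^sup>2"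
    if uv: "\<bar>u - u1\<bar> < \<eta>" "\<bar>v - v1\<bar> < \<eta>" for u v
  proof -
    have "((\<lambda>u. \<psi> u v) has_real_derivative h1 u - y v * sinh u / (cosh u)\<^sup>2) (at u)"
      using DERIV_add[OF hD[OF uv(1)] sechD[of "y v" u]]
      by (subst DERIV_cong_ev[OF refl _ refl, of _ "\<lambda>u. h u + y v / cosh u"])
         (auto intro: eventually_mono[OF open_near[OF uv(1)]] simp: \<psi>_eq uv)
    thus ?thesis using \<psi>u[OF uv] DERIV_unique by blast
  qed
  have \<psi>uu_eq: "l2' (\<mu> u v) * (Re (f1 (Complex u v)))\<^sup>2 + l1' (\<mu> u v) * Re (f2 (Complex u v)) = h2 u - y v * (2 / (cosh u)^3 - 1 / cosh u)"
    if uv: "\<bar>u - u1\<bar> < \<eta>" "\<bar>v - v1\<bar> < \<eta>" for u v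
  proof -
    have "((\<lambda>u. l1' (\<mu> u v) * Re (f1 (Complex u v))) has_real_derivative h2 u - y v * (2 / (cosh u)^3 - 1 / cosh u)) (at u)"
      using DERIV_diff[OF h1D[OF uv(1)] sech2D[of "y v" u]]
      by (subst DERIV_cong_ev[OF refl _ refl, of _ "\<lambda>u. h1 u - y v * sinh u / (cosh u)\<^sup>2"])
         (auto intro: eventually_mono[OF open_near[OF uv(1)]] simp: \<psi>u_eq uv)
    thus ?thesis using \<psi>uu[OF uv] DERIV_unique by blast
  qed
  have \<psi>vv_eq: "l2' (\<mu> u v) * (Im (f1 (Complex u v)))\<^sup>2 - l1' (\<mu> u v) * Re (f2 (Complex u v)) = - y v / cosh u"
    if uv: "\<bar>u - u1\<bar> < \<eta>" "\<bar>v - v1\<bar> < \<eta>" for u v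
  proof -
    have "((\<lambda>v. l1' (\<mu> u v) * - Im (f1 (Complex u v))) has_real_derivative - y v / cosh u) (at v)"
      using DERIV_cdivide[OF y1D, of "cosh u" v]
      by (subst DERIV_cong_ev[OF refl _ refl, of _ "\<lambda>v. y1 v / cosh u"])
         (auto intro: eventually_mono[OF open_near[OF uv(2)]] simp: \<psi>v_eq[simplified] uv)
    thus ?thesis using \<psi>vv[OF uv] DERIV_unique by blast
  qed
  have injl: "inj l" by (rule inj_if_deriv_nonzero[OF l1 l'])
  define k where "k \<tau> = l2' (inv l \<tau>) / (l1' (inv l \<tau>))\<^sup>2" for \<tau>
  have ratio: "((cosh u)\<^sup>2 * h2 u + 2 * h u) - 2 * \<tau> =
        k \<tau> * (((cosh u)\<^sup>2 * (h1 u)\<^sup>2 + c + 2 * sinh u * cosh u * h u * h1 u - (h u)\<^sup>2)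
          + 2 * (h u - sinh u * cosh u * h1 u) * \<tau> - \<tau>\<^sup>2)"
    if uv: "\<bar>u - u1\<bar> < \<eta>" "\<bar>v - v1\<bar> < \<eta>" and \<tau>: "\<tau> = h u + y v / cosh u" for u v \<tau>
  proof -
    have "inv l \<tau> = \<mu> u v" unfolding \<tau> \<psi>_eq[OF uv, symmetric] \<psi>_def by (rule inv_f_f[OF injl])
    hence k: "k \<tau> * (l1' (\<mu> u v))\<^sup>2 = l2' (\<mu> u v)" using l' by (simp add: k_def l1'_def)
    have "h2 u - 2 * y v / (cosh u)^3 = l2' (\<mu> u v) * ((Re (f1 (Complex u v)))\<^sup>2 + (Im (f1 (Complex u v)))\<^sup>2)"
      using \<psi>uu_eq[OF uv] \<psi>vv_eq[OF uv] by (simp add: algebra_simps)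
    also have "\<dots> = k \<tau> * ((l1' (\<mu> u v) * Re (f1 (Complex u v)))\<^sup>2 + (l1' (\<mu> u v) * - Im (f1 (Complex u v)))\<^sup>2)"
      unfolding k[symmetric] by (simp add: power2_eq_square algebra_simps)
    also have "\<dots> = k \<tau> * ((h1 u - y v * sinh u / (cosh u)\<^sup>2)\<^sup>2 + (y1 v / cosh u)\<^sup>2)"
      unfolding \<psi>u_eq[OF uv] \<psi>v_eq[OF uv] ..
    finally have main: "h2 u - 2 * y v / (cosh u)^3 = k \<tau> * ((h1 u - y v * sinh u / (cosh u)\<^sup>2)\<^sup>2 + (y1 v / cosh u)\<^sup>2)" .
    have alg: "C\<^sup>2 * H2 + 2 * H - 2 * \<tau> =
        K * ((C\<^sup>2 * H1\<^sup>2 + c + 2 * s * C * H * H1 - H\<^sup>2)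
          + 2 * (H - s * C * H1) * \<tau> - \<tau>\<^sup>2)"
      if "C > 0" "C\<^sup>2 = s\<^sup>2 + 1" "\<tau> = H + Y / C" "Y\<^sup>2 + Y1\<^sup>2 = c"
        "H2 - 2 * Y / C^3 = K * ((H1 - Y * s / C\<^sup>2)\<^sup>2 + (Y1 / C)\<^sup>2)" for C s H H1 H2 Y Y1 K :: real
    proof -
      define x where "x = Y / C"
      have Y: "Y = x * C" using that(1) by (simp add: x_def)
      have t: "\<tau> = H + x" using that(3) by (simp add: x_def)
      have 1: "C\<^sup>2 * (H2 - 2 * Y / C^3) = C\<^sup>2 * H2 - 2 * x"
        using that(1) by (simp add: Y field_simps power2_eq_square power3_eq_cube)
      have 2: "C\<^sup>2 * ((H1 - Y * s / C\<^sup>2)\<^sup>2 + (Y1 / C)\<^sup>2) = (C * H1 - x * s)\<^sup>2 + Y1\<^sup>2"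
        using that(1) by (simp add: Y field_simps power2_eq_square)
      have 3: "C\<^sup>2 * H2 - 2 * x = K * ((C * H1 - x * s)\<^sup>2 + Y1\<^sup>2)"
        unfolding 1[symmetric] 2[symmetric] that(5) by (rule mult.left_commute)
      have Y1: "Y1\<^sup>2 = c - x\<^sup>2 * C\<^sup>2" using that(4) by (simp add: Y power_mult_distrib)
      have "(C * H1 - x * s)\<^sup>2 + Y1\<^sup>2 = (C\<^sup>2 * H1\<^sup>2 + c + 2 * s * C * H * H1 - H\<^sup>2)
          + 2 * (H - s * C * H1) * \<tau> - \<tau>\<^sup>2"
        using that(2) Y1 unfolding t by algebra
      thus ?thesis using 3 t by simp
    qed
    show ?thesis
      using alg[OF cosh_real_pos cosh_square_eq \<tau> yc main] by simp
  qed
  define \<tau>0 where "\<tau>0 = h u1 + y v1 / cosh u1"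
  obtain vm vp where vm: "\<bar>vm - v1\<bar> < \<eta>" "y vm < y v1" and vp: "\<bar>vp - v1\<bar> < \<eta>" "y v1 < y vp"
  proof (cases "y1 v1 > 0")
    case True
    obtain d where d: "d > 0" "\<And>h. 0 < h \<Longrightarrow> h < d \<Longrightarrow> y v1 < y (v1 + h)" using DERIV_pos_inc_right[OF yD True] by blast
    obtain d' where d': "d' > 0" "\<And>h. 0 < h \<Longrightarrow> h < d' \<Longrightarrow> y (v1 - h) < y v1" using DERIV_pos_inc_left[OF yD True] by blast
    define t where "t = min \<eta> (min d d') / 2"
    have "0 < t" "t < \<eta>" "t < d" "t < d'" using d(1) d'(1) \<eta>(1) by (auto simp: t_def min_def)
    thus ?thesis using d(2) d'(2) by (intro that[of "v1 - t" "v1 + t"]) auto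
  next
    case False
    hence n: "y1 v1 < 0" using v1(1) by simp
    obtain d where d: "d > 0" "\<And>h. 0 < h \<Longrightarrow> h < d \<Longrightarrow> y (v1 + h) < y v1" using DERIV_neg_dec_right[OF yD n] by blast
    obtain d' where d': "d' > 0" "\<And>h. 0 < h \<Longrightarrow> h < d' \<Longrightarrow> y v1 < y (v1 - h)" using DERIV_neg_dec_left[OF yD n] by blast
    define t where "t = min \<eta> (min d d') / 2"
    have "0 < t" "t < \<eta>" "t < d" "t < d'" using d(1) d'(1) \<eta>(1) by (auto simp: t_def min_def)
    thus ?thesis using d(2) d'(2) by (intro that[of "v1 + t" "v1 - t"]) auto
  qed
  \<comment> \<open>Half of the smaller gap: by continuity, the values of the support function on each nearby parallel still cover the interval of radius \<open>\<kappa>\<close> about \<open>\<tau>0\<close>.\<close>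
  define \<kappa> where "\<kappa> = min (y v1 - y vm) (y vp - y v1) / (2 * cosh u1)"
  have \<kappa>: "\<kappa> > 0" using vm vp by (simp add: \<kappa>_def)
  have gap: "h u1 + y vm / cosh u1 < \<tau>0 - \<kappa>" "\<tau>0 + \<kappa> < h u1 + y vp / cosh u1"
  proof -
    have C: "cosh u1 > 0" by simp
    have "\<kappa> < (y v1 - y vm) / cosh u1" "\<kappa> < (y vp - y v1) / cosh u1"
      unfolding \<kappa>_def using vm vp C by (auto simp: field_simps min_def)
    thus "h u1 + y vm / cosh u1 < \<tau>0 - \<kappa>" "\<tau>0 + \<kappa> < h u1 + y vp / cosh u1"
      by (simp_all add: \<tau>0_def diff_divide_distrib)
  qed
  have cont: "isCont (\<lambda>u. h u + a / cosh u) u1" for a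
    using DERIV_isCont[OF hD[of u1]] \<eta>(1) by (intro continuous_intros) auto
  have cont': "((\<lambda>u. h u + a / cosh u) \<longlongrightarrow> h u1 + a / cosh u1) (nhds u1)" for a
    using cont[of a] tendsto_at_iff_tendsto_nhds[of "\<lambda>u. h u + a / cosh u" u1] unfolding isCont_def by simp
  have "eventually (\<lambda>u. h u + y vm / cosh u < \<tau>0 - \<kappa>) (nhds u1)"
    "eventually (\<lambda>u. \<tau>0 + \<kappa> < h u + y vp / cosh u) (nhds u1)"
    using order_tendstoD[OF cont'] gap by auto
  hence "eventually (\<lambda>u. \<bar>u - u1\<bar> < \<eta> \<and> h u + y vm / cosh u < \<tau>0 - \<kappa> \<and> \<tau>0 + \<kappa> < h u + y vp / cosh u) (nhds u1)"
    using open_near[of u1 u1] \<eta>(1) by (intro eventually_conj) simp_all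
  then obtain \<rho> where \<rho>: "\<rho> > 0" "\<And>u. \<bar>u - u1\<bar> < \<rho> \<Longrightarrow> \<bar>u - u1\<bar> < \<eta> \<and> h u + y vm / cosh u < \<tau>0 - \<kappa> \<and> \<tau>0 + \<kappa> < h u + y vp / cosh u"
    unfolding eventually_nhds_metric dist_real_def by blast
  have "\<exists>r m. \<forall>u. u1 - \<rho> < u \<longrightarrow> u < u1 + \<rho> \<longrightarrow> h u = r + m * tanh u"
  proof (rule sphere_profile_of_rational_ratio[of "u1 - \<rho>" "u1 + \<rho>" h h1 h2 c \<kappa> \<tau>0 k])
    fix u assume "u1 - \<rho> < u" "u < u1 + \<rho>"
    hence u: "\<bar>u - u1\<bar> < \<rho>" by auto
    note u' = \<rho>(2)[OF u]
    show "u \<noteq> 0" using u' u_nz by blast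
    show "(h has_real_derivative h1 u) (at u)" "(h1 has_real_derivative h2 u) (at u)" using u' hD h1D by auto
    fix \<tau> assume \<tau>: "\<bar>\<tau> - \<tau>0\<bar> \<le> \<kappa>"
    have C: "cosh u > 0" by simp
    have "y vm / cosh u \<le> \<tau> - h u" "\<tau> - h u \<le> y vp / cosh u" using \<tau> u' by auto
    hence b: "y vm \<le> (\<tau> - h u) * cosh u" "(\<tau> - h u) * cosh u \<le> y vp" using C by (simp_all add: field_simps)
    have yc': "continuous_on X y" for X using yD by (meson DERIV_isCont continuous_at_imp_continuous_on)
    obtain v where v: "v \<in> closed_segment vm vp" "y v = (\<tau> - h u) * cosh u"
      using IVT'_closed_segment_real[of "(\<tau> - h u) * cosh u" y vm vp] b yc' by (auto simp: closed_segment_eq_real_ivl)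
    have "\<bar>v - v1\<bar> < \<eta>" using v(1) vm(1) vp(1) by (auto simp: closed_segment_eq_real_ivl split: if_splits)
    moreover have "\<tau> = h u + y v / cosh u" using C v(2) by simp
    ultimately show "((cosh u)\<^sup>2 * h2 u + 2 * h u) - 2 * \<tau> =
        k \<tau> * (((cosh u)\<^sup>2 * (h1 u)\<^sup>2 + c + 2 * sinh u * cosh u * h u * h1 u - (h u)\<^sup>2)
          + 2 * (h u - sinh u * cosh u * h1 u) * \<tau> - \<tau>\<^sup>2)"
      using ratio u' by blast
  qed (use \<rho> c \<kappa> in auto)
  then obtain r m where hm: "\<And>u. u1 - \<rho> < u \<Longrightarrow> u < u1 + \<rho> \<Longrightarrow> h u = r + m * tanh u" by blast
  have h1m: "h1 u = m / (cosh u)\<^sup>2" if u: "\<bar>u - u1\<bar> < \<rho>" for u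
  proof -
    have "((\<lambda>u. r + m * tanh u) has_real_derivative m * (1 - (tanh u)\<^sup>2)) (at u)"
      by (auto intro!: derivative_eq_intros)
    moreover have "(1 - (tanh u)\<^sup>2) = 1 / (cosh u)\<^sup>2"
      by (simp add: tanh_def power_divide sinh_square_eq field_simps)
    ultimately have "((\<lambda>u. r + m * tanh u) has_real_derivative m / (cosh u)\<^sup>2) (at u)" by simp
    hence "(h has_real_derivative m / (cosh u)\<^sup>2) (at u)"
      by (rule has_field_derivative_transform_within_open[of _ _ _ "{u1 - \<rho><..<u1 + \<rho>}"]) (use u hm in auto)
    thus ?thesis using hD \<rho>(2)[OF u] DERIV_unique by blast
  qed
  define U where "U = {z. \<bar>Re z - u1\<bar> < \<rho> \<and> \<bar>Im z - v1\<bar> < \<eta>}"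
  \<comment> \<open>The centre of the sphere: \<open>h + y / cosh u = r + d \<bullet> \<nu>\<close> with \<open>\<nu> = (cis v / cosh u, - tanh u)\<close>.\<close>
  define d :: space3 where "d = (\<i> * E, - m)"
  show ?thesis
  proof (rule that[of U d])
    show "open U" unfolding U_def by (intro open_Collect_conj open_Collect_less continuous_intros)
    show "U \<noteq> {}" using \<rho>(1) \<eta>(1) by (auto simp: U_def intro!: exI[of _ "Complex u1 v1"])
    show "U \<subseteq> S" using \<rho>(2) box by (metis (no_types, lifting) U_def complex_surj mem_Collect_eq subsetI)
    show "d \<noteq> 0" using E by (simp add: d_def zero_prod_def)
    fix z assume z: "z \<in> U"
    define u v where "u = Re z" and "v = Im z"
    have zuv: "z = Complex u v" by (simp add: u_def v_def)
    have uv: "\<bar>u - u1\<bar> < \<rho>" "\<bar>u - u1\<bar> < \<eta>" "\<bar>v - v1\<bar> < \<eta>" using z \<rho>(2) by (auto simp: U_def u_def v_def)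
    have C: "cosh u > 0" by simp
    have q: "rot_field d (exp z) / exp z =
      Complex (- (cosh u * - y1 v)) (sinh u * y v - m)"
    proof -
      have "rot_field d (exp z) / exp z = (\<i> / 2) * (cnj (fst d) * exp z + 2 * of_real (snd d) - fst d * exp (- z))"
        unfolding rot_field_def by (simp add: field_simps power2_eq_square exp_minus)
      also have "\<dots> = Complex (- (cosh u * - y1 v)) (sinh u * y v - m)"
      proof -
        define p where "p = exp u"
        define m' where "m' = exp (- u)"
        have e: "exp z = of_real p * cis v" "exp (- z) = of_real m' * cis (- v)"
          unfolding exp_eq_polar[of z] exp_eq_polar[of "- z"] by (simp_all add: p_def m'_def u_def v_def)
        have c: "cosh u = (p + m') / 2" "sinh u = (p - m') / 2"
          by (simp_all add: cosh_field_def sinh_field_def p_def m'_def)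
        show ?thesis
          unfolding e c d_def y_def y1_def complex_eq_iff
          by (simp add: algebra_simps add_divide_distrib diff_divide_distrib)
      qed
      finally show ?thesis .
    qed
    have A: "l1' (\<mu> u v) * Re (f1 z) = m / (cosh u)\<^sup>2 - y v * sinh u / (cosh u)\<^sup>2"
      using \<psi>u_eq[OF uv(2,3)] h1m[OF uv(1)] by (simp add: zuv)
    have B: "l1' (\<mu> u v) * - Im (f1 z) = y1 v / cosh u" using \<psi>v_eq[OF uv(2,3)] by (simp add: zuv)
    have "l1' (\<mu> u v) * Re (f1 z * (rot_field d (exp z) / exp z)) =
      (l1' (\<mu> u v) * Re (f1 z)) * (cosh u * y1 v) + (l1' (\<mu> u v) * - Im (f1 z)) * (sinh u * y v - m)"
      unfolding q by (simp add: algebra_simps)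
    also have "\<dots> = 0" unfolding A B using C by (simp add: field_simps power2_eq_square)
    finally show "Re (deriv F z * (rot_field d (exp z) / exp z)) = 0" using l' by (simp add: l1'_def f1_def)
  qed
qed

section \<open>Local rotational symmetry and the profile curve\<close>
definition rotational_near :: "('a::t2_space \<Rightarrow> space3) \<Rightarrow> space3 \<Rightarrow> space3 \<Rightarrow> 'a \<Rightarrow> bool" where
  "rotational_near X x0 d p \<longleftrightarrow>
     (\<exists>W Q. open W \<and> p \<in> W \<and> (\<exists>Y. homeomorphism W (X ` W) X Y) \<and>
        openin (top_of_set Q) (X ` W) \<and>
        (\<forall>t. Q \<inter> axis_plane x0 d t = {} \<or>
             (\<exists>r\<ge>0. Q \<inter> axis_plane x0 d t = axis_circle x0 d t r)))"

lemma rotational_iff: "rotational X \<longleftrightarrow> (\<exists>x0 d. norm d = 1 \<and> (\<forall>p. rotational_near X x0 d p))"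
  unfolding rotational_def rotational_near_def ..

lemma profile_hyperbolic:
  "profile_M l a b u = - a * deriv l (a * u + b) * sinh u + l (a * u + b) / cosh u"
  "profile_N l a b u = - a * deriv l (a * u + b) - l (a * u + b) * tanh u"
proof -
  define e where "e = exp u"
  have e: "e > 0" by (simp add: e_def)
  have x: "exp (2 * u) = e\<^sup>2" "exp (- u) = 1 / e" "exp (3 * u) = e ^ 3"
    unfolding e_def by (simp_all add: exp_of_nat_mult[symmetric] exp_minus inverse_eq_divide power2_eq_square power3_eq_cube exp_add[symmetric])
  have h: "sinh u = (e - 1 / e) / 2" "cosh u = (e + 1 / e) / 2"
    by (simp_all add: sinh_field_def cosh_field_def e_def exp_minus inverse_eq_divide)
  have p: "1 + e\<^sup>2 > 0" by (simp add: add_pos_nonneg)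
  have q: "e * e + 1 \<noteq> 0" "1 + e * e \<noteq> 0" using p by (simp_all add: power2_eq_square)
  have c: "1 / cosh u = 2 * e / (1 + e\<^sup>2)" "tanh u = (e\<^sup>2 - 1) / (1 + e\<^sup>2)"
    unfolding tanh_def h using e p q by (simp_all add: divide_simps power2_eq_square)
  have m: "1 / e - e ^ 3 = (1 + e\<^sup>2) * (1 / e - e)"
    using e by (simp add: field_simps power2_eq_square power3_eq_cube)
  have "profile_M l a b u = deriv l (a * u + b) * (a * ((1 / e - e) / 2)) + l (a * u + b) * (2 * e / (1 + e\<^sup>2))"
  proof -
    have "1 / p * ((a * B * (p * w) + 4 * L * e) / 2) = B * (a * (w / 2)) + L * (2 * e / p)"
      if "p > 0" for p B w L :: real
      using that by (simp add: field_simps)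
    from this[OF p] show ?thesis unfolding profile_M_def Let_def x m e_def[symmetric] .
  qed
  thus "profile_M l a b u = - a * deriv l (a * u + b) * sinh u + l (a * u + b) / cosh u"
    unfolding c(1)[symmetric] h(1) by (simp add: algebra_simps add_divide_distrib diff_divide_distrib)
  have "profile_N l a b u = - a * deriv l (a * u + b) - l (a * u + b) * ((e\<^sup>2 - 1) / (1 + e\<^sup>2))"
    unfolding profile_N_def Let_def x using p by (simp add: field_simps)
  thus "profile_N l a b u = - a * deriv l (a * u + b) - l (a * u + b) * tanh u" unfolding c(2) .
qed

lemma grt_normal_exp: "grt_normal (exp z) = (of_real (1 / cosh (Re z)) * cis (Im z), - tanh (Re z))"
proof -
  define e where "e = exp (Re z)"
  have e: "e > 0" by (simp add: e_def)
  have h: "cosh (Re z) = (e + 1 / e) / 2" "sinh (Re z) = (e - 1 / e) / 2"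
    by (simp_all add: sinh_field_def cosh_field_def e_def exp_minus inverse_eq_divide)
  have p: "1 + e\<^sup>2 > 0" by (simp add: add_pos_nonneg)
  have q: "e * e + 1 \<noteq> 0" "1 + e * e \<noteq> 0" using p by (simp_all add: power2_eq_square)
  have c: "1 / cosh (Re z) = 2 * e / (1 + e\<^sup>2)" "- tanh (Re z) = (1 - e\<^sup>2) / (1 + e\<^sup>2)"
    unfolding tanh_def h using e p q by (simp_all add: divide_simps power2_eq_square) (simp add: algebra_simps)
  show ?thesis unfolding c grt_normal_def exp_eq_polar[of z]
    by (simp add: e_def[symmetric] e[THEN less_imp_le] norm_mult scaleR_conv_of_real)
qed

lemma X_ab_eq:
  "X_ab l a b z = (deriv l (a * Re z + b) / 2) *\<^sub>R grad_vec (exp z) (of_real a / exp z)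
     + l (a * Re z + b) *\<^sub>R grt_normal (exp z)"
proof -
  have "cnj (of_real a / exp z) = of_real (a * exp (- Re z)) * cis (Im z)"
    unfolding exp_eq_polar[of z] by (simp add: exp_minus cis_cnj divide_inverse cis_inverse flip: of_real_inverse)
  moreover have "(exp z)\<^sup>2 * (of_real a / exp z) = of_real (a * exp (Re z)) * cis (Im z)"
    unfolding exp_eq_polar[of z] by (simp add: power2_eq_square)
  moreover have "- 2 * Re (exp z * (of_real a / exp z)) = - 2 * a" by simp
  ultimately have "grad_vec (exp z) (of_real a / exp z) = (of_real (- (2 * a) * sinh (Re z)) * cis (Im z), - 2 * a)"
    unfolding grad_vec_def by (simp add: sinh_field_def algebra_simps)
  thus ?thesis
    unfolding X_ab_def profile_hyperbolic grt_normal_exp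
    by (simp add: complex_eq_iff algebra_simps)
qed

lemma X_ab_polar: "X_ab l a b z = (of_real (profile_M l a b (Re z)) * cis (Im z), profile_N l a b (Re z))"
  by (simp add: X_ab_def complex_eq_iff)

text \<open>
  The meridian is orthogonal to the normal \<open>(1 / cosh u, - tanh u)\<close>, hence \<open>M' = N' sinh u\<close>. In particular
  a regular meridian has \<open>N' \<noteq> 0\<close>: it is a graph over the axis.
\<close>
lemma profile_derivatives:
  fixes l :: "real \<Rightarrow> real"
  assumes l1: "\<And>t. l field_differentiable (at t)" and l2: "\<And>t. deriv l field_differentiable (at t)"
  obtains N' where "(profile_N l a b has_real_derivative N') (at u)"
    "(profile_M l a b has_real_derivative N' * sinh u) (at u)"
proof -
  have lD: "(l has_real_derivative deriv l t) (at t)" and l1D: "(deriv l has_real_derivative deriv (deriv l) t) (at t)" for t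
    using l1 l2 by (simp_all add: field_differentiable_derivI)
  define m where "m = (\<lambda>u. a * u + b)"
  have m: "(m has_real_derivative a) (at u)" unfolding m_def by (auto intro!: derivative_eq_intros)
  note D = DERIV_chain2[OF lD m] and D1 = DERIV_chain2[OF l1D m]
  define N' where "N' = - a * (deriv (deriv l) (m u) * a) - (deriv l (m u) * a * tanh u + l (m u) * (1 / (cosh u)\<^sup>2))"
  have t: "1 - (tanh u)\<^sup>2 = 1 / (cosh u)\<^sup>2" by (simp add: tanh_def power_divide sinh_square_eq field_simps)
  have "((\<lambda>u. - a * deriv l (m u) - l (m u) * tanh u) has_real_derivative
     - a * (deriv (deriv l) (m u) * a) - (deriv l (m u) * a * tanh u + l (m u) * (1 - (tanh u)\<^sup>2))) (at u)"
    by (rule derivative_eq_intros D D1 refl | simp)+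
  hence 1: "(profile_N l a b has_real_derivative N') (at u)"
    unfolding N'_def t profile_hyperbolic[abs_def] m_def by (simp add: mult.assoc)
  have s: "sinh u * sinh u = cosh u * cosh u - 1" using sinh_square_eq[of u] by (simp add: power2_eq_square)
  have "((\<lambda>u. - a * deriv l (m u) * sinh u + l (m u) / cosh u) has_real_derivative
     - a * (deriv (deriv l) (m u) * a) * sinh u + - a * deriv l (m u) * cosh u
       + (deriv l (m u) * a * cosh u - l (m u) * sinh u) / (cosh u * cosh u)) (at u)"
    by (rule derivative_eq_intros D D1 refl | simp)+
  moreover have "- a * (deriv (deriv l) (m u) * a) * sinh u + - a * deriv l (m u) * cosh u
       + (deriv l (m u) * a * cosh u - l (m u) * sinh u) / (cosh u * cosh u) = N' * sinh u"
  proof -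
    have "- a * A * S + - a * B * C + (B * a * C - L * S) / (C * C) = (- a * A - (B * a * (S / C) + L * (1 / C\<^sup>2))) * S"
      if "C > 0" "S * S = C * C - 1" for A B C L S :: real
    proof -
      have "B * a * (S / C) * S = B * a * (S * S) / C" by simp
      also have "\<dots> = B * a * C - B * a / C" unfolding that(2) using that(1) by (simp add: field_simps)
      finally have "B * a * (S / C) * S = B * a * C - B * a / C" .
      moreover have "(B * a * C - L * S) / (C * C) = B * a / C - L * (1 / C\<^sup>2) * S"
        using that(1) by (simp add: field_simps power2_eq_square)
      ultimately show ?thesis by (simp add: algebra_simps)
    qed
    from this[OF cosh_real_pos s] show ?thesis unfolding N'_def tanh_def .
  qed
  ultimately have 2: "(profile_M l a b has_real_derivative N' * sinh u) (at u)"
    unfolding profile_hyperbolic[abs_def] m_def by simp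
  show ?thesis using that 1 2 .
qed

section \<open>Pieces of surfaces of revolution\<close>

text \<open>
  Since \<open>N' \<noteq> 0\<close>, the height determines the point of the meridian and thus the radius of the circle, so the
  full surface of revolution \<open>Q\<close> of a short meridian has circles as horizontal sections. The inverse of
  the parametrization reads off the longitude from the unit complex number \<open>\<rho>\<close>; on the half of the circle in question
  \<open>arcsin (Im \<rho>)\<close> does it, and this is continuous on all of \<open>Q\<close>, so that the piece is cut out of \<open>Q\<close> by the
  open condition \<open>Re \<rho> > cos \<eta>\<close>.
\<close>
lemma revolution_patch:
  fixes M N :: "real \<Rightarrow> real"
  assumes S: "open S" "\<zeta>0 \<in> S"
    and N: "\<And>z. z \<in> S \<Longrightarrow> \<exists>N'. (N has_real_derivative N') (at (Re z)) \<and> N' \<noteq> 0"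
    and M: "\<And>z. z \<in> S \<Longrightarrow> isCont M (Re z)" "\<And>z. z \<in> S \<Longrightarrow> M (Re z) \<noteq> 0"
  defines "P \<equiv> \<lambda>z. (of_real (M (Re z)) * cis (Im z), N (Re z)) :: space3"
  obtains B Y Q where "open B" "\<zeta>0 \<in> B" "B \<subseteq> S" "homeomorphism B (P ` B) P Y"
    "openin (top_of_set Q) (P ` B)"
    "\<And>t. Q \<inter> {x. snd x = t} = {} \<or> (\<exists>r\<ge>0. Q \<inter> {x. snd x = t} = {x. snd x = t \<and> cmod (fst x) = r})"
proof -
  define u0 v0 where "u0 = Re \<zeta>0" and "v0 = Im \<zeta>0"
  obtain \<epsilon> where \<epsilon>: "\<epsilon> > 0" "ball \<zeta>0 \<epsilon> \<subseteq> S" using S openE by blast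
  define \<eta> where "\<eta> = min (\<epsilon> / 2) 1"
  have \<eta>: "\<eta> > 0" "2 * \<eta> \<le> \<epsilon>" "\<eta> \<le> 1" using \<epsilon> by (auto simp: \<eta>_def)
  have \<eta>pi: "\<eta> < pi / 2" using \<eta>(3) pi_gt3 by simp
  have inS: "Complex u v \<in> S" if "\<bar>u - u0\<bar> \<le> \<eta>" "\<bar>v - v0\<bar> < \<eta>" for u v
  proof -
    have "cmod (Complex u v - \<zeta>0) \<le> \<bar>u - u0\<bar> + \<bar>v - v0\<bar>"
      using cmod_le[of "Complex u v - \<zeta>0"] by (simp add: u0_def v0_def)
    also have "\<dots> < \<epsilon>" using that \<eta>(2) by linarith
    finally show ?thesis using \<epsilon>(2) by (auto simp: dist_norm norm_minus_commute)
  qed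
  define I where "I = {u0 - \<eta>..u0 + \<eta>}"
  have I: "\<exists>N'. (N has_real_derivative N') (at u) \<and> N' \<noteq> 0" "isCont M u" "M u \<noteq> 0" if "u \<in> I" for u
  proof -
    have "Complex u v0 \<in> S" using inS[of u v0] that \<eta>(1) by (auto simp: I_def)
    from N[OF this] M[OF this]
    show "\<exists>N'. (N has_real_derivative N') (at u) \<and> N' \<noteq> 0" "isCont M u" "M u \<noteq> 0" by simp_all
  qed
  have Ncont: "continuous_on I N"
    using I(1) by (meson DERIV_isCont continuous_at_imp_continuous_on)
  have Mcont: "continuous_on I M" using I(2) by (simp add: continuous_at_imp_continuous_on)
  have inj: "inj_on N I"
  proof -
    have "N x \<noteq> N y" if xy: "x \<in> I" "y \<in> I" "x < y" for x y
    proof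
      assume eq: "N x = N y"
      have sub: "{x..y} \<subseteq> I" using xy by (auto simp: I_def)
      obtain z where z: "x < z" "z < y" "(N has_real_derivative 0) (at z)"
      proof -
        have "\<exists>z. x < z \<and> z < y \<and> DERIV N z :> 0"
        proof (rule Rolle[OF xy(3) eq])
          show "continuous_on {x..y} N" using Ncont sub continuous_on_subset by blast
          show "\<And>z. x < z \<Longrightarrow> z < y \<Longrightarrow> N differentiable (at z)"
            using I(1) sub by (meson atLeastAtMost_iff less_imp_le real_differentiable_def subsetD)
        qed
        thus ?thesis using that by blast
      qed
      moreover have "z \<in> I" using z xy by (auto simp: I_def)
      ultimately show False using I(1) DERIV_unique by blast
    qed
    thus ?thesis by (metis inj_onI linorder_neqE_linordered_idom)
  qed
  define g where "g = inv_into I N"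
  have gN: "g (N u) = u" if "u \<in> I" for u unfolding g_def using inj that by simp
  have gcont: "continuous_on (N ` I) g"
    by (rule continuous_on_inv[OF Ncont]) (auto simp: I_def[symmetric] gN, simp add: I_def)
  define Q where "Q = {x :: space3. \<exists>u. \<bar>u - u0\<bar> < \<eta> \<and> snd x = N u \<and> cmod (fst x) = \<bar>M u\<bar>}"
  have Q: "snd x \<in> N ` I" "g (snd x) \<in> I" "\<bar>g (snd x) - u0\<bar> < \<eta>" "N (g (snd x)) = snd x" "cmod (fst x) = \<bar>M (g (snd x))\<bar>"
    if "x \<in> Q" for x
  proof -
    from that obtain u where u: "\<bar>u - u0\<bar> < \<eta>" "snd x = N u" "cmod (fst x) = \<bar>M u\<bar>" by (auto simp: Q_def)
    hence uI: "u \<in> I" by (auto simp: I_def)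
    thus "snd x \<in> N ` I" "g (snd x) \<in> I" "\<bar>g (snd x) - u0\<bar> < \<eta>" "N (g (snd x)) = snd x" "cmod (fst x) = \<bar>M (g (snd x))\<bar>"
      using u gN[OF uI] by auto
  qed
  define \<rho> where "\<rho> x = fst x * cis (- v0) / of_real (M (g (snd x)))" for x :: space3
  have gQ: "continuous_on Q (\<lambda>x. g (snd x))"
    by (rule continuous_on_compose2[OF gcont]) (auto intro!: continuous_intros Q)
  have MQ: "continuous_on Q (\<lambda>x. M (g (snd x)))"
    by (rule continuous_on_compose2[OF Mcont gQ]) (auto intro!: Q)
  have \<rho>cont: "continuous_on Q \<rho>"
    unfolding \<rho>_def using Q(2) I(3) by (intro continuous_intros MQ) auto
  have \<rho>1: "cmod (\<rho> x) = 1" if "x \<in> Q" for x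
    using Q(5)[OF that] I(3)[OF Q(2)[OF that]] by (simp add: \<rho>_def norm_mult norm_divide)
  define Y where "Y x = Complex (g (snd x)) (v0 + arcsin (Im (\<rho> x)))" for x
  define B where "B = {z. \<bar>Re z - u0\<bar> < \<eta> \<and> \<bar>Im z - v0\<bar> < \<eta>}"
  have BI: "Re z \<in> I" if "z \<in> B" for z using that by (auto simp: B_def I_def)
  have PQ: "P z \<in> Q" if "z \<in> B" for z
    using that by (auto simp: B_def P_def Q_def norm_mult intro!: exI[of _ "Re z"])
  have \<rho>P: "\<rho> (P z) = cis (Im z - v0)" if "z \<in> B" for z
    using gN[OF BI[OF that]] I(3)[OF BI[OF that]] by (simp add: \<rho>_def P_def cis_mult)
  have YP: "Y (P z) = z" if "z \<in> B" for z
  proof -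
    have "\<bar>Im z - v0\<bar> \<le> pi / 2" using that \<eta>pi by (simp add: B_def)
    hence "arcsin (sin (Im z - v0)) = Im z - v0" by (intro arcsin_sin) linarith+
    thus ?thesis using gN[OF BI[OF that]] \<rho>P[OF that] by (simp add: Y_def complex_eq_iff P_def)
  qed
  have img: "P ` B = Q \<inter> \<rho> -` {w. Re w > cos \<eta>}"
  proof (intro equalityI subsetI)
    fix x assume "x \<in> P ` B"
    then obtain z where z: "z \<in> B" "x = P z" by blast
    have "cos \<eta> < cos \<bar>Im z - v0\<bar>"
      using z \<eta>pi pi_gt_zero by (intro cos_monotone_0_pi) (auto simp: B_def)
    thus "x \<in> Q \<inter> \<rho> -` {w. Re w > cos \<eta>}" using z PQ \<rho>P by (simp add: abs_if split: if_splits) (metis cos_minus minus_diff_eq)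
  next
    fix x assume "x \<in> Q \<inter> \<rho> -` {w. Re w > cos \<eta>}"
    hence x: "x \<in> Q" "Re (\<rho> x) > cos \<eta>" by auto
    have cpos: "cos \<eta> > 0" using \<eta>pi \<eta>(1) by (intro cos_gt_zero_pi) auto
    define w where "w = arcsin (Im (\<rho> x))"
    have one: "(Re (\<rho> x))\<^sup>2 + (Im (\<rho> x))\<^sup>2 = 1" using \<rho>1[OF x(1)] by (metis cmod_power2 one_power2)
    have b: "-1 \<le> Im (\<rho> x)" "Im (\<rho> x) \<le> 1" using abs_Im_le_cmod[of "\<rho> x"] \<rho>1[OF x(1)] by auto
    have s: "sin w = Im (\<rho> x)" unfolding w_def using b by simp
    have "cos w = sqrt (1 - (Im (\<rho> x))\<^sup>2)" unfolding w_def using b by (rule cos_arcsin)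
    also have "1 - (Im (\<rho> x))\<^sup>2 = (Re (\<rho> x))\<^sup>2" using one by simp
    finally have c: "cos w = Re (\<rho> x)" using x(2) cpos by simp
    have cis: "cis w = \<rho> x" by (simp add: complex_eq_iff s c)
    have "\<bar>w\<bar> \<le> pi / 2" unfolding w_def using arcsin_bounded[OF b] by linarith
    have "\<bar>w\<bar> < \<eta>"
    proof (rule ccontr)
      assume "\<not> \<bar>w\<bar> < \<eta>"
      hence "cos \<bar>w\<bar> \<le> cos \<eta>" using \<eta>(1) \<open>\<bar>w\<bar> \<le> pi / 2\<close> pi_gt_zero by (intro cos_monotone_0_pi_le) auto
      thus False using x(2) c by (simp add: abs_if split: if_splits)
    qed
    hence "Y x \<in> B" using Q(3)[OF x(1)] by (simp add: Y_def B_def w_def)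
    moreover have "P (Y x) = x"
    proof -
      have "of_real (M (g (snd x))) * cis (v0 + w) = fst x"
        unfolding cis_mult[symmetric] cis using I(3)[OF Q(2)[OF x(1)]] by (simp add: \<rho>_def cis_mult)
      thus ?thesis using Q(4)[OF x(1)] by (simp add: P_def Y_def w_def prod_eq_iff)
    qed
    ultimately show "x \<in> P ` B" by (metis imageI)
  qed
  show ?thesis
  proof (rule that[of B Y Q])
    show "open B" unfolding B_def by (intro open_Collect_conj open_Collect_less continuous_intros)
    show "\<zeta>0 \<in> B" using \<eta>(1) by (simp add: B_def u0_def v0_def)
    show "B \<subseteq> S"
    proof
      fix z assume "z \<in> B" thus "z \<in> S" using inS[of "Re z" "Im z"] by (simp add: B_def)
    qed
    show "homeomorphism B (P ` B) P Y"
    proof (rule homeomorphismI)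
      have "continuous_on B (\<lambda>z. M (Re z))" "continuous_on B (\<lambda>z. N (Re z))"
        by (rule continuous_on_compose2[OF Mcont] continuous_on_compose2[OF Ncont]; use BI in \<open>auto intro!: continuous_intros\<close>)+
      moreover have "continuous_on B (\<lambda>z. cis (Im z))" by (intro continuous_intros)
      ultimately show "continuous_on B P" unfolding P_def by (intro continuous_intros)
      have "-1 \<le> Im (\<rho> x)" "Im (\<rho> x) \<le> 1" if "x \<in> Q" for x
        using abs_Im_le_cmod[of "\<rho> x"] \<rho>1[OF that] by linarith+
      hence "continuous_on Q Y" unfolding Y_def Complex_eq by (intro continuous_intros gQ \<rho>cont) auto
      thus "continuous_on (P ` B) Y" using img continuous_on_subset by blast
      show "P ` B \<subseteq> P ` B" by simp
      show "Y ` P ` B \<subseteq> B" using YP by auto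
      show "\<And>x. x \<in> B \<Longrightarrow> Y (P x) = x" by (rule YP)
      show "\<And>y. y \<in> P ` B \<Longrightarrow> P (Y y) = y" using YP by auto
    qed
    show "openin (top_of_set Q) (P ` B)"
      unfolding img by (rule continuous_openin_preimage_gen[OF \<rho>cont]) (intro open_Collect_less continuous_intros)
    fix t
    show "Q \<inter> {x. snd x = t} = {} \<or> (\<exists>r\<ge>0. Q \<inter> {x. snd x = t} = {x. snd x = t \<and> cmod (fst x) = r})"
    proof (cases "Q \<inter> {x. snd x = t} = {}")
      case False
      then obtain x where x: "x \<in> Q" "snd x = t" by blast
      have "Q \<inter> {x. snd x = t} = {x. snd x = t \<and> cmod (fst x) = \<bar>M (g t)\<bar>}"
      proof (intro equalityI subsetI)
        fix y assume "y \<in> {x. snd x = t \<and> cmod (fst x) = \<bar>M (g t)\<bar>}"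
        thus "y \<in> Q \<inter> {x. snd x = t}"
          using Q(3,4)[OF x(1)] x(2) unfolding Q_def by (auto intro!: exI[of _ "g t"])
      qed (use Q(5) in auto)
      thus ?thesis by (intro disjI2 exI[of _ "\<bar>M (g t)\<bar>"]) simp
    qed simp
  qed
qed

lemma axis_circle_rotated:
  assumes R: "orthogonal_transformation R"
  shows "axis_plane 0 (R (0, 1)) t = R ` {x :: space3. snd x = t}"
    "axis_circle 0 (R (0, 1)) t r = R ` {x :: space3. snd x = t \<and> cmod (fst x) = r}"
proof -
  have surj: "surj R" using R by (rule orthogonal_transformation_surj)
  have lin: "linear R" using R by (rule orthogonal_transformation_linear)
  have inner: "R x \<bullet> R y = x \<bullet> y" for x y using R unfolding orthogonal_transformation_def by blast
  have pl: "R x \<in> axis_plane 0 (R (0, 1)) t \<longleftrightarrow> snd x = t" for x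
    unfolding axis_plane_def by (simp add: inner) (simp add: inner_space3)
  have ci: "R x \<in> axis_circle 0 (R (0, 1)) t r \<longleftrightarrow> snd x = t \<and> cmod (fst x) = r" for x
  proof -
    have "dist (t *\<^sub>R R (0, 1)) (R x) = norm (R (t *\<^sub>R (0, 1) - x))"
      unfolding dist_norm linear_diff[OF lin] linear_scale[OF lin] ..
    also have "\<dots> = norm (t *\<^sub>R (0, 1) - x)" by (rule orthogonal_transformation_norm[OF R])
    finally have "dist (0 + t *\<^sub>R R (0, 1)) (R x) = norm (t *\<^sub>R (0, 1) - x)" by simp
    moreover have "norm (t *\<^sub>R (0, 1) - x) = cmod (fst x)" if "snd x = t"
      using that by (cases x) (simp add: norm_prod_def)
    ultimately show ?thesis using pl[of x] by (auto simp: axis_circle_def)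
  qed
  have im: "A = R ` {x. P x}" if "\<And>x. R x \<in> A \<longleftrightarrow> P x" for A P
  proof (intro equalityI subsetI)
    fix y assume y: "y \<in> A"
    obtain x where "y = R x" using surj by (rule surjE)
    thus "y \<in> R ` {x. P x}" using that y by blast
  qed (use that in blast)
  show "axis_plane 0 (R (0, 1)) t = R ` {x :: space3. snd x = t}" by (rule im) (rule pl)
  show "axis_circle 0 (R (0, 1)) t r = R ` {x :: space3. snd x = t \<and> cmod (fst x) = r}" by (rule im) (rule ci)
qed

text \<open>
  If the radius \<open>M\<close> vanished, the derivative along the parallel would vanish; if \<open>N'\<close> vanished, so would
  \<open>M'\<close> and the derivative along the meridian.
\<close>
lemma X_ab_nondegenerate:
  fixes l :: "real \<Rightarrow> real"
  assumes l1: "\<And>t. l field_differentiable (at t)" and l2: "\<And>t. deriv l field_differentiable (at t)"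
    and R: "linear R" and imm: "immersion_on S (R \<circ> X_ab l a b)" and z: "z \<in> S"
  shows "profile_M l a b (Re z) \<noteq> 0" "isCont (profile_M l a b) (Re z)"
    "\<exists>N'. (profile_N l a b has_real_derivative N') (at (Re z)) \<and> N' \<noteq> 0"
    "pd \<i> (R \<circ> X_ab l a b) z = R (of_real (profile_M l a b (Re z)) * (\<i> * cis (Im z)), 0)"
proof -
  define Y where "Y = R \<circ> X_ab l a b"
  define D where "D = frechet_derivative Y (at z)"
  have YD: "(Y has_derivative D) (at z)" and inj: "inj D"
    using imm z unfolding immersion_on_def C1_on_def Y_def[symmetric] D_def by (auto simp: frechet_derivative_works)
  define u v where "u = Re z" and "v = Im z"
  have zuv: "Complex u v = z" by (simp add: u_def v_def)
  obtain N' where N': "(profile_N l a b has_real_derivative N') (at u)"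
    "(profile_M l a b has_real_derivative N' * sinh u) (at u)" using profile_derivatives[OF l1 l2] by blast
  have Rb: "bounded_linear R" using R by (simp add: linear_conv_bounded_linear)
  have h: "((\<lambda>u. Complex u v) has_vector_derivative 1) (at u)"
    and w: "((\<lambda>v. Complex u v) has_vector_derivative \<i>) (at v)"
    by (simp_all add: has_vector_derivative_complex_iff)
  have 1: "((\<lambda>u. Y (Complex u v)) has_vector_derivative D 1) (at u)"
    using vector_derivative_diff_chain_within[of "\<lambda>u. Complex u v" 1 u UNIV Y D] h YD zuv
    by (auto simp: o_def intro: has_derivative_at_withinI)
  have 2: "((\<lambda>v. Y (Complex u v)) has_vector_derivative D \<i>) (at v)"
    using vector_derivative_diff_chain_within[of "\<lambda>v. Complex u v" \<i> v UNIV Y D] w YD zuv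
    by (auto simp: o_def intro: has_derivative_at_withinI)
  have 3: "((\<lambda>u. Y (Complex u v)) has_vector_derivative R (of_real (N' * sinh u) * cis v, N')) (at u)"
    unfolding Y_def o_def X_ab_polar
    by (intro bounded_linear.has_vector_derivative[OF Rb] has_vector_derivative_Pair)
      (use N' in \<open>auto intro!: derivative_eq_intros has_vector_derivative_mult_left has_vector_derivative_of_real simp: has_real_derivative_iff_has_vector_derivative\<close>)
  have 4: "((\<lambda>v. Y (Complex u v)) has_vector_derivative R (of_real (profile_M l a b u) * (\<i> * cis v), 0)) (at v)"
    unfolding Y_def o_def X_ab_polar
    by (intro bounded_linear.has_vector_derivative[OF Rb] has_vector_derivative_Pair)
      (auto intro!: derivative_eq_intros simp: has_vector_derivative_complex_iff)
  have D1: "D 1 = R (of_real (N' * sinh u) * cis v, N')" using vector_derivative_unique_at[OF 1 3] .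
  have Di: "D \<i> = R (of_real (profile_M l a b u) * (\<i> * cis v), 0)" using vector_derivative_unique_at[OF 2 4] .
  have D0: "D 0 = 0" using YD has_derivative_linear linear_0 by blast
  have R0: "R 0 = 0" using R linear_0 by blast
  have "D 1 \<noteq> 0" "D \<i> \<noteq> 0" using inj D0 by (metis injD zero_neq_one, metis injD complex_i_not_zero)
  hence "N' \<noteq> 0" "profile_M l a b u \<noteq> 0" using D1 Di R0 by (auto simp: zero_prod_def)
  thus "profile_M l a b (Re z) \<noteq> 0" "isCont (profile_M l a b) (Re z)"
    "\<exists>N'. (profile_N l a b has_real_derivative N') (at (Re z)) \<and> N' \<noteq> 0"
    using N' DERIV_isCont unfolding u_def by blast+
  show "pd \<i> (R \<circ> X_ab l a b) z = R (of_real (profile_M l a b (Re z)) * (\<i> * cis (Im z)), 0)"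
    using Di unfolding pd_def D_def Y_def u_def v_def .
qed

text \<open>
  A smaller parameter rectangle is embedded with the surface of revolution of its meridian as \<open>Q\<close>; the rotation
  \<open>R\<close> carries horizontal planes to planes orthogonal to the axis \<open>R (0, 1)\<close>.
\<close>
lemma rotational_near_if_parametrized:
  fixes X :: "'a::t2_space \<Rightarrow> space3" and l :: "real \<Rightarrow> real"
  assumes l1: "\<And>t. l field_differentiable (at t)" and l2: "\<And>t. deriv l field_differentiable (at t)"
    and R: "orthogonal_transformation R"
    and param: "parametrizes_near X (R \<circ> X_ab l a b) p"
  shows "rotational_near X 0 (R (0, 1)) p"
proof -
  obtain S V G H where S: "open S" and G: "open V" "homeomorphism S V G H" and p: "p \<in> V"
    and X: "\<And>z. z \<in> S \<Longrightarrow> X (G z) = R (X_ab l a b z)"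
    and imm: "immersion_on S (R \<circ> X_ab l a b)"
    using param unfolding parametrizes_near_def o_def by (elim exE conjE) simp
  define \<zeta>0 where "\<zeta>0 = H p"
  have \<zeta>0: "\<zeta>0 \<in> S" "G \<zeta>0 = p" using G(2) p by (auto simp: \<zeta>0_def homeomorphism_def)
  have lin: "linear R" using R by (rule orthogonal_transformation_linear)
  note nd = X_ab_nondegenerate[OF l1 l2 lin imm]
  define P where "P z = (of_real (profile_M l a b (Re z)) * cis (Im z), profile_N l a b (Re z))" for z
  obtain B Y Q where B: "open B" "\<zeta>0 \<in> B" "B \<subseteq> S" "homeomorphism B (P ` B) P Y"
    "openin (top_of_set Q) (P ` B)"
    and Q: "\<And>t. Q \<inter> {x. snd x = t} = {} \<or> (\<exists>r\<ge>0. Q \<inter> {x. snd x = t} = {x. snd x = t \<and> cmod (fst x) = r})"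
    using revolution_patch[OF S \<zeta>0(1) nd(3,2,1)] unfolding P_def by blast
  obtain R' where R': "homeomorphism UNIV UNIV R R'"
  proof -
    obtain R' where "homeomorphism (R ` UNIV) UNIV R' R"
      using linear_homeomorphism_image[OF lin orthogonal_transformation_inj[OF R]] by blast
    thus ?thesis using that orthogonal_transformation_surj[OF R] homeomorphism_symD by metis
  qed
  have injR: "inj R" using R by (rule orthogonal_transformation_inj)
  have GB: "homeomorphism B (G ` B) G H" using G(2) B(3) by (meson homeomorphism_of_subsets order_refl image_mono homeomorphism_def equalityD1 order_trans)
  have XP: "X (G z) = R (P z)" if "z \<in> B" for z using X B(3) that by (auto simp: X_ab_polar P_def)
  have img: "X ` (G ` B) = R ` (P ` B)" using XP by (simp add: image_image)
  have RP: "homeomorphism (P ` B) (R ` P ` B) R R'" using R' homeomorphism_of_subsets by blast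
  have "homeomorphism (G ` B) (R ` P ` B) (R \<circ> (P \<circ> H)) ((G \<circ> Y) \<circ> R')"
    by (rule homeomorphism_compose[OF homeomorphism_compose[OF homeomorphism_symD[OF GB] B(4)] RP])
  hence hom: "homeomorphism (G ` B) (X ` (G ` B)) X ((G \<circ> Y) \<circ> R')"
    unfolding img using XP GB by (elim homeomorphism_cong) (auto simp: homeomorphism_def)
  have opW: "open (G ` B)"
  proof -
    have "openin (top_of_set V) (G ` B)"
      using G(2) B(1,3) by (intro homeomorphism_imp_open_map[OF G(2)] open_subset)
    thus ?thesis using G(1) openin_open_trans by blast
  qed
  have opQ: "openin (top_of_set (R ` Q)) (R ` P ` B)"
  proof -
    have "homeomorphism Q (R ` Q) R R'" using R' homeomorphism_of_subsets by blast
    thus ?thesis using B(5) homeomorphism_imp_open_map by blast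
  qed
  show ?thesis
    unfolding rotational_near_def
  proof (intro exI conjI allI)
    show "open (G ` B)" by fact
    show "p \<in> G ` B" using B(2) \<zeta>0(2) by blast
    show "homeomorphism (G ` B) (X ` (G ` B)) X ((G \<circ> Y) \<circ> R')" by fact
    show "openin (top_of_set (R ` Q)) (X ` (G ` B))" unfolding img by fact
    fix t
    show "R ` Q \<inter> axis_plane 0 (R (0, 1)) t = {} \<or>
      (\<exists>r\<ge>0. R ` Q \<inter> axis_plane 0 (R (0, 1)) t = axis_circle 0 (R (0, 1)) t r)"
      unfolding axis_circle_rotated[OF R] image_Int[OF injR, symmetric] using Q[of t] by auto
  qed
qed

lemma immersion_on_compose:
  assumes imm: "immersion_on T Y" and T: "open T" and S: "open S" and \<omega>: "\<omega> holomorphic_on S" "\<omega> ` S \<subseteq> T"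
    and nz: "\<And>z. z \<in> S \<Longrightarrow> deriv \<omega> z \<noteq> 0"
  shows "immersion_on S (Y \<circ> \<omega>)"
proof -
  have YD: "(Y has_derivative frechet_derivative Y (at (\<omega> z))) (at (\<omega> z))" and Yinj: "inj (frechet_derivative Y (at (\<omega> z)))"
    if "z \<in> S" for z
    using imm \<omega>(2) that unfolding immersion_on_def C1_on_def by (auto simp: frechet_derivative_works)
  have D: "((Y \<circ> \<omega>) has_derivative (\<lambda>h. frechet_derivative Y (at (\<omega> z)) (deriv \<omega> z * h))) (at z)" if "z \<in> S" for z
    using diff_chain_at[of \<omega> "(*) (deriv \<omega> z)" z, OF _ YD[OF that]] holomorphic_derivI[OF \<omega>(1) S that]
    by (simp add: has_field_derivative_def o_def)
  have F: "frechet_derivative (Y \<circ> \<omega>) (at z) = (\<lambda>h. frechet_derivative Y (at (\<omega> z)) (deriv \<omega> z * h))" if "z \<in> S" for z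
    using frechet_derivative_at[OF D[OF that]] by simp
  have lin: "frechet_derivative Y (at (\<omega> z)) c = Re c *\<^sub>R pd 1 Y (\<omega> z) + Im c *\<^sub>R pd \<i> Y (\<omega> z)" if "z \<in> S" for z c
  proof -
    have L: "linear (frechet_derivative Y (at (\<omega> z)))" using YD[OF that] has_derivative_linear by blast
    have "frechet_derivative Y (at (\<omega> z)) c = frechet_derivative Y (at (\<omega> z)) (Re c *\<^sub>R 1 + Im c *\<^sub>R \<i>)"
      by (rule arg_cong[of c]) (simp add: complex_eq_iff)
    thus ?thesis unfolding pd_def linear_add[OF L] linear_scale[OF L] .
  qed
  have wc: "continuous_on S \<omega>" using \<omega>(1) by (rule holomorphic_on_imp_continuous_on)
  have dc: "continuous_on S (deriv \<omega>)" using holomorphic_deriv[OF \<omega>(1) S] by (rule holomorphic_on_imp_continuous_on)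
  have c: "continuous_on S (\<lambda>z. pd v Y (\<omega> z))" if "v = 1 \<or> v = \<i>" for v
    using imm that unfolding immersion_on_def C1_on_def by (intro continuous_on_compose2[OF _ wc \<omega>(2)]) auto
  have "continuous_on S (pd v (Y \<circ> \<omega>))" for v
  proof -
    have "continuous_on S (\<lambda>z. Re (deriv \<omega> z * v) *\<^sub>R pd 1 Y (\<omega> z) + Im (deriv \<omega> z * v) *\<^sub>R pd \<i> Y (\<omega> z))"
      by (intro continuous_intros dc c) auto
    moreover have "pd v (Y \<circ> \<omega>) z = Re (deriv \<omega> z * v) *\<^sub>R pd 1 Y (\<omega> z) + Im (deriv \<omega> z * v) *\<^sub>R pd \<i> Y (\<omega> z)" if "z \<in> S" for z
      using F[OF that] lin[OF that] unfolding pd_def[of v] by simp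
    ultimately show ?thesis by (simp cong: continuous_on_cong)
  qed
  moreover have "inj (frechet_derivative (Y \<circ> \<omega>) (at z))" if "z \<in> S" for z
    unfolding F[OF that]
  proof (rule injI)
    fix x y assume "frechet_derivative Y (at (\<omega> z)) (deriv \<omega> z * x) = frechet_derivative Y (at (\<omega> z)) (deriv \<omega> z * y)"
    hence "deriv \<omega> z * x = deriv \<omega> z * y" using Yinj[OF that] injD by metis
    thus "x = y" using nz[OF that] by simp
  qed
  ultimately show ?thesis
    unfolding immersion_on_def C1_on_def using D differentiableI by blast
qed

text \<open>
  Near the poles of a sphere polar coordinates break down, but there the stereographic coordinate gives the embedding
  directly.
\<close>
lemma rotational_near_sphere:
  fixes X :: "'a::t2_space \<Rightarrow> space3"
  assumes r: "r \<noteq> 0" and d: "norm d = 1" and S: "open S" "\<zeta>0 \<in> S"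
    and G: "open V" "homeomorphism S V G H"
    and g: "g holomorphic_on S" "inj_on g S"
    and X: "\<And>z. z \<in> S \<Longrightarrow> X (G z) = r *\<^sub>R grt_normal (g z)"
  shows "rotational_near X 0 d (G \<zeta>0)"
proof -
  define st where "st x = fst x / of_real (r + snd x)" for x :: space3
  define \<sigma> where "\<sigma> w = r *\<^sub>R grt_normal w" for w
  have \<sigma>: "snd (\<sigma> w) \<noteq> - r" "st (\<sigma> w) = w" "norm (\<sigma> w) = \<bar>r\<bar>" for w
  proof -
    define T where "T = 1 + (cmod w)\<^sup>2"
    have T: "T > 0" unfolding T_def by (rule one_plus_cmod2_pos)
    have n: "grt_normal w = ((2 / T) *\<^sub>R w, (2 - T) / T)"
      by (simp add: grt_normal_def T_def scaleR_conv_of_real)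
    have s: "r + snd (\<sigma> w) = r * (2 / T)" using T by (simp add: \<sigma>_def n field_simps)
    show "snd (\<sigma> w) \<noteq> - r" using s r T by (metis add.right_inverse divide_eq_0_iff less_irrefl mult_eq_0_iff zero_neq_numeral)
    show "st (\<sigma> w) = w" unfolding st_def s using r T by (simp add: \<sigma>_def n scaleR_conv_of_real)
    show "norm (\<sigma> w) = \<bar>r\<bar>" using grt_normal_unit[of w] by (simp add: \<sigma>_def norm_eq_sqrt_inner)
  qed
  have st: "\<sigma> (st x) = x" if x: "norm x = \<bar>r\<bar>" "snd x \<noteq> - r" for x
  proof -
    obtain w t where wt: "x = (w, t)" by (cases x)
    have n: "(cmod w)\<^sup>2 = r\<^sup>2 - t\<^sup>2" using x(1) by (simp add: wt norm_prod_def real_sqrt_eq_iff real_sqrt_abs[symmetric] del: real_sqrt_abs)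
    have nz: "r + t \<noteq> 0" using x(2) by (simp add: wt)
    have s2: "(cmod (st x))\<^sup>2 = (r - t) / (r + t)"
    proof -
      have "(cmod (st x))\<^sup>2 = (r\<^sup>2 - t\<^sup>2) / (r + t)\<^sup>2" by (simp add: st_def wt norm_divide power_divide n flip: of_real_add)
      also have "\<dots> = ((r - t) * (r + t)) / ((r + t) * (r + t))"
        by (simp add: power2_eq_square algebra_simps)
      also have "\<dots> = (r - t) / (r + t)" using nz by simp
      finally show ?thesis .
    qed
    have T: "1 + (cmod (st x))\<^sup>2 = 2 * r / (r + t)" "1 - (cmod (st x))\<^sup>2 = 2 * t / (r + t)"
      unfolding s2 using nz by (simp_all add: field_simps)
    have a: "r * (1 / (2 * r / (r + t))) = (r + t) / 2" using r nz by (simp add: field_simps)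
    have "\<sigma> (st x) = ((r + t) / 2) *\<^sub>R (2 * st x, 2 * t / (r + t))"
      unfolding \<sigma>_def grt_normal_def T scaleR_scaleR a ..
    also have "\<dots> = x" using nz by (simp add: st_def wt scaleR_conv_of_real flip: of_real_add)
    finally show ?thesis .
  qed
  have og: "open (g ` S)" by (rule open_mapping_thm3[OF g(1) S(1) g(2)])
  obtain g' where g': "homeomorphism S (g ` S) g g'"
    using invariance_of_domain_homeomorphism[OF S(1) holomorphic_on_imp_continuous_on[OF g(1)] _ g(2)] by auto
  have VS: "V = G ` S" using G(2) by (simp add: homeomorphism_def)
  define Q where "Q = {x :: space3. norm x = \<bar>r\<bar>}"
  define Q' where "Q' = {x \<in> Q. snd x \<noteq> - r}"
  have stc: "continuous_on Q' st"
    unfolding st_def by (intro continuous_intros) (auto simp: Q'_def add_eq_0_iff simp flip: of_real_add)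
  have \<sigma>c: "continuous_on A \<sigma>" for A
    unfolding \<sigma>_def grt_normal_def
    by (intro continuous_intros ballI) (metis one_plus_cmod2_pos less_irrefl)
  have img: "X ` V = \<sigma> ` g ` S" using X by (auto simp: VS image_image \<sigma>_def)
  have img': "\<sigma> ` g ` S = Q' \<inter> st -` (g ` S)"
    using \<sigma> st by (auto simp: Q_def Q'_def) (metis image_eqI)
  have "openin (top_of_set Q') (\<sigma> ` g ` S)"
    unfolding img' by (rule continuous_openin_preimage_gen[OF stc og])
  moreover have "openin (top_of_set Q) Q'"
  proof -
    have "Q' = Q \<inter> snd -` (- {- r})" by (auto simp: Q'_def)
    thus ?thesis by (simp only:) (intro continuous_openin_preimage_gen continuous_intros open_Compl closed_singleton)
  qed
  ultimately have opQ: "openin (top_of_set Q) (X ` V)" unfolding img by (rule openin_trans)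
  have \<sigma>h: "homeomorphism (g ` S) (\<sigma> ` g ` S) \<sigma> st"
  proof (rule homeomorphismI)
    show "continuous_on (\<sigma> ` g ` S) st" unfolding img' by (rule continuous_on_subset[OF stc]) simp
  qed (auto simp: \<sigma> \<sigma>c)
  have "homeomorphism V (\<sigma> ` g ` S) (\<sigma> \<circ> (g \<circ> H)) ((G \<circ> g') \<circ> st)"
    by (rule homeomorphism_compose[OF homeomorphism_compose[OF homeomorphism_symD[OF G(2)] g'] \<sigma>h])
  hence hom: "homeomorphism V (X ` V) X ((G \<circ> g') \<circ> st)"
    unfolding img using G(2) X by (elim homeomorphism_cong) (auto simp: homeomorphism_def \<sigma>_def)
  show ?thesis
    unfolding rotational_near_def
  proof (intro exI conjI allI)
    show "open V" by fact
    show "G \<zeta>0 \<in> V" using S(2) VS by simp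
    show "homeomorphism V (X ` V) X ((G \<circ> g') \<circ> st)" by fact
    show "openin (top_of_set Q) (X ` V)" by fact
    fix t
    have key: "(norm (t *\<^sub>R d - x))\<^sup>2 = (norm x)\<^sup>2 - t\<^sup>2" if "x \<bullet> d = t" for x
    proof -
      have "d \<bullet> d = 1" using d by (simp add: dot_square_norm)
      thus ?thesis unfolding power2_norm_eq_inner using that
        by (simp add: inner_diff_left inner_diff_right inner_commute power2_eq_square algebra_simps)
    qed
    show "Q \<inter> axis_plane 0 d t = {} \<or> (\<exists>s\<ge>0. Q \<inter> axis_plane 0 d t = axis_circle 0 d t s)"
    proof (cases "Q \<inter> axis_plane 0 d t = {}")
      case False
      then obtain x where "x \<in> Q" "x \<bullet> d = t" by (auto simp: axis_plane_def)
      hence "r\<^sup>2 - t\<^sup>2 \<ge> 0" using key[of x] zero_le_power2[of "norm (t *\<^sub>R d - x)"]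
        by (simp add: Q_def)
      hence s: "(sqrt (r\<^sup>2 - t\<^sup>2))\<^sup>2 = r\<^sup>2 - t\<^sup>2" "sqrt (r\<^sup>2 - t\<^sup>2) \<ge> 0" by auto
      have "norm y = \<bar>r\<bar> \<longleftrightarrow> dist (0 + t *\<^sub>R d) y = sqrt (r\<^sup>2 - t\<^sup>2)" if "y \<bullet> d = t" for y
      proof -
        have "dist (0 + t *\<^sub>R d) y = sqrt (r\<^sup>2 - t\<^sup>2) \<longleftrightarrow> (norm (t *\<^sub>R d - y))\<^sup>2 = r\<^sup>2 - t\<^sup>2"
          using s by (metis add_0 dist_norm norm_ge_zero power2_eq_iff_nonneg)
        also have "\<dots> \<longleftrightarrow> norm y = \<bar>r\<bar>" unfolding key[OF that]
          by (metis abs_norm_cancel add_diff_cancel_right' diff_add_cancel power2_abs power2_eq_iff_nonneg abs_ge_zero)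
        finally show ?thesis by simp
      qed
      hence "Q \<inter> axis_plane 0 d t = axis_circle 0 d t (sqrt (r\<^sup>2 - t\<^sup>2))"
        by (auto simp: Q_def axis_plane_def axis_circle_def)
      thus ?thesis using s(2) by blast
    qed simp
  qed
qed

section \<open>Holomorphic functions on a connected Riemann surface\<close>
lemma coordinate_disc:
  fixes A :: "'a::t2_space chart set"
  assumes A: "riemann_surface A" and p: "open W" "p \<in> W"
  obtains c z0 r where "c \<in> A" "p \<in> fst c" "z0 = snd c p" "r > 0" "ball z0 r \<subseteq> chart_image c"
    "inv_into (fst c) (snd c) z0 = p"
    "homeomorphism (ball z0 r) (inv_into (fst c) (snd c) ` ball z0 r) (inv_into (fst c) (snd c)) (snd c)"
    "inv_into (fst c) (snd c) ` ball z0 r \<subseteq> W" "\<And>B. open B \<Longrightarrow> B \<subseteq> chart_image c \<Longrightarrow> open (inv_into (fst c) (snd c) ` B)"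
proof -
  have "p \<in> (\<Union>(U, \<phi>)\<in>A. U)" using A by (simp add: riemann_surface_def)
  then obtain U \<phi> where c: "(U, \<phi>) \<in> A" "p \<in> U" by (auto split: prod.splits)
  define \<kappa> where "\<kappa> = inv_into U \<phi>"
  have h: "open U" "open (\<phi> ` U)" "homeomorphism U (\<phi> ` U) \<phi> \<kappa>"
    using A c(1) unfolding riemann_surface_def \<kappa>_def by blast+
  have h': "homeomorphism (\<phi> ` U) U \<kappa> \<phi>" using h(3) by (rule homeomorphism_symD)
  have op: "open (\<kappa> ` B)" if "open B" "B \<subseteq> \<phi> ` U" for B
  proof -
    have "openin (top_of_set U) (\<kappa> ` B)"
      using that by (intro homeomorphism_imp_open_map[OF h'] open_subset)
    thus ?thesis using h(1) openin_open_trans by blast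
  qed
  have \<kappa>p: "\<kappa> (\<phi> p) = p" using h(3) c(2) by (simp add: homeomorphism_def)
  have "openin (top_of_set (\<phi> ` U)) (\<phi> ` U \<inter> \<kappa> -` W)"
    using h' p(1) by (intro continuous_openin_preimage_gen) (auto simp: homeomorphism_def)
  hence "open (\<phi> ` U \<inter> \<kappa> -` W)" using h(2) openin_open_trans by blast
  moreover have "\<phi> p \<in> \<phi> ` U \<inter> \<kappa> -` W" using c(2) p(2) \<kappa>p by simp
  ultimately obtain r where r: "r > 0" "ball (\<phi> p) r \<subseteq> \<phi> ` U \<inter> \<kappa> -` W" using openE by blast
  show ?thesis
  proof (rule that[of "(U, \<phi>)" "\<phi> p" r])
    show "homeomorphism (ball (\<phi> p) r) (inv_into (fst (U, \<phi>)) (snd (U, \<phi>)) ` ball (\<phi> p) r)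
      (inv_into (fst (U, \<phi>)) (snd (U, \<phi>))) (snd (U, \<phi>))"
    proof -
      have s: "ball (\<phi> p) r \<subseteq> \<phi> ` U" using r(2) by blast
      hence "\<kappa> ` ball (\<phi> p) r \<subseteq> U" using h' by (auto simp: homeomorphism_def)
      from homeomorphism_of_subsets[OF h' s this] show ?thesis by (simp add: \<kappa>_def)
    qed
  qed (use c r \<kappa>p op in \<open>auto simp: chart_image_def \<kappa>_def\<close>)
qed

text \<open>
  On a disc in \<open>U\<close> the function is constant by the open mapping theorem. The interior of the set where it takes
  this value is closed by the identity theorem, hence everything.
\<close>
lemma holomorphic_map_constant_if_Re_zero:
  fixes A :: "'a::t2_space chart set"
  assumes A: "riemann_surface A" "connected (UNIV :: 'a set)" and F: "holomorphic_map A F"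
    and U: "open U" "U \<noteq> {}" "\<And>p. p \<in> U \<Longrightarrow> Re (F p) = 0"
  obtains a :: real where "\<And>p. F p = \<i> * of_real a"
proof -
  obtain p0 where p0: "p0 \<in> U" using U(2) by blast
  obtain c z0 r where c: "c \<in> A" "r > 0" "ball z0 r \<subseteq> chart_image c"
    "inv_into (fst c) (snd c) z0 = p0" "inv_into (fst c) (snd c) ` ball z0 r \<subseteq> U"
    "open (inv_into (fst c) (snd c) ` ball z0 r)"
    using coordinate_disc[OF A(1) U(1) p0] by (metis open_ball)
  have hol: "in_chart c F holomorphic_on ball z0 r"
    using F c(1,3) unfolding holomorphic_map_def by (meson holomorphic_on_subset)
  have re: "Re (in_chart c F z) = 0" if "z \<in> ball z0 r" for z
    using U(3)[OF subsetD[OF c(5) imageI[OF that]]] by (simp add: in_chart_def)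
  have "in_chart c F constant_on ball z0 r"
  proof (rule ccontr)
    assume "\<not> in_chart c F constant_on ball z0 r"
    hence "open (in_chart c F ` ball z0 r)"
      by (intro open_mapping_thm[OF hol]) auto
    moreover have "in_chart c F z0 \<in> in_chart c F ` ball z0 r" using c(2) by simp
    \<comment> \<open>An open image would contain values with positive real part.\<close>
    ultimately obtain e where e: "e > 0" "cball (in_chart c F z0) e \<subseteq> in_chart c F ` ball z0 r"
      using open_contains_cball by blast
    have "in_chart c F z0 + of_real e \<in> cball (in_chart c F z0) e" using e(1) by (simp add: dist_norm)
    then obtain z where "z \<in> ball z0 r" "in_chart c F z = in_chart c F z0 + of_real e" using e(2) by (metis imageE subsetD)
    hence "Re (in_chart c F z0 + of_real e) = 0" using re by metis
    thus False using re[of z0] c(2) e(1) by simp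
  qed
  then obtain k where k: "\<And>z. z \<in> ball z0 r \<Longrightarrow> in_chart c F z = k" unfolding constant_on_def by blast
  define T where "T = interior {p. F p = k}"
  have "inv_into (fst c) (snd c) ` ball z0 r \<subseteq> {p. F p = k}" using k by (auto simp: in_chart_def)
  hence "inv_into (fst c) (snd c) ` ball z0 r \<subseteq> T" unfolding T_def using c(6) by (rule interior_maximal)
  hence T0: "p0 \<in> T" using c(2,4) by (metis centre_in_ball imageI subsetD)
  have "closed T"
  proof (rule closed_limpt[THEN iffD2], intro allI impI)
    fix p assume lp: "p islimpt T"
    obtain c z0 r where c: "c \<in> A" "r > 0" "ball z0 r \<subseteq> chart_image c" "inv_into (fst c) (snd c) z0 = p"
      "homeomorphism (ball z0 r) (inv_into (fst c) (snd c) ` ball z0 r) (inv_into (fst c) (snd c)) (snd c)"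
      "open (inv_into (fst c) (snd c) ` ball z0 r)"
      using coordinate_disc[OF A(1) open_UNIV UNIV_I[of p]] by (metis open_ball)
    define \<kappa> where "\<kappa> = inv_into (fst c) (snd c)"
    note c = c[folded \<kappa>_def]
    have hol: "in_chart c F holomorphic_on ball z0 r"
      using F c(1,3) unfolding holomorphic_map_def by (meson holomorphic_on_subset)
    have "p \<in> \<kappa> ` ball z0 r" using c(2,4) by force
    then obtain q where q: "q \<in> T" "q \<in> \<kappa> ` ball z0 r" using lp c(6) by (meson islimptE)
    then obtain w where w: "w \<in> ball z0 r" "q = \<kappa> w" by blast
    have "openin (top_of_set (ball z0 r)) (ball z0 r \<inter> \<kappa> -` T)"
      using c(5) by (intro continuous_openin_preimage_gen) (auto simp: homeomorphism_def T_def)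
    hence o: "open (ball z0 r \<inter> \<kappa> -` T)" using open_ball openin_open_trans by blast
    have "(\<lambda>z. in_chart c F z - k) z = 0" if "z \<in> ball z0 r" for z
    proof (rule analytic_continuation[of "\<lambda>z. in_chart c F z - k" "ball z0 r" "ball z0 r \<inter> \<kappa> -` T" w])
      show "(\<lambda>z. in_chart c F z - k) holomorphic_on ball z0 r" by (intro holomorphic_intros hol)
      show "w islimpt (ball z0 r \<inter> \<kappa> -` T)"
        by (rule interior_limit_point) (use w q(1) in \<open>simp add: interior_open[OF o] del: interior_Int\<close>)
      show "\<And>z. z \<in> ball z0 r \<inter> \<kappa> -` T \<Longrightarrow> in_chart c F z - k = 0"
        using interior_subset[of "{p. F p = k}"] by (auto simp: T_def in_chart_def \<kappa>_def)
    qed (use w that in auto)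
    hence "\<kappa> ` ball z0 r \<subseteq> {p. F p = k}" by (auto simp: in_chart_def \<kappa>_def)
    hence "\<kappa> ` ball z0 r \<subseteq> T" unfolding T_def using c(6) by (rule interior_maximal)
    thus "p \<in> T" using \<open>p \<in> \<kappa> ` ball z0 r\<close> by blast
  qed
  moreover have "open T" by (simp add: T_def)
  ultimately have "T = UNIV" using A(2) T0 unfolding connected_clopen by auto
  hence all: "F p = k" for p using interior_subset[of "{p. F p = k}"] unfolding T_def by blast
  have "Re k = 0" using all U(3)[OF p0] by simp
  hence "k = \<i> * of_real (Im k)" by (simp add: complex_eq_iff)
  thus ?thesis using that all by metis
qed

lemma locally_constant_imp_constant:
  assumes "connected (UNIV :: 'a::topological_space set)"
    and "\<And>p :: 'a. \<exists>W. open W \<and> p \<in> W \<and> (\<forall>q\<in>W. F q = F p)"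
  shows "F p = F q"
proof (rule connected_local_const[OF assms(1)])
  show "\<forall>a\<in>UNIV. eventually (\<lambda>b. F a = F b) (at a within UNIV)"
  proof
    fix a
    obtain W where "open W" "a \<in> W" "\<forall>q\<in>W. F q = F a" using assms(2) by blast
    thus "eventually (\<lambda>b. F a = F b) (at a within UNIV)"
      unfolding eventually_at_topological by metis
  qed
qed auto

lemma immersion_on_cong:
  assumes S: "open S" and eq: "\<And>z. z \<in> S \<Longrightarrow> Y z = Z z" and imm: "immersion_on S Y"
  shows "immersion_on S Z"
proof -
  have D: "(Z has_derivative frechet_derivative Y (at z)) (at z)" if "z \<in> S" for z
  proof (rule has_derivative_transform_within_open[OF _ S that eq])
    show "(Y has_derivative frechet_derivative Y (at z)) (at z)"
      using imm that unfolding immersion_on_def C1_on_def by (simp add: frechet_derivative_works)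
  qed
  have F: "frechet_derivative Z (at z) = frechet_derivative Y (at z)" if "z \<in> S" for z
    using frechet_derivative_at[OF D[OF that]] by simp
  have "continuous_on S (pd v Z)" if "continuous_on S (pd v Y)" for v
    using that F by (simp add: pd_def cong: continuous_on_cong)
  thus ?thesis using imm D F unfolding immersion_on_def C1_on_def by (auto simp: differentiable_def)
qed

lemma rot_field_scaleR: "rot_field (c *\<^sub>R d) w = of_real c * rot_field d w"
  by (simp add: rot_field_def scaleR_conv_of_real algebra_simps)

lemma rot_field_axis: "rot_field (0, 1) w = \<i> * w"
  by (simp add: rot_field_def)

lemma rot_field_deriv: "(rot_field d has_field_derivative \<i> * (cnj (fst d) * w + of_real (snd d))) (at w)"
  unfolding rot_field_def[abs_def] by (auto intro!: derivative_eq_intros simp: algebra_simps)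

text \<open>
  The discriminant of the quadratic polynomial \<open>rot_field d\<close> is a nonzero multiple of the squared norm of \<open>d\<close>, so a
  zero common with its derivative occurs only for \<open>d = 0\<close>.
\<close>
lemma rot_field_simple_zero:
  assumes "rot_field d w = 0" "cnj (fst d) * w + of_real (snd d) = 0"
  shows "d = 0"
proof -
  obtain \<delta> t where d: "d = (\<delta>, t)" by (cases d)
  have 1: "cnj \<delta> * w\<^sup>2 + 2 * of_real t * w - \<delta> = 0" using assms(1) by (simp add: rot_field_def d)
  have 2: "cnj \<delta> * w = - of_real t" using assms(2) by (simp add: d add_eq_0_iff2)
  have "(of_real t)\<^sup>2 + \<delta> * cnj \<delta> = 0" using 1 2 by algebra
  hence "of_real (t\<^sup>2 + (cmod \<delta>)\<^sup>2) = (0 :: complex)" by (simp only: of_real_add complex_norm_square) simp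
  hence "t\<^sup>2 + (cmod \<delta>)\<^sup>2 = 0" by (simp only: of_real_eq_0_iff)
  thus ?thesis by (simp add: d zero_prod_def add_nonneg_eq_0_iff)
qed

section \<open>The axial function and the normal\<close>

text \<open>
  The last assumption keeps the surface from collapsing to a point when \<open>f\<close> is constant.
\<close>
locale grt_data =
  fixes A :: "'a::t2_space chart set" and X :: "'a \<Rightarrow> space3" and f g :: "'a \<Rightarrow> complex" and l :: "real \<Rightarrow> real"
  assumes surface: "riemann_surface A" "connected (UNIV :: 'a set)"
    and holo: "holomorphic_map A f" "holomorphic_map A g"
    and g'_nz: "\<And>c z. c \<in> A \<Longrightarrow> z \<in> chart_image c \<Longrightarrow> deriv (in_chart c g) z \<noteq> 0"
    and l1: "\<And>t. l field_differentiable (at t)" and l2: "\<And>t. deriv l field_differentiable (at t)"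
    and l'_nz: "\<And>t. deriv l t \<noteq> 0"
    and X_eq: "\<And>c p. c \<in> A \<Longrightarrow> p \<in> fst c \<Longrightarrow>
      X p = grt_point l (f p) (g p) (deriv (in_chart c f) (snd c p)) (deriv (in_chart c g) (snd c p))"
    and imm: "immersion A X" and normal: "gauss_map A X (\<lambda>p. grt_normal (g p))"
    and l_nz: "\<And>p. l (Re (f p)) \<noteq> 0"
begin

text \<open>
  The quotient \<open>f' / g'\<close>, recovered from the position by inverting \<open>grad_vec\<close>; see \<open>X_chart\<close>.
\<close>
definition ratio :: "'a \<Rightarrow> complex" where
  "ratio p = (let Z = (2 / deriv l (Re (f p))) *\<^sub>R (X p - l (Re (f p)) *\<^sub>R grt_normal (g p))
     in cnj (fst Z - g p * of_real (snd Z)) / of_real (1 + (cmod (g p))\<^sup>2))"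

definition axial :: "space3 \<Rightarrow> 'a \<Rightarrow> complex" where
  "axial d p = ratio p * rot_field d (g p)"

lemma chart_facts:
  assumes "c \<in> A"
  shows "open (fst c)" "open (chart_image c)"
    "homeomorphism (fst c) (chart_image c) (snd c) (inv_into (fst c) (snd c))"
    "\<And>z. z \<in> chart_image c \<Longrightarrow> inv_into (fst c) (snd c) z \<in> fst c"
    "\<And>z. z \<in> chart_image c \<Longrightarrow> snd c (inv_into (fst c) (snd c) z) = z"
    "\<And>p. p \<in> fst c \<Longrightarrow> inv_into (fst c) (snd c) (snd c p) = p"
    "in_chart c f holomorphic_on chart_image c" "in_chart c g holomorphic_on chart_image c"
proof -
  obtain U \<phi> where c: "c = (U, \<phi>)" by (cases c)
  have "open U \<and> open (\<phi> ` U) \<and> homeomorphism U (\<phi> ` U) \<phi> (inv_into U \<phi>)"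
    using surface(1) assms unfolding riemann_surface_def c by blast
  thus a: "open (fst c)" "open (chart_image c)"
    and h: "homeomorphism (fst c) (chart_image c) (snd c) (inv_into (fst c) (snd c))"
    by (auto simp: c chart_image_def)
  show "\<And>z. z \<in> chart_image c \<Longrightarrow> inv_into (fst c) (snd c) z \<in> fst c"
    "\<And>z. z \<in> chart_image c \<Longrightarrow> snd c (inv_into (fst c) (snd c) z) = z"
    "\<And>p. p \<in> fst c \<Longrightarrow> inv_into (fst c) (snd c) (snd c p) = p"
    using h by (auto simp: homeomorphism_def)
  show "in_chart c f holomorphic_on chart_image c" "in_chart c g holomorphic_on chart_image c"
    using holo assms by (auto simp: holomorphic_map_def)
qed

lemma X_chart:
  assumes c: "c \<in> A" and p: "p \<in> fst c"
  shows "ratio p = deriv (in_chart c f) (snd c p) / deriv (in_chart c g) (snd c p)"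
    "X p = (deriv l (Re (f p)) / 2) *\<^sub>R grad_vec (g p) (ratio p) + l (Re (f p)) *\<^sub>R grt_normal (g p)"
proof -
  define q where "q = deriv (in_chart c f) (snd c p) / deriv (in_chart c g) (snd c p)"
  have nz: "deriv (in_chart c g) (snd c p) \<noteq> 0"
    using g'_nz[OF c] p by (simp add: chart_image_def)
  have X: "X p = (deriv l (Re (f p)) / 2) *\<^sub>R grad_vec (g p) q + l (Re (f p)) *\<^sub>R grt_normal (g p)"
    unfolding X_eq[OF c p] grt_point_eq[OF nz] q_def ..
  hence "(2 / deriv l (Re (f p))) *\<^sub>R (X p - l (Re (f p)) *\<^sub>R grt_normal (g p)) = grad_vec (g p) q"
    using l'_nz by simp
  hence "ratio p = of_real (1 + (cmod (g p))\<^sup>2) * q / of_real (1 + (cmod (g p))\<^sup>2)"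
    unfolding ratio_def Let_def by (simp only: grad_vec_inverse)
  moreover have "of_real (1 + (cmod (g p))\<^sup>2) \<noteq> (0 :: complex)"
    using one_plus_cmod2_pos[of "g p"] by (metis less_irrefl of_real_eq_0_iff)
  ultimately have r: "ratio p = q" by simp
  show "ratio p = deriv (in_chart c f) (snd c p) / deriv (in_chart c g) (snd c p)" using r q_def by simp
  show "X p = (deriv l (Re (f p)) / 2) *\<^sub>R grad_vec (g p) (ratio p) + l (Re (f p)) *\<^sub>R grt_normal (g p)"
    using X r by simp
qed

lemma obtain_chart: obtains c where "c \<in> A" "p \<in> fst c"
  using coordinate_disc[OF surface(1) open_UNIV UNIV_I[of p]] by metis

lemma X_ratio:
  "X p = (deriv l (Re (f p)) / 2) *\<^sub>R grad_vec (g p) (ratio p) + l (Re (f p)) *\<^sub>R grt_normal (g p)"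
  using obtain_chart[of p] X_chart(2) by metis

text \<open>
  As \<open>l'\<close> has no zeros, the coplanarity of the position, \<open>d\<close> and the normal is the vanishing of the real part of
  a holomorphic function.
\<close>
lemma X_axial: "X p \<bullet> cross d (grt_normal (g p)) = deriv l (Re (f p)) * Re (axial d p)"
  unfolding X_ratio[of p] inner_add_left inner_scaleR_left grad_vec_cross cross_self_inner axial_def by simp

lemma holomorphic_axial: "holomorphic_map A (axial d)"
  unfolding holomorphic_map_def
proof
  fix c assume c: "c \<in> A"
  note cf = chart_facts[OF c]
  have "(\<lambda>z. deriv (in_chart c f) z / deriv (in_chart c g) z * rot_field d (in_chart c g z)) holomorphic_on chart_image c"
    unfolding rot_field_def using g'_nz[OF c]
    by (intro holomorphic_intros holomorphic_deriv cf) auto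
  moreover have "in_chart c (axial d) z = deriv (in_chart c f) z / deriv (in_chart c g) z * rot_field d (in_chart c g z)"
    if "z \<in> chart_image c" for z
    using X_chart(1)[OF c cf(4)[OF that]] cf(5)[OF that] by (simp add: in_chart_def axial_def)
  ultimately show "in_chart c (axial d) holomorphic_on chart_image c" by (simp cong: holomorphic_cong)
qed

lemma normal_to_curve:
  assumes cont: "isCont \<Theta> (0::real)" and lift: "eventually (\<lambda>s. X (\<Theta> s) = \<gamma> s) (nhds 0)"
    and vel: "(\<gamma> has_vector_derivative \<gamma>') (at 0)"
  shows "grt_normal (g (\<Theta> 0)) \<bullet> \<gamma>' = 0"
proof -
  obtain c where c: "c \<in> A" "\<Theta> 0 \<in> fst c" by (rule obtain_chart)
  note cf = chart_facts[OF c(1)]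
  define z where "z = snd c (\<Theta> 0)"
  have z: "z \<in> chart_image c" using c(2) by (simp add: z_def chart_image_def)
  have imm': "immersion_on (chart_image c) (in_chart c X)" using imm c(1) by (simp add: immersion_def)
  show ?thesis
  proof (rule normal_to_lifted_curve[of "in_chart c X" "frechet_derivative (in_chart c X) (at z)" z _ "snd c \<circ> \<Theta>"])
    show "(in_chart c X has_derivative frechet_derivative (in_chart c X) (at z)) (at z)"
      "inj (frechet_derivative (in_chart c X) (at z))"
      using imm' z by (auto simp: immersion_on_def C1_on_def frechet_derivative_works)
    have "pd h (in_chart c X) z \<bullet> in_chart c (\<lambda>p. grt_normal (g p)) z = 0" for h
      using normal c(1) z unfolding gauss_map_def by blast
    thus "grt_normal (g (\<Theta> 0)) \<bullet> frechet_derivative (in_chart c X) (at z) h = 0" for h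
      using cf(6)[OF c(2)] by (simp add: pd_def in_chart_def z_def inner_commute)
    have sc: "isCont (snd c) (\<Theta> 0)"
      using cf(1,3) c(2) by (meson continuous_on_eq_continuous_at homeomorphism_def)
    show "isCont (snd c \<circ> \<Theta>) 0" using cont sc by (rule continuous_at_compose)
    have "((\<lambda>s. \<Theta> s) \<longlongrightarrow> \<Theta> 0) (nhds 0)"
      using cont tendsto_at_iff_tendsto_nhds[of \<Theta> 0] by (simp add: isCont_def)
    hence "eventually (\<lambda>s. \<Theta> s \<in> fst c) (nhds 0)" using cf(1) c(2) topological_tendstoD by blast
    with lift show "eventually (\<lambda>s. in_chart c X ((snd c \<circ> \<Theta>) s) = \<gamma> s) (nhds 0)"
      by eventually_elim (simp add: in_chart_def cf(6))
  qed (use vel in \<open>simp_all add: z_def\<close>)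
qed

text \<open>
  The section of \<open>Q\<close> through \<open>X p\<close> is a full circle about the axis, and the part of it near \<open>X p\<close> lies in the
  surface because \<open>X ` W\<close> is open in \<open>Q\<close>. So the velocity \<open>d \<times> (X p - x0)\<close> of this circle is tangent to
  the surface.
\<close>
lemma rotational_near_normal:
  assumes rot: "rotational_near X x0 d p" and d: "norm d = 1"
  shows "(X p - x0) \<bullet> cross d (grt_normal (g p)) = 0"
proof -
  obtain W Q Y where W: "open W" "p \<in> W" "homeomorphism W (X ` W) X Y" "openin (top_of_set Q) (X ` W)"
    and Q: "\<And>t. Q \<inter> axis_plane x0 d t = {} \<or> (\<exists>r\<ge>0. Q \<inter> axis_plane x0 d t = axis_circle x0 d t r)"
    using rot unfolding rotational_near_def by blast
  define t where "t = (X p - x0) \<bullet> d"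
  define w where "w = X p - x0 - t *\<^sub>R d"
  have dd: "d \<bullet> d = 1" using d by (simp add: dot_square_norm)
  have dw: "d \<bullet> w = 0" by (simp add: w_def inner_diff_right dd t_def inner_commute)
  have pQ: "X p \<in> Q \<inter> axis_plane x0 d t" using W(2) openin_subset[OF W(4)] by (auto simp: axis_plane_def t_def)
  then obtain r where r: "Q \<inter> axis_plane x0 d t = axis_circle x0 d t r" using Q by blast
  have rw: "norm w = r"
  proof -
    have "dist (x0 + t *\<^sub>R d) (X p) = r" using pQ r by (auto simp: axis_circle_def)
    moreover have "x0 + t *\<^sub>R d - X p = - w" by (simp add: w_def)
    ultimately show ?thesis by (metis dist_norm norm_minus_cancel)
  qed
  \<comment> \<open>The circle through \<open>X p\<close> about the axis.\<close>
  define \<gamma> where "\<gamma> s = x0 + t *\<^sub>R d + (cos s *\<^sub>R w + sin s *\<^sub>R cross d w)" for s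
  have ww: "cross d w \<bullet> cross d w = w \<bullet> w"
  proof -
    have "cross d w \<bullet> cross d w = (d \<bullet> d) * (w \<bullet> w) - (d \<bullet> w)\<^sup>2"
      by (simp add: inner_space3 cross_def algebra_simps power2_eq_square)
    thus ?thesis by (simp add: dd dw)
  qed
  have \<gamma>Q: "\<gamma> s \<in> Q" for s
  proof -
    have "(norm (cos s *\<^sub>R w + sin s *\<^sub>R cross d w))\<^sup>2 = cos s * cos s * (w \<bullet> w) + sin s * sin s * (w \<bullet> w)"
      unfolding power2_norm_eq_inner
      by (simp add: inner_add_left inner_add_right cross_self_inner inner_commute[of "cross d w" w] ww algebra_simps)
    also have "\<dots> = ((cos s)\<^sup>2 + (sin s)\<^sup>2) * (w \<bullet> w)" by (simp only: distrib_right power2_eq_square)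
    also have "\<dots> = r\<^sup>2" using rw by (simp add: dot_square_norm)
    finally have "norm (cos s *\<^sub>R w + sin s *\<^sub>R cross d w) = r"
      using rw by (metis norm_ge_zero power2_eq_iff_nonneg)
    hence "dist (\<gamma> s) (x0 + t *\<^sub>R d) = r" by (simp add: \<gamma>_def dist_norm)
    hence "dist (x0 + t *\<^sub>R d) (\<gamma> s) = r" by (simp only: dist_commute)
    moreover have "(\<gamma> s - x0) \<bullet> d = t"
      by (simp add: \<gamma>_def inner_add_left dd dw inner_commute[of w d] inner_commute[of "cross d w" d] cross_self_inner)
    ultimately have "\<gamma> s \<in> axis_circle x0 d t r" by (simp add: axis_circle_def axis_plane_def)
    thus ?thesis using r by blast
  qed
  have \<gamma>c: "continuous_on B \<gamma>" for B unfolding \<gamma>_def by (intro continuous_intros)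
  have \<gamma>0: "\<gamma> 0 = X p" by (simp add: \<gamma>_def w_def)
  obtain B where B: "open B" "X ` W = Q \<inter> B" using W(4) by (auto simp: openin_open)
  define J where "J = \<gamma> -` B"
  have J: "open J" "0 \<in> J" unfolding J_def
    using B \<gamma>c[of UNIV] \<gamma>0 W(2) by (auto intro: open_vimage)
  have JX: "\<gamma> s \<in> X ` W" if "s \<in> J" for s using that \<gamma>Q B(2) by (auto simp: J_def)
  have "continuous_on J (\<lambda>s. Y (\<gamma> s))"
    using W(3) JX by (intro continuous_on_compose2[OF _ \<gamma>c]) (auto simp: homeomorphism_def)
  hence cont: "isCont (\<lambda>s. Y (\<gamma> s)) 0" using J continuous_on_eq_continuous_at by blast
  have XY: "X (Y x) = x" if "x \<in> X ` W" for x
    using W(3) that unfolding homeomorphism_def by blast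
  have lift: "eventually (\<lambda>s. X (Y (\<gamma> s)) = \<gamma> s) (nhds 0)"
    unfolding eventually_nhds using J XY[OF JX] by blast
  have vel: "(\<gamma> has_vector_derivative cross d w) (at 0)"
    unfolding \<gamma>_def[abs_def] by (auto intro!: derivative_eq_intros)
  have start: "Y (\<gamma> 0) = p" using W(2,3) \<gamma>0 by (simp add: homeomorphism_def)
  have "grt_normal (g p) \<bullet> cross d w = 0" using normal_to_curve[OF cont lift vel] by (simp add: start)
  moreover have "cross d w = cross d (X p - x0)"
    by (simp add: w_def cross_def scaleR_conv_of_real algebra_simps)
  ultimately show ?thesis by (metis cross_swap neg_equal_0_iff_equal)
qed

text \<open>
  Off the axis, position, axis and normal are all orthogonal to the velocity of the parallel circle.
\<close>
lemma locally_X_ab_normal: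
  assumes R: "orthogonal_transformation R" and loc: "locally_X_ab X l R a b"
  shows "X p \<bullet> cross (R (0, 1)) (grt_normal (g p)) = 0"
proof (cases "X p \<in> range (\<lambda>t. R (0, t))")
  case True
  then obtain t where "X p = R (0, t)" by blast
  moreover have "R (0, t) = t *\<^sub>R R (0, 1)"
    using linear_scale[OF orthogonal_transformation_linear[OF R], of t "(0, 1)"] by simp
  ultimately show ?thesis by (simp add: cross_self_inner)
next
  case False
  hence "parametrizes_near X (R \<circ> X_ab l a b) p" using loc unfolding locally_X_ab_def by simp
  then obtain D W \<theta> \<theta>' where D: "open D" "open W" "p \<in> W" "immersion_on D (R \<circ> X_ab l a b)"
    "homeomorphism D W \<theta> \<theta>'" "\<And>z. z \<in> D \<Longrightarrow> X (\<theta> z) = (R \<circ> X_ab l a b) z"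
    unfolding parametrizes_near_def by meson
  have lin: "linear R" using R by (rule orthogonal_transformation_linear)
  have inner: "R x \<bullet> R y = x \<bullet> y" for x y using R unfolding orthogonal_transformation_def by blast
  define z where "z = \<theta>' p"
  have z: "z \<in> D" "\<theta> z = p" using D(3,5) by (auto simp: z_def homeomorphism_def)
  note nd = X_ab_nondegenerate[OF l1 l2 lin D(4) z(1)]
  define m where "m = (\<i> * cis (Im z), 0 :: real)"
  define Y where "Y = R \<circ> X_ab l a b"
  define line where "line s = z + of_real s * \<i>" for s
  have linec: "continuous_on B line" for B unfolding line_def by (intro continuous_intros)
  define J where "J = line -` D"
  have J: "open J" "0 \<in> J" using D(1) linec[of UNIV] z(1) by (auto simp: J_def line_def intro: open_vimage)
  have "continuous_on J (\<lambda>s. \<theta> (line s))"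
    using D(5) by (intro continuous_on_compose2[OF _ linec]) (auto simp: homeomorphism_def J_def)
  hence cont: "isCont (\<lambda>s. \<theta> (line s)) 0" using J continuous_on_eq_continuous_at by blast
  have lift: "eventually (\<lambda>s. X (\<theta> (line s)) = Y (line s)) (nhds 0)"
    unfolding eventually_nhds using J D(6) by (intro exI[of _ J]) (auto simp: J_def Y_def)
  have YD: "(Y has_derivative frechet_derivative Y (at z)) (at z)"
    using D(4) z(1) by (auto simp: immersion_on_def C1_on_def Y_def frechet_derivative_works)
  have "(line has_vector_derivative \<i>) (at 0)"
    unfolding line_def[abs_def] by (auto simp: has_vector_derivative_complex_iff intro!: derivative_eq_intros)
  hence vel: "((\<lambda>s. Y (line s)) has_vector_derivative pd \<i> Y z) (at 0)"
    using vector_derivative_diff_chain_within[of line \<i> 0 UNIV Y "frechet_derivative Y (at z)"] YD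
    by (auto simp: o_def line_def pd_def intro: has_derivative_at_withinI)
  have "pd \<i> Y z = profile_M l a b (Re z) *\<^sub>R R m"
    using nd(4) linear_scale[OF lin, of "profile_M l a b (Re z)" m] by (simp add: m_def Y_def scaleR_conv_of_real)
  hence "grt_normal (g p) \<bullet> R m = 0"
    using normal_to_curve[OF cont lift vel] nd(1) z(2) by (simp add: line_def)
  moreover have "X p \<bullet> R m = 0"
  proof -
    have "X p = R (X_ab l a b z)" using D(6)[OF z(1)] z(2) by simp
    hence "X p \<bullet> R m = X_ab l a b z \<bullet> m" by (simp only: inner)
    thus ?thesis by (simp add: X_ab_polar m_def inner_space3 algebra_simps)
  qed
  moreover have "R (0, 1) \<bullet> R m = 0" unfolding inner by (simp add: m_def inner_space3)
  moreover have "R m \<noteq> 0" using orthogonal_transformation_norm[OF R, of m] by (auto simp: m_def norm_prod_def norm_mult)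
  ultimately show ?thesis by (intro coplanar)
qed

end

context grt_data
begin

section \<open>Coordinates adapted to an axis\<close>

text \<open>
  Away from the poles a branch of the logarithm of the transformed \<open>g\<close> is a local coordinate, because \<open>g'\<close> has no zeros.
  Dividing by the value at the centre first moves the argument of \<open>Ln\<close> to 1 there, away from the branch cut.
\<close>
lemma logarithmic_coordinate:
  assumes unit: "(cmod \<alpha>)\<^sup>2 + (cmod \<beta>)\<^sup>2 = 1"
    and nz: "\<alpha> * g p + \<beta> \<noteq> 0" "cnj \<alpha> - cnj \<beta> * g p \<noteq> 0"
  obtains c S \<zeta>0 \<omega> H where "c \<in> A" "open S" "connected S" "\<zeta>0 \<in> S" "\<omega> holomorphic_on S" "\<omega> ` S \<subseteq> chart_image c"
    "\<And>\<zeta>. \<zeta> \<in> S \<Longrightarrow> deriv \<omega> \<zeta> \<noteq> 0"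
    "inv_into (fst c) (snd c) (\<omega> \<zeta>0) = p"
    "open ((inv_into (fst c) (snd c) \<circ> \<omega>) ` S)"
    "homeomorphism S ((inv_into (fst c) (snd c) \<circ> \<omega>) ` S) (inv_into (fst c) (snd c) \<circ> \<omega>) H"
    "\<And>\<zeta>. \<zeta> \<in> S \<Longrightarrow> cnj \<alpha> - cnj \<beta> * in_chart c g (\<omega> \<zeta>) \<noteq> 0"
    "\<And>\<zeta>. \<zeta> \<in> S \<Longrightarrow> moebius \<alpha> \<beta> (in_chart c g (\<omega> \<zeta>)) = exp \<zeta>"
proof -
  obtain c z0 r where c: "c \<in> A" "r > 0" "ball z0 r \<subseteq> chart_image c" "inv_into (fst c) (snd c) z0 = p"
    "homeomorphism (ball z0 r) (inv_into (fst c) (snd c) ` ball z0 r) (inv_into (fst c) (snd c)) (snd c)"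
    "\<And>B. open B \<Longrightarrow> B \<subseteq> chart_image c \<Longrightarrow> open (inv_into (fst c) (snd c) ` B)"
    using coordinate_disc[OF surface(1) open_UNIV UNIV_I[of p]] by metis
  define \<kappa> where "\<kappa> = inv_into (fst c) (snd c)"
  define G where "G = in_chart c g"
  have z0: "z0 \<in> ball z0 r" using c(2) by simp
  have G0: "G z0 = g p" using c(4) by (simp add: G_def in_chart_def)
  have Ghol: "G holomorphic_on ball z0 r" unfolding G_def using chart_facts(8)[OF c(1)] c(3) holomorphic_on_subset by blast
  define m where "m z = moebius \<alpha> \<beta> (G z)" for z
  define O1 where "O1 = ball z0 r \<inter> (\<lambda>z. cnj \<alpha> - cnj \<beta> * G z) -` (- {0})"
  have "open O1" unfolding O1_def
    by (intro continuous_open_preimage continuous_intros holomorphic_on_imp_continuous_on[OF Ghol]) auto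
  have G1: "G holomorphic_on O1" using Ghol by (rule holomorphic_on_subset) (auto simp: O1_def)
  have mhol: "m holomorphic_on O1"
    unfolding m_def moebius_def by (intro holomorphic_intros G1) (auto simp: O1_def)
  have m0: "m z0 \<noteq> 0" using nz by (simp add: m_def moebius_def G0)
  define O2 where "O2 = O1 \<inter> (\<lambda>z. m z / m z0) -` (- \<real>\<^sub>\<le>\<^sub>0)"
  have O2: "open O2" unfolding O2_def
    using \<open>open O1\<close> m0 by (intro continuous_open_preimage continuous_intros holomorphic_on_imp_continuous_on[OF mhol]) auto
  have z0O: "z0 \<in> O2" using z0 nz m0 by (simp add: O2_def O1_def G0)
  have O2s: "O2 \<subseteq> ball z0 r" by (auto simp: O2_def O1_def)
  define h where "h z = Ln (m z / m z0) + Ln (m z0)" for z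
  have "m holomorphic_on O2" using mhol by (rule holomorphic_on_subset) (auto simp: O2_def)
  hence hhol: "h holomorphic_on O2" unfolding h_def using m0
    by (intro holomorphic_intros) (auto simp: O2_def)
  have exph: "exp (h z) = m z" if "z \<in> O2" for z
  proof -
    have "m z / m z0 \<noteq> 0" using that by (auto simp: O2_def)
    thus ?thesis using m0 by (simp add: h_def exp_add)
  qed
  have "deriv h z0 \<noteq> 0"
  proof
    assume z: "deriv h z0 = 0"
    have "(h has_field_derivative 0) (at z0)" using holomorphic_derivI[OF hhol O2 z0O] z by simp
    hence "((\<lambda>z. exp (h z)) has_field_derivative 0) (at z0)"
      by (auto intro!: derivative_eq_intros)
    hence 1: "(m has_field_derivative 0) (at z0)"
      by (rule has_field_derivative_transform_within_open[OF _ O2 z0O]) (rule exph)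
    have "(G has_field_derivative deriv G z0) (at z0)" using holomorphic_derivI[OF Ghol open_ball z0] .
    hence "(m has_field_derivative 1 / (cnj \<alpha> - cnj \<beta> * G z0)\<^sup>2 * deriv G z0) (at z0)"
      unfolding m_def using nz(2) by (intro DERIV_chain2[OF has_field_derivative_moebius[OF unit]]) (simp add: G0)
    hence "1 / (cnj \<alpha> - cnj \<beta> * G z0)\<^sup>2 * deriv G z0 = 0" using 1 DERIV_unique by blast
    moreover have "deriv G z0 \<noteq> 0" using g'_nz[OF c(1) subsetD[OF c(3) z0]] by (simp add: G_def)
    ultimately show False using nz(2) by (simp add: G0)
  qed
  then obtain r1 where r1: "r1 > 0" "ball z0 r1 \<subseteq> O2" "open (h ` ball z0 r1)" "inj_on h (ball z0 r1)"
    using has_complex_derivative_locally_invertible[OF hhol z0O O2] by blast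
  have hb: "h holomorphic_on ball z0 r1" using hhol r1(2) by (rule holomorphic_on_subset)
  obtain \<omega> where \<omega>: "\<omega> holomorphic_on h ` ball z0 r1" "\<And>z. z \<in> ball z0 r1 \<Longrightarrow> deriv h z * deriv \<omega> (h z) = 1"
    "\<And>z. z \<in> ball z0 r1 \<Longrightarrow> \<omega> (h z) = z"
    using holomorphic_has_inverse[OF hb open_ball r1(4)] by blast
  define S where "S = h ` ball z0 r1"
  have b: "ball z0 r1 \<subseteq> ball z0 r" using r1(2) O2s by blast
  have \<omega>S: "\<omega> ` S = ball z0 r1" using \<omega>(3) by (auto simp: S_def image_image)
  have hom1: "homeomorphism S (ball z0 r1) \<omega> h"
    unfolding S_def by (rule homeomorphismI)
      (use \<omega> hb in \<open>auto intro: holomorphic_on_imp_continuous_on simp: image_image\<close>)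
  have hom2: "homeomorphism (ball z0 r1) (\<kappa> ` ball z0 r1) \<kappa> (snd c)"
    using c(5) b unfolding \<kappa>_def[symmetric] by (rule homeomorphism_of_subsets) (use b in auto)
  have img: "(\<kappa> \<circ> \<omega>) ` S = \<kappa> ` ball z0 r1" unfolding image_comp[symmetric] \<omega>S ..
  have inO: "\<omega> \<zeta> \<in> O2" if "\<zeta> \<in> S" for \<zeta> using that \<omega>S r1(2) by blast
  show ?thesis
  proof (rule that[of c S "h z0" \<omega> "h \<circ> snd c"])
    show "connected S" unfolding S_def
      by (intro connected_continuous_image holomorphic_on_imp_continuous_on[OF hb]) auto
    show "open ((inv_into (fst c) (snd c) \<circ> \<omega>) ` S)"
      unfolding \<kappa>_def[symmetric] img unfolding \<kappa>_def using b c(3) by (intro c(6)) auto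
    show "homeomorphism S ((inv_into (fst c) (snd c) \<circ> \<omega>) ` S) (inv_into (fst c) (snd c) \<circ> \<omega>) (h \<circ> snd c)"
      unfolding \<kappa>_def[symmetric] img by (rule homeomorphism_compose[OF hom1 hom2])
    show "deriv \<omega> \<zeta> \<noteq> 0" if "\<zeta> \<in> S" for \<zeta> using that \<omega>(2) by (force simp: S_def)
    show "cnj \<alpha> - cnj \<beta> * in_chart c g (\<omega> \<zeta>) \<noteq> 0" if "\<zeta> \<in> S" for \<zeta>
      using inO[OF that] by (simp add: O2_def O1_def G_def)
    show "moebius \<alpha> \<beta> (in_chart c g (\<omega> \<zeta>)) = exp \<zeta>" if "\<zeta> \<in> S" for \<zeta>
    proof -
      have "exp (h (\<omega> \<zeta>)) = m (\<omega> \<zeta>)" by (rule exph[OF inO[OF that]])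
      moreover have "h (\<omega> \<zeta>) = \<zeta>" using that \<omega>(3) by (auto simp: S_def)
      ultimately show ?thesis by (simp add: m_def G_def)
    qed
    show "inv_into (fst c) (snd c) (\<omega> (h z0)) = p" using \<omega>(3)[of z0] r1(1) c(4) by simp
    show "\<omega> ` S \<subseteq> chart_image c" using \<omega>S b c(3) by blast
  qed (use c(1) r1 \<omega>(1) in \<open>auto simp: S_def\<close>)
qed

text \<open>
  In the logarithmic coordinate the transformed Gauss map is \<open>exp \<zeta>\<close>, so all the data become those of \<open>f \<circ> G\<close> and
  \<open>exp\<close>, followed by the rotation \<open>R\<close> that undoes \<open>moebius \<alpha> \<beta>\<close>.
\<close>
lemma adapted_coordinate:
  assumes unit: "(cmod \<alpha>)\<^sup>2 + (cmod \<beta>)\<^sup>2 = 1"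
    and nz: "\<alpha> * g p + \<beta> \<noteq> 0" "cnj \<alpha> - cnj \<beta> * g p \<noteq> 0"
  defines "R \<equiv> rotation (cnj \<alpha>) (- \<beta>)"
  obtains S \<zeta>0 G H where "open S" "connected S" "\<zeta>0 \<in> S" "G \<zeta>0 = p" "open (G ` S)" "homeomorphism S (G ` S) G H"
    "(f \<circ> G) holomorphic_on S" "immersion_on S (X \<circ> G)"
    "\<And>\<zeta>. \<zeta> \<in> S \<Longrightarrow> moebius \<alpha> \<beta> (g (G \<zeta>)) = exp \<zeta>"
    "\<And>\<zeta>. \<zeta> \<in> S \<Longrightarrow> grt_normal (g (G \<zeta>)) = R (grt_normal (exp \<zeta>))"
    "\<And>\<zeta>. \<zeta> \<in> S \<Longrightarrow> X (G \<zeta>) = R ((deriv l (Re (f (G \<zeta>))) / 2) *\<^sub>R grad_vec (exp \<zeta>) (deriv (f \<circ> G) \<zeta> / exp \<zeta>)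
        + l (Re (f (G \<zeta>))) *\<^sub>R grt_normal (exp \<zeta>))"
    "\<And>\<zeta> d. \<zeta> \<in> S \<Longrightarrow> axial (R d) (G \<zeta>) = deriv (f \<circ> G) \<zeta> * (rot_field d (exp \<zeta>) / exp \<zeta>)"
proof -
  obtain c S \<zeta>0 \<omega> H where C: "c \<in> A" "open S" "connected S" "\<zeta>0 \<in> S" "\<omega> holomorphic_on S" "\<omega> ` S \<subseteq> chart_image c"
    "\<And>\<zeta>. \<zeta> \<in> S \<Longrightarrow> deriv \<omega> \<zeta> \<noteq> 0"
    "inv_into (fst c) (snd c) (\<omega> \<zeta>0) = p"
    "open ((inv_into (fst c) (snd c) \<circ> \<omega>) ` S)"
    "homeomorphism S ((inv_into (fst c) (snd c) \<circ> \<omega>) ` S) (inv_into (fst c) (snd c) \<circ> \<omega>) H"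
    "\<And>\<zeta>. \<zeta> \<in> S \<Longrightarrow> cnj \<alpha> - cnj \<beta> * in_chart c g (\<omega> \<zeta>) \<noteq> 0"
    "\<And>\<zeta>. \<zeta> \<in> S \<Longrightarrow> moebius \<alpha> \<beta> (in_chart c g (\<omega> \<zeta>)) = exp \<zeta>"
    by (fact logarithmic_coordinate[OF unit nz])
  define \<kappa> where "\<kappa> = inv_into (fst c) (snd c)"
  define G where "G = \<kappa> \<circ> \<omega>"
  note cf = chart_facts[OF C(1)]
  have unit': "(cmod (cnj \<alpha>))\<^sup>2 + (cmod (- \<beta>))\<^sup>2 = 1" using unit by simp
  have fG: "f \<circ> G = in_chart c f \<circ> \<omega>" and gG: "g \<circ> G = in_chart c g \<circ> \<omega>" and XG: "X \<circ> G = in_chart c X \<circ> \<omega>"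
    by (simp_all add: G_def in_chart_def \<kappa>_def o_assoc)
  have in\<omega>: "\<omega> \<zeta> \<in> chart_image c" if "\<zeta> \<in> S" for \<zeta> using that C(6) by blast
  have Gc: "G \<zeta> \<in> fst c" "snd c (G \<zeta>) = \<omega> \<zeta>" if "\<zeta> \<in> S" for \<zeta>
    using cf(4,5)[OF in\<omega>[OF that]] by (simp_all add: G_def \<kappa>_def)
  have mG: "moebius \<alpha> \<beta> (g (G \<zeta>)) = exp \<zeta>" and Dn: "cnj \<alpha> - cnj \<beta> * g (G \<zeta>) \<noteq> 0" if "\<zeta> \<in> S" for \<zeta>
    using C(11,12)[OF that] gG by (metis comp_apply)+
  have gE: "g (G \<zeta>) = moebius (cnj \<alpha>) (- \<beta>) (exp \<zeta>)" and D: "cnj (cnj \<alpha>) - cnj (- \<beta>) * exp \<zeta> \<noteq> 0" if "\<zeta> \<in> S" for \<zeta>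
    using moebius_inverse[OF unit Dn[OF that]] mG[OF that] by simp_all
  have fD: "((f \<circ> G) has_field_derivative deriv (in_chart c f) (\<omega> \<zeta>) * deriv \<omega> \<zeta>) (at \<zeta>)"
    and gD: "((g \<circ> G) has_field_derivative deriv (in_chart c g) (\<omega> \<zeta>) * deriv \<omega> \<zeta>) (at \<zeta>)" if "\<zeta> \<in> S" for \<zeta>
    unfolding fG gG
    by (intro DERIV_chain holomorphic_derivI[OF cf(7) cf(2) in\<omega>[OF that]] holomorphic_derivI[OF cf(8) cf(2) in\<omega>[OF that]]
      holomorphic_derivI[OF C(5) C(2) that])+
  have ratio: "ratio (G \<zeta>) = (deriv (f \<circ> G) \<zeta> / exp \<zeta>) * (cnj (cnj \<alpha>) - cnj (- \<beta>) * exp \<zeta>)\<^sup>2" if z: "\<zeta> \<in> S" for \<zeta>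
  proof -
    let ?D = "cnj (cnj \<alpha>) - cnj (- \<beta>) * exp \<zeta>"
    have "((\<lambda>\<zeta>. moebius (cnj \<alpha>) (- \<beta>) (exp \<zeta>)) has_field_derivative 1 / ?D\<^sup>2 * exp \<zeta>) (at \<zeta>)"
      using has_field_derivative_moebius[OF unit' D[OF z]] DERIV_exp by (rule DERIV_chain2)
    hence "((g \<circ> G) has_field_derivative 1 / ?D\<^sup>2 * exp \<zeta>) (at \<zeta>)"
      by (rule has_field_derivative_transform_within_open[OF _ C(2) z]) (simp add: gE)
    hence 1: "deriv (in_chart c g) (\<omega> \<zeta>) * deriv \<omega> \<zeta> = 1 / ?D\<^sup>2 * exp \<zeta>" using gD[OF z] DERIV_unique by blast
    have 2: "deriv (f \<circ> G) \<zeta> = deriv (in_chart c f) (\<omega> \<zeta>) * deriv \<omega> \<zeta>" using fD[OF z] by (rule DERIV_imp_deriv)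
    have "ratio (G \<zeta>) = deriv (in_chart c f) (\<omega> \<zeta>) / deriv (in_chart c g) (\<omega> \<zeta>)"
      using X_chart(1)[OF C(1) Gc(1)[OF z]] Gc(2)[OF z] by simp
    also have "\<dots> = (deriv (in_chart c f) (\<omega> \<zeta>) * deriv \<omega> \<zeta>) / (deriv (in_chart c g) (\<omega> \<zeta>) * deriv \<omega> \<zeta>)"
      using C(7)[OF z] by simp
    also have "\<dots> = deriv (f \<circ> G) \<zeta> / (1 / ?D\<^sup>2 * exp \<zeta>)" unfolding 1 2 ..
    finally show ?thesis by simp
  qed
  have lin: "linear R" unfolding R_def using rotation_orthogonal[OF unit'] by (rule orthogonal_transformation_linear)
  have nG: "grt_normal (g (G \<zeta>)) = R (grt_normal (exp \<zeta>))" if "\<zeta> \<in> S" for \<zeta>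
    unfolding R_def gE[OF that] by (rule grt_normal_moebius[OF unit' D[OF that]])
  show ?thesis
  proof (rule that[of S \<zeta>0 G H])
    show "(f \<circ> G) holomorphic_on S" using fD C(2) by (auto simp: holomorphic_on_open)
    show "immersion_on S (X \<circ> G)"
      unfolding XG using imm C(1) by (intro immersion_on_compose[OF _ cf(2) C(2,5,6,7)]) (auto simp: immersion_def)
    show "X (G \<zeta>) = R ((deriv l (Re (f (G \<zeta>))) / 2) *\<^sub>R grad_vec (exp \<zeta>) (deriv (f \<circ> G) \<zeta> / exp \<zeta>)
        + l (Re (f (G \<zeta>))) *\<^sub>R grt_normal (exp \<zeta>))" if "\<zeta> \<in> S" for \<zeta>
    proof -
      have "grad_vec (g (G \<zeta>)) (ratio (G \<zeta>)) = R (grad_vec (exp \<zeta>) (deriv (f \<circ> G) \<zeta> / exp \<zeta>))"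
        unfolding ratio[OF that] gE[OF that] R_def by (rule grad_vec_moebius[OF unit' D[OF that]])
      thus ?thesis unfolding X_ratio[of "G \<zeta>"] nG[OF that] linear_add[OF lin] linear_scale[OF lin] by simp
    qed
    show "axial (R d) (G \<zeta>) = deriv (f \<circ> G) \<zeta> * (rot_field d (exp \<zeta>) / exp \<zeta>)" if "\<zeta> \<in> S" for \<zeta> d
      unfolding axial_def ratio[OF that] gE[OF that] R_def
      using rot_field_moebius[OF unit' D[OF that], of d] by (simp add: mult_ac)
  qed (use C mG nG in \<open>auto simp: G_def \<kappa>_def\<close>)
qed

text \<open>
  If \<open>rot_field d\<close> vanished along \<open>g\<close> on an open set, so would its derivative, as \<open>g' \<noteq> 0\<close>; but its zeros are simple.
\<close>
lemma rot_field_nonzero_in_chart: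
  assumes d: "d \<noteq> 0" and c: "c \<in> A" and B: "open B" "B \<noteq> {}" "B \<subseteq> chart_image c"
  shows "\<exists>z\<in>B. rot_field d (in_chart c g z) \<noteq> 0"
proof (rule ccontr)
  assume "\<not> ?thesis"
  hence all: "rot_field d (in_chart c g z) = 0" if "z \<in> B" for z using that by blast
  obtain z where z: "z \<in> B" using B(2) by blast
  hence zc: "z \<in> chart_image c" using B(3) by blast
  note cf = chart_facts[OF c]
  let ?w = "in_chart c g z"
  have "((\<lambda>z. rot_field d (in_chart c g z)) has_field_derivative \<i> * (cnj (fst d) * ?w + of_real (snd d)) * deriv (in_chart c g) z) (at z)"
    by (intro DERIV_chain2[OF rot_field_deriv] holomorphic_derivI[OF cf(8) cf(2) zc])
  moreover have "((\<lambda>z. rot_field d (in_chart c g z)) has_field_derivative 0) (at z)"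
    by (rule has_field_derivative_transform_within_open[OF DERIV_const B(1) z]) (simp add: all)
  ultimately have "\<i> * (cnj (fst d) * ?w + of_real (snd d)) * deriv (in_chart c g) z = 0"
    using DERIV_unique by blast
  hence "cnj (fst d) * ?w + of_real (snd d) = 0" using g'_nz[OF c zc] by simp
  thus False using rot_field_simple_zero[OF all[OF z]] d by simp
qed

text \<open>
  Where \<open>f' \<noteq> 0\<close>, the rotation field would have to vanish along \<open>g\<close> on an open set.
\<close>
lemma f_constant_if_axial_zero:
  assumes d: "d \<noteq> 0" and z: "\<And>p. axial d p = 0"
  shows "f p = f q"
proof (rule locally_constant_imp_constant[OF surface(2)])
  fix p :: 'a
  obtain c z0 r where c: "c \<in> A" "r > 0" "ball z0 r \<subseteq> chart_image c" "inv_into (fst c) (snd c) z0 = p"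
    "open (inv_into (fst c) (snd c) ` ball z0 r)"
    using coordinate_disc[OF surface(1) open_UNIV UNIV_I[of p]] by (metis open_ball)
  note cf = chart_facts[OF c(1)]
  have d0: "deriv (in_chart c f) w = 0" if w: "w \<in> ball z0 r" for w
  proof (rule ccontr)
    assume nz: "deriv (in_chart c f) w \<noteq> 0"
    define B where "B = ball z0 r \<inter> deriv (in_chart c f) -` (- {0})"
    have "deriv (in_chart c f) holomorphic_on ball z0 r"
      using holomorphic_deriv[OF cf(7) cf(2)] c(3) holomorphic_on_subset by blast
    hence "open B" unfolding B_def
      by (intro continuous_open_preimage holomorphic_on_imp_continuous_on) auto
    moreover have "B \<noteq> {}" using w nz by (auto simp: B_def)
    moreover have "B \<subseteq> chart_image c" using c(3) by (auto simp: B_def)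
    ultimately obtain v where v: "v \<in> B" "v \<in> chart_image c" "rot_field d (in_chart c g v) \<noteq> 0"
      using rot_field_nonzero_in_chart[OF d c(1)] by blast
    have "axial d (inv_into (fst c) (snd c) v) = deriv (in_chart c f) v / deriv (in_chart c g) v * rot_field d (in_chart c g v)"
      using X_chart(1)[OF c(1) cf(4)[OF v(2)]] cf(5)[OF v(2)] by (simp add: axial_def in_chart_def)
    thus False using z v g'_nz[OF c(1) v(2)] by (simp add: B_def)
  qed
  have "\<exists>k. \<forall>w\<in>ball z0 r. in_chart c f w = k"
  proof (rule has_field_derivative_zero_constant)
    fix w assume w: "w \<in> ball z0 r"
    hence "(in_chart c f has_field_derivative 0) (at w)"
      using holomorphic_derivI[OF cf(7) cf(2), of w] c(3) d0[OF w] by auto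
    thus "(in_chart c f has_field_derivative 0) (at w within ball z0 r)" by (rule has_field_derivative_at_within)
  qed simp
  then obtain k where k: "\<And>w. w \<in> ball z0 r \<Longrightarrow> in_chart c f w = k" by blast
  have "f q = k" if "q \<in> inv_into (fst c) (snd c) ` ball z0 r" for q using that k by (auto simp: in_chart_def)
  moreover have "p \<in> inv_into (fst c) (snd c) ` ball z0 r" using c(2,4) by (metis centre_in_ball imageI)
  ultimately show "\<exists>W. open W \<and> p \<in> W \<and> (\<forall>q\<in>W. f q = f p)"
    using c(5) by (intro exI[of _ "inv_into (fst c) (snd c) ` ball z0 r"]) auto
qed

text \<open>
  Locally \<open>f = a \<zeta> + k\<close> in the adapted coordinate. The constant \<open>b = Re k\<close> is the value of the function \<open>bf\<close>, which does not
  mention the coordinate and is locally constant. If \<open>a \<noteq> 0\<close> there are no poles, so \<open>bf\<close> is constant on the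
  connected surface; if \<open>a = 0\<close> then already \<open>f\<close> is constant.
\<close>
lemma parametrization_off_poles:
  assumes ab: "(cmod \<alpha>)\<^sup>2 + (cmod \<beta>)\<^sup>2 = 1" "rotation (cnj \<alpha>) (- \<beta>) (0, 1) = d"
      "\<And>w. rot_field d w = \<i> * (\<alpha> * w + \<beta>) * (cnj \<alpha> - cnj \<beta> * w)"
    and d: "norm d = 1"
    and const: "\<And>p. axial d p = \<i> * of_real a"
  obtains b where "\<And>p. rot_field d (g p) \<noteq> 0 \<Longrightarrow> parametrizes_near X (rotation (cnj \<alpha>) (- \<beta>) \<circ> X_ab l a b) p"
proof -
  define R where "R = rotation (cnj \<alpha>) (- \<beta>)"
  define bf where "bf p = Re (f p) - a * ln (cmod (moebius \<alpha> \<beta> (g p)))" for p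
  have local: "parametrizes_near X (R \<circ> X_ab l a (bf p)) p \<and> (\<exists>W. open W \<and> p \<in> W \<and> (\<forall>q\<in>W. bf q = bf p))"
    if V: "rot_field d (g p) \<noteq> 0" for p
  proof -
    have nz: "\<alpha> * g p + \<beta> \<noteq> 0" "cnj \<alpha> - cnj \<beta> * g p \<noteq> 0" using V unfolding ab(3) by auto
    obtain S \<zeta>0 G H where S: "open S" "connected S" "\<zeta>0 \<in> S" "G \<zeta>0 = p" "open (G ` S)" "homeomorphism S (G ` S) G H"
      "(f \<circ> G) holomorphic_on S" "immersion_on S (X \<circ> G)"
      and mG: "\<And>\<zeta>. \<zeta> \<in> S \<Longrightarrow> moebius \<alpha> \<beta> (g (G \<zeta>)) = exp \<zeta>"
      and nG: "\<And>\<zeta>. \<zeta> \<in> S \<Longrightarrow> grt_normal (g (G \<zeta>)) = R (grt_normal (exp \<zeta>))"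
      and XG: "\<And>\<zeta>. \<zeta> \<in> S \<Longrightarrow> X (G \<zeta>) = R ((deriv l (Re (f (G \<zeta>))) / 2) *\<^sub>R grad_vec (exp \<zeta>) (deriv (f \<circ> G) \<zeta> / exp \<zeta>)
        + l (Re (f (G \<zeta>))) *\<^sub>R grt_normal (exp \<zeta>))"
      and aG: "\<And>\<zeta> d. \<zeta> \<in> S \<Longrightarrow> axial (R d) (G \<zeta>) = deriv (f \<circ> G) \<zeta> * (rot_field d (exp \<zeta>) / exp \<zeta>)"
      by (fact adapted_coordinate[OF ab(1) nz, folded R_def])
    have f1: "deriv (f \<circ> G) \<zeta> = of_real a" if "\<zeta> \<in> S" for \<zeta>
      using aG[OF that, of "(0, 1)"] const ab(2) by (simp add: R_def rot_field_axis)
    have "(\<lambda>\<zeta>. (f \<circ> G) \<zeta> - of_real a * \<zeta>) constant_on S"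
    proof (rule has_field_derivative_0_imp_constant_on[OF _ S(2,1)])
      fix \<zeta> assume z: "\<zeta> \<in> S"
      show "((\<lambda>\<zeta>. (f \<circ> G) \<zeta> - of_real a * \<zeta>) has_field_derivative 0) (at \<zeta>)"
        using DERIV_diff[OF holomorphic_derivI[OF S(7,1) z] DERIV_cmult_Id[of "of_real a"]] f1[OF z] by simp
    qed
    then obtain k where k: "\<And>\<zeta>. \<zeta> \<in> S \<Longrightarrow> f (G \<zeta>) - of_real a * \<zeta> = k" unfolding constant_on_def by auto
    have fG: "Re (f (G \<zeta>)) = a * Re \<zeta> + Re k" if "\<zeta> \<in> S" for \<zeta>
    proof -
      have "f (G \<zeta>) = k + of_real a * \<zeta>" using k[OF that] by (simp add: algebra_simps)
      thus ?thesis by simp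
    qed
    have bfk: "bf (G \<zeta>) = Re k" if "\<zeta> \<in> S" for \<zeta>
      using fG[OF that] by (simp add: bf_def mG[OF that])
    have bp: "bf p = Re k" using bfk[OF S(3)] S(4) by simp
    have XX: "X (G \<zeta>) = R (X_ab l a (bf p) \<zeta>)" if "\<zeta> \<in> S" for \<zeta>
      unfolding XG[OF that] f1[OF that] fG[OF that] X_ab_eq bp ..
    moreover have "immersion_on S (R \<circ> X_ab l a (bf p))"
      using XX by (intro immersion_on_cong[OF S(1) _ S(8)]) simp
    moreover have pS: "p \<in> G ` S" using S(3,4) by blast
    ultimately have "parametrizes_near X (R \<circ> X_ab l a (bf p)) p"
      unfolding parametrizes_near_def using S(1,5,6)
      by (intro exI[of _ S] exI[of _ "G ` S"] exI[of _ G] exI[of _ H]) simp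
    moreover have "\<forall>q\<in>G ` S. bf q = bf p" using bfk bp by simp
    ultimately show ?thesis using S(5) pS by blast
  qed
  have bconst: "bf p = bf q" for p q
  proof (cases "a = 0")
    case True
    have "d \<noteq> 0" using d by auto
    thus ?thesis using f_constant_if_axial_zero[of d p q] const True by (simp add: bf_def)
  next
    case False
    have V: "rot_field d (g p) \<noteq> 0" for p using const[of p] False by (auto simp: axial_def)
    show ?thesis
    proof (rule locally_constant_imp_constant[OF surface(2)])
      fix p
      show "\<exists>W. open W \<and> p \<in> W \<and> (\<forall>q\<in>W. bf q = bf p)" using local[OF V[of p]] by blast
    qed
  qed
  define p0 :: 'a where "p0 = undefined"
  show ?thesis
  proof (rule that[of "bf p0"])
    fix p assume "rot_field d (g p) \<noteq> 0"
    hence "parametrizes_near X (R \<circ> X_ab l a (bf p)) p" using local by blast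
    thus "parametrizes_near X (rotation (cnj \<alpha>) (- \<beta>) \<circ> X_ab l a (bf p0)) p"
      by (simp only: bconst[of p p0] R_def)
  qed
qed

section \<open>Rotational surfaces and the normal form\<close>
lemma constant_axial_imp:
  assumes d: "norm d = 1" and const: "\<And>p. axial d p = \<i> * of_real a"
  shows "rotational X" "\<exists>a b R. orthogonal_transformation R \<and> locally_X_ab X l R a b"
proof -
  obtain \<alpha> \<beta> where ab: "(cmod \<alpha>)\<^sup>2 + (cmod \<beta>)\<^sup>2 = 1" "rotation (cnj \<alpha>) (- \<beta>) (0, 1) = d"
    "\<And>w. rot_field d w = \<i> * (\<alpha> * w + \<beta>) * (cnj \<alpha> - cnj \<beta> * w)"
    using exists_rotation_to_axis[OF d] by blast
  define R where "R = rotation (cnj \<alpha>) (- \<beta>)"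
  have ab': "(cmod (cnj \<alpha>))\<^sup>2 + (cmod (- \<beta>))\<^sup>2 = 1" using ab(1) by simp
  have R: "orthogonal_transformation R" unfolding R_def by (rule rotation_orthogonal[OF ab'])
  have lin: "linear R" using R by (rule orthogonal_transformation_linear)
  obtain b where b: "\<And>p. rot_field d (g p) \<noteq> 0 \<Longrightarrow> parametrizes_near X (R \<circ> X_ab l a b) p"
    using parametrization_off_poles[OF ab d const] unfolding R_def by blast
  have d0: "d \<noteq> 0" using d by auto
  have a0: "a = 0" if "rot_field d (g p) = 0" for p using const[of p] that by (simp add: axial_def)
  have fc: "f p = f q" if "a = 0" for p q using f_constant_if_axial_zero[OF d0] const that by simp
  \<comment> \<open>For \<open>a = 0\<close> the gradient part vanishes and the surface lies in a sphere about the origin.\<close>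
  have sphere: "X p = l (Re (f p)) *\<^sub>R grt_normal (g p)" if a: "a = 0" for p
  proof -
    obtain c where c: "c \<in> A" "p \<in> fst c" by (rule obtain_chart)
    have "in_chart c f = (\<lambda>z. f p)" unfolding in_chart_def o_def using fc[OF a] by blast
    hence "ratio p = 0" using X_chart(1)[OF c] by simp
    thus ?thesis using X_ratio[of p] by (simp add: grad_vec_def zero_prod_def[symmetric])
  qed
  have near: "rotational_near X 0 d p" for p
  proof (cases "rot_field d (g p) = 0")
    case False
    from rotational_near_if_parametrized[OF l1 l2 R b[OF this]] show ?thesis using ab(2) by (simp add: R_def)
  next
    case True
    hence a: "a = 0" by (rule a0)
    obtain c z0 r where c: "c \<in> A" "z0 = snd c p" "p \<in> fst c" "r > 0" "ball z0 r \<subseteq> chart_image c" "inv_into (fst c) (snd c) z0 = p"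
      "homeomorphism (ball z0 r) (inv_into (fst c) (snd c) ` ball z0 r) (inv_into (fst c) (snd c)) (snd c)"
      "\<And>B. open B \<Longrightarrow> B \<subseteq> chart_image c \<Longrightarrow> open (inv_into (fst c) (snd c) ` B)"
      using coordinate_disc[OF surface(1) open_UNIV UNIV_I[of p]] by metis
    note cf = chart_facts[OF c(1)]
    have z0: "z0 \<in> chart_image c" using c(4,5) by auto
    obtain s where s: "s > 0" "ball z0 s \<subseteq> ball z0 r" "inj_on (in_chart c g) (ball z0 s)"
    proof -
      have "in_chart c g holomorphic_on ball z0 r" using cf(8) c(5) holomorphic_on_subset by blast
      thus ?thesis using has_complex_derivative_locally_injective[of "in_chart c g" "ball z0 r" z0] c(4) g'_nz[OF c(1) z0] that by auto
    qed
    have "ball z0 s \<subseteq> chart_image c" using s(2) c(5) by blast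
    hence hol: "in_chart c g holomorphic_on ball z0 s" and op: "open (inv_into (fst c) (snd c) ` ball z0 s)"
      using cf(8) holomorphic_on_subset c(8) by blast+
    have hom: "homeomorphism (ball z0 s) (inv_into (fst c) (snd c) ` ball z0 s) (inv_into (fst c) (snd c)) (snd c)"
      using c(7) s(2) by (rule homeomorphism_of_subsets) (use s(2) in auto)
    have "X (inv_into (fst c) (snd c) z) = l (Re (f p)) *\<^sub>R grt_normal (in_chart c g z)" for z
      using sphere[OF a, of "inv_into (fst c) (snd c) z"] fc[OF a, of "inv_into (fst c) (snd c) z" p]
      by (simp add: in_chart_def)
    from rotational_near_sphere[OF l_nz d open_ball _ op hom hol s(3) this]
    show ?thesis using s(1) c(6) by force
  qed
  show "rotational X" unfolding rotational_iff using near d by blast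
  have "parametrizes_near X (R \<circ> X_ab l a b) p" if "X p \<notin> range (\<lambda>t. R (0, t))" for p
  proof -
    \<comment> \<open>At a pole the normal is parallel to the axis, and so is the position, contrary to the assumption on \<open>p\<close>.\<close>
    have "rot_field d (g p) \<noteq> 0"
    proof
      assume z: "rot_field d (g p) = 0"
      let ?x = "grt_normal (g p)"
      define y where "y = rotation \<alpha> \<beta> ?x"
      have "R y = ?x" unfolding R_def y_def by (rule rotation_inverse[OF ab(1)])
      have "fst y = 0"
      proof -
        define T where "T = 1 / (1 + (cmod (g p))\<^sup>2)"
        have "rotation \<alpha> \<beta> (T *\<^sub>R u) = T *\<^sub>R rotation \<alpha> \<beta> u" for u
          using linear_scale[OF orthogonal_transformation_linear[OF rotation_orthogonal[OF ab(1)]]] .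
        hence "fst y = T *\<^sub>R (fst (rotation \<alpha> \<beta> (2 * g p, 1 - (cmod (g p))\<^sup>2)))"
          by (simp only: y_def grt_normal_def T_def[symmetric] fst_scaleR)
        also have "fst (rotation \<alpha> \<beta> (2 * g p, 1 - (cmod (g p))\<^sup>2)) = 2 * (\<alpha> * g p + \<beta>) * cnj (cnj \<alpha> - cnj \<beta> * g p)"
          unfolding rotation_def fst_conv snd_conv of_real_diff complex_norm_square
          by (simp add: algebra_simps power2_eq_square)
        also have "\<dots> = 0" using z unfolding ab(3) by (auto simp del: complex_cnj_diff distrib_left_numeral)
        finally show ?thesis by simp
      qed
      hence "y = (0, snd y)" by (simp add: prod_eq_iff)
      hence "?x = R (0, snd y)" using \<open>R y = ?x\<close> by metis
      hence "X p = R (0, l (Re (f p)) * snd y)"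
        using sphere[OF a0[OF z], of p] linear_scale[OF lin, of "l (Re (f p))" "(0, snd y)"] by simp
      thus False using that by blast
    qed
    thus ?thesis by (rule b)
  qed
  hence "locally_X_ab X l R a b" unfolding locally_X_ab_def by blast
  thus "\<exists>a b R. orthogonal_transformation R \<and> locally_X_ab X l R a b" using R by blast
qed

text \<open>
  The hypothesis is what \<open>rotational_near_normal\<close> gives. The vector \<open>cross x0 d\<close> measures the failure of the axis to
  pass through the origin; when it is nonzero, the surface is locally a sphere and \<open>d'\<close> is the direction of its centre.
\<close>
lemma axis_through_origin:
  assumes d: "norm d = 1" and normal: "\<And>p. (X p - x0) \<bullet> cross d (grt_normal (g p)) = 0"
  obtains d' U where "norm d' = 1" "open U" "U \<noteq> {}" "\<And>p. p \<in> U \<Longrightarrow> Re (axial d' p) = 0"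
proof -
  have key: "deriv l (Re (f p)) * Re (axial d p) = grt_normal (g p) \<bullet> cross x0 d" for p
  proof -
    have "x0 \<bullet> cross d (grt_normal (g p)) = grt_normal (g p) \<bullet> cross x0 d"
      by (simp add: inner_space3 cross_def algebra_simps)
    thus ?thesis using normal[of p] X_axial[of p d] by (simp add: inner_diff_left)
  qed
  show ?thesis
  proof (cases "cross x0 d = 0")
    case True
    hence "Re (axial d p) = 0" for p using key[of p] l'_nz by simp
    thus ?thesis using that[of d UNIV] d by simp
  next
    case False
    obtain \<alpha> \<beta> where ab: "(cmod \<alpha>)\<^sup>2 + (cmod \<beta>)\<^sup>2 = 1" "rotation (cnj \<alpha>) (- \<beta>) (0, 1) = d"
      "\<And>w. rot_field d w = \<i> * (\<alpha> * w + \<beta>) * (cnj \<alpha> - cnj \<beta> * w)"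
      using exists_rotation_to_axis[OF d] by blast
    define R where "R = rotation (cnj \<alpha>) (- \<beta>)"
    have ab': "(cmod (cnj \<alpha>))\<^sup>2 + (cmod (- \<beta>))\<^sup>2 = 1" using ab(1) by simp
    have R: "orthogonal_transformation R" unfolding R_def by (rule rotation_orthogonal[OF ab'])
    have inner: "R x \<bullet> R y = x \<bullet> y" for x y using R unfolding orthogonal_transformation_def by blast
    obtain e where e: "cross x0 d = R e" using orthogonal_transformation_surj[OF R] by (metis surjD)
    have "snd e = 0"
    proof -
      have "snd e = R e \<bullet> R (0, 1)" unfolding inner by (simp add: inner_space3)
      also have "\<dots> = 0" unfolding e[symmetric] using cross_self_inner(1)[of d x0] ab(2) by (simp add: R_def inner_commute)
      finally show ?thesis .
    qed
    define E where "E = fst e"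
    have eE: "e = (E, 0)" using \<open>snd e = 0\<close> by (simp add: E_def prod_eq_iff)
    have E0: "E \<noteq> 0"
    proof
      assume "E = 0"
      hence "e = 0" by (simp add: eE zero_prod_def)
      thus False using False e linear_0[OF orthogonal_transformation_linear[OF R]] by simp
    qed
    have d0: "d \<noteq> 0" using d by auto
    obtain p where p: "rot_field d (g p) \<noteq> 0"
    proof -
      obtain c where c: "c \<in> A" "undefined \<in> fst c" by (rule obtain_chart)
      have "chart_image c \<noteq> {}" using c(2) by (auto simp: chart_image_def)
      from rot_field_nonzero_in_chart[OF d0 c(1) chart_facts(2)[OF c(1)] this] show ?thesis
        using that by (auto simp: in_chart_def)
    qed
    have nz: "\<alpha> * g p + \<beta> \<noteq> 0" "cnj \<alpha> - cnj \<beta> * g p \<noteq> 0" using p unfolding ab(3) by auto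
    obtain S \<zeta>0 G H where S: "open S" "connected S" "\<zeta>0 \<in> S" "G \<zeta>0 = p" "open (G ` S)" "homeomorphism S (G ` S) G H"
      "(f \<circ> G) holomorphic_on S" "immersion_on S (X \<circ> G)"
      and mG: "\<And>\<zeta>. \<zeta> \<in> S \<Longrightarrow> moebius \<alpha> \<beta> (g (G \<zeta>)) = exp \<zeta>"
      and nG: "\<And>\<zeta>. \<zeta> \<in> S \<Longrightarrow> grt_normal (g (G \<zeta>)) = R (grt_normal (exp \<zeta>))"
      and XG: "\<And>\<zeta>. \<zeta> \<in> S \<Longrightarrow> X (G \<zeta>) = R ((deriv l (Re (f (G \<zeta>))) / 2) *\<^sub>R grad_vec (exp \<zeta>) (deriv (f \<circ> G) \<zeta> / exp \<zeta>)
        + l (Re (f (G \<zeta>))) *\<^sub>R grt_normal (exp \<zeta>))"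
      and aG: "\<And>\<zeta> d. \<zeta> \<in> S \<Longrightarrow> axial (R d) (G \<zeta>) = deriv (f \<circ> G) \<zeta> * (rot_field d (exp \<zeta>) / exp \<zeta>)"
      by (fact adapted_coordinate[OF ab(1) nz, folded R_def])
    have eq: "deriv l (Re ((f \<circ> G) \<zeta>)) * Im (deriv (f \<circ> G) \<zeta>) = - (Re (cnj E * cis (Im \<zeta>)) / cosh (Re \<zeta>))"
      if z: "\<zeta> \<in> S" for \<zeta>
    proof -
      have "axial d (G \<zeta>) = \<i> * deriv (f \<circ> G) \<zeta>"
        using aG[OF z, of "(0, 1)"] ab(2) by (simp add: R_def rot_field_axis)
      hence "deriv l (Re (f (G \<zeta>))) * - Im (deriv (f \<circ> G) \<zeta>) = grt_normal (g (G \<zeta>)) \<bullet> cross x0 d"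
        using key[of "G \<zeta>"] by simp
      also have "\<dots> = grt_normal (exp \<zeta>) \<bullet> e" unfolding nG[OF z] e inner ..
      also have "\<dots> = Re (cnj E * cis (Im \<zeta>)) / cosh (Re \<zeta>)"
        unfolding grt_normal_exp eE inner_space3 by (simp add: algebra_simps add_divide_distrib)
      finally show ?thesis by simp
    qed
    obtain U d' where U: "open U" "U \<noteq> {}" "U \<subseteq> S" "d' \<noteq> 0"
      "\<And>z. z \<in> U \<Longrightarrow> Re (deriv (f \<circ> G) z * (rot_field d' (exp z) / exp z)) = 0"
      using off_axis_surface_is_sphere[of l S \<zeta>0 "f \<circ> G" E, OF l1 l2 l'_nz S(1,3,7) E0 eq] by blast
    define d2 where "d2 = (1 / norm (R d')) *\<^sub>R R d'"
    have nR: "norm (R d') \<noteq> 0" using orthogonal_transformation_norm[OF R, of d'] U(4) by simp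
    show ?thesis
    proof (rule that[of d2 "G ` U"])
      show "norm d2 = 1" using nR by (simp add: d2_def)
      have "openin (top_of_set (G ` S)) (G ` U)"
        using U(1,3) by (intro homeomorphism_imp_open_map[OF S(6)] open_subset)
      thus "open (G ` U)" using S(5) openin_open_trans by blast
      show "G ` U \<noteq> {}" using U(2) by simp
      show "Re (axial d2 q) = 0" if q: "q \<in> G ` U" for q
      proof -
        obtain z where z: "z \<in> U" "q = G z" using q by blast
        have "axial d2 q = of_real (1 / norm (R d')) * axial (R d') q"
          unfolding axial_def d2_def rot_field_scaleR by (simp add: mult_ac)
        hence "Re (axial d2 q) = (1 / norm (R d')) * Re (axial (R d') q)" by simp
        also have "\<dots> = 0" using aG[of z d'] U(3,5) z by auto
        finally show ?thesis .
      qed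
    qed
  qed
qed

lemma rotational_iff_locally_X_ab:
  "rotational X \<longleftrightarrow> (\<exists>a b R. orthogonal_transformation R \<and> locally_X_ab X l R a b)"
proof
  assume "rotational X"
  then obtain x0 d where d: "norm d = 1" "\<And>p. rotational_near X x0 d p" unfolding rotational_iff by blast
  obtain d' U where U: "norm d' = 1" "open U" "U \<noteq> {}" "\<And>p. p \<in> U \<Longrightarrow> Re (axial d' p) = 0"
    using axis_through_origin[OF d(1) rotational_near_normal[OF d(2,1)]] by blast
  obtain a where "\<And>p. axial d' p = \<i> * of_real a"
    using holomorphic_map_constant_if_Re_zero[OF surface holomorphic_axial U(2-4)] by blast
  thus "\<exists>a b R. orthogonal_transformation R \<and> locally_X_ab X l R a b" by (rule constant_axial_imp(2)[OF U(1)])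
next
  assume "\<exists>a b R. orthogonal_transformation R \<and> locally_X_ab X l R a b"
  then obtain a b R where R: "orthogonal_transformation R" "locally_X_ab X l R a b" by blast
  define d where "d = R (0, 1)"
  have d: "norm d = 1" unfolding d_def orthogonal_transformation_norm[OF R(1)] by (simp add: norm_prod_def)
  have "Re (axial d p) = 0" for p
    using locally_X_ab_normal[OF R, of p] X_axial[of p d] l'_nz by (simp add: d_def)
  then obtain a where "\<And>p. axial d p = \<i> * of_real a"
    using holomorphic_map_constant_if_Re_zero[OF surface holomorphic_axial open_UNIV] by blast
  thus "rotational X" by (rule constant_axial_imp(1)[OF d])
qed

end

theorem theorem2p6:
  fixes A :: "'a::t2_space chart set"
    and X :: "'a \<Rightarrow> space3"
    and f g :: "'a \<Rightarrow> complex"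
    and l :: "real \<Rightarrow> real"
  assumes surface: "riemann_surface A" "connected (UNIV :: 'a set)"
    and holo: "holomorphic_map A f" "holomorphic_map A g"
    and g'_nz: "\<And>c z. c \<in> A \<Longrightarrow> z \<in> chart_image c \<Longrightarrow> deriv (in_chart c g) z \<noteq> 0"
    and l_C2: "\<And>t. l field_differentiable (at t)" "\<And>t. deriv l field_differentiable (at t)"
      "continuous_on UNIV (deriv (deriv l))"
    and l'_nz: "\<And>t. deriv l t \<noteq> 0"
    and X_eq: "\<And>c p. c \<in> A \<Longrightarrow> p \<in> fst c \<Longrightarrow>
      X p = grt_point l (f p) (g p) (deriv (in_chart c f) (snd c p)) (deriv (in_chart c g) (snd c p))"
    and GRT: "GRT_surface A X (\<lambda>p. grt_normal (g p)) (\<lambda>p. 1 \<bullet> f p)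
      (\<lambda>t. l t * deriv (deriv l) t / (deriv l t)\<^sup>2)"
  shows "rotational X \<longleftrightarrow>
    (\<exists>a b R. orthogonal_transformation R \<and> locally_X_ab X l R a b)"
proof -
  have "l (Re (f p)) \<noteq> 0" for p
  proof -
    have "l (1 \<bullet> f p) * deriv (deriv l) (1 \<bullet> f p) / (deriv l (1 \<bullet> f p))\<^sup>2 \<noteq> 0"
      using GRT unfolding GRT_surface_def by blast
    thus ?thesis by (auto simp: inner_complex_def)
  qed
  moreover have "immersion A X" "gauss_map A X (\<lambda>p. grt_normal (g p))"
    using GRT unfolding GRT_surface_def by blast+
  ultimately interpret grt_data A X f g l
    by unfold_locales (use surface holo g'_nz l_C2 l'_nz X_eq in auto)
  show ?thesis by (rule rotational_iff_locally_X_ab)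
qed

end
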